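(* Let $T$ be a tree of order at least $2$. Then $T$ is $\gamma_R$-excellent if and only if there is a labeling $S:V(T)\rightarrow\{A,B,C,D\}$ such that $(T,S)\in\mathscr{T}$. Moreover, if $(T,S)\in\mathscr{T}$, then $S_B(T)=\{x\in V^{02}(T)\mid \deg(x)=2 \text{ and } |N(x)\cap V^{02}(T)|=1\}$, $S_A(T)=V^{01}(T)$, $S_D(T)=V^{012}(T)$, and $S_C(T)=V^{02}(T)-S_B(T)$.
   Context: All graphs are finite and simple. A Roman dominating function (RDF) on a graph $G$ is a map $f:V(G)\to\{0,1,2\}$ such that every vertex $v$ with $f(v)=0$ has a neighbor $u$ with $f(u)=2$; its weight is $\sum_{v}f(v)$. The Roman domination number $\gamma_R(G)$ is the minimum weight of an RDF on $G$, and an RDF of weight $\gamma_R(G)$ is a $\gamma_R$-function. For $X\subseteq\{0,1,2\}$, $V^{X}(G)$ denotes the set of vertices $v$ with $\{f(v): f \text{ a } \gamma_R\text{-function on } G\}=X$; we write $V^{01}(G)=V^{\{0,1\}}(G)$, $V^{02}(G)=V^{\{0,2\}}(G)$, $V^{012}(G)=V^{\{0,1,2\}}(G)$. $G$ is $\gamma_R$-excellent if for every vertex $v$ there is a $\gamma_R$-function $f$ with $f(v)\neq 0$. A labeling of a tree $T$ is a map $S:V(T)\to\{A,B,C,D\}$; $S(v)$ is the status of $v$, and $S_X(T)$ is the set of vertices of status $X$. Labeled trees used (statuses indicated): $(H_1,I^1)$: $K_2$, both vertices of status $D$. $(H_2,I^2)$: path on 4 vertices, endpoints of status $A$, the two inner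 vertices of status $B$. $(H_3,I^3)$: two adjacent vertices $c_1,c_2$ of status $C$, each adjacent to two leaves of status $A$ (6 vertices). $(H_4,I^4)$: adjacent $c_1,c_2$ of status $C$; $c_1$ adjacent to two leaves of status $A$; $c_2$ adjacent to one leaf of status $A$ and to a vertex $d$ of status $D$ which is adjacent to a leaf $d'$ of status $D$ (7 vertices). $(H_5,I^5)$: adjacent $c_1,c_2$ of status $C$; each $c_i$ is adjacent to one leaf of status $A$ and to a vertex $d_i$ of status $D$ which is adjacent to a leaf $d_i'$ of status $D$ (8 vertices). $(H_6,I^6)$: adjacent $c_1,c_2$ of status $C$; $c_1$ adjacent to two leaves of status $A$; $c_2$ adjacent to two vertices $d_1,d_2$ of status $D$, each $d_i$ adjacent to a leaf $d_i'$ of status $D$ (8 vertices). $(H_7,I^7)$: adjacent $c_1,c_2$ of status $C$; $c_1$ adjacent to one leaf of status $A$ and to a vertex $d_1$ of status $D$ adjacent to a leaf $d_1'$ of status $D$; $c_2$ adjacent to two vertices $d_2,d_3$ of status $D$, each $d_i$ adjacent to a leaf $d_i'$ of status $D$ (9 vertices). $(F_1,J^1)$: path $a,x,a'$ with statuses $A,C,A$. $(F_2,J^2)$: path $a,x,d,d'$ with statuses $A,C,D,D$. $(F_3,J^3)$: path $d',d,x,e,e'$ with statuses $D,D,C,D,D$. $(F_4,J^4)$: path $x,d,d'$ with statuses $C,D,D$. In each $F_i$, $x$ denotes the unique vertex of status $C$. Operations on a labeled tree $(T',S')$ (all existing vertices keep their statuses, and added vertices keep the statuses from the copy): $O_1$: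 add a disjoint copy of some $(F,J)\in\{(F_1,J^1),(F_2,J^2),(F_3,J^3)\}$ and the edge $ux$, where $u\in V(T')$ has status $C$ and $x$ is the status-$C$ vertex of $F$. $O_2$: add a disjoint copy of $(F_4,J^4)$ and the edge $ux$, where $u\in V(T')$ has status $D$ and $x$ is the status-$C$ vertex of $F_4$. $O_3$: take a disjoint copy of $(H_k,I^k)$, $k\in\{2,\dots,7\}$, and identify a vertex $u$ of $T'$ of status $A$ with a vertex $v$ of $H_k$ of status $A$; the identified vertex has status $A$. $O_4$: take a disjoint copy of $(H_k,I^k)$, $k\in\{3,4,6\}$, and identify a vertex $u$ of $T'$ of status $D$ with a vertex $v$ of $H_k$ of status $A$; the identified vertex has status $D$. $\mathscr{T}$ is the family of labeled trees $(T,S)$ for which there is a sequence $(T^1,S^1),\dots,(T^j,S^j)$, $j\ge1$, with $(T^1,S^1)$ (a copy of) one of $(H_1,I^1),\dots,(H_5,I^5)$, $(T^j,S^j)=(T,S)$, and each $(T^{i+1},S^{i+1})$ obtained from $(T^i,S^i)$ by one of $O_1,O_2,O_3,O_4$. *)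

theory Defs
  imports "Graph_Theory.Digraph_Component"
begin

text \<open>
  Finite simple graphs are modelled by the locale predicate \<open>pair_graph\<close>: every undirected edge
  is represented by its two orientations in \<open>parcs\<close>.  The constant \<open>tree\<close> of the library is about
  digraphs: there the closed walk u, v, u is a cycle, so no symmetric digraph with an edge is
  a \<open>tree\<close>.  Undirected cycles are those cycles of the library that have length at least 3.
\<close>

definition undirected_tree :: "'a pair_pre_digraph \<Rightarrow> bool" where
  "undirected_tree G \<longleftrightarrow> pair_graph G \<and> connected (with_proj G) \<and>
     (\<nexists>p. pre_digraph.cycle (with_proj G) p \<and> length p \<ge> 3)"

definition neighborhood :: "'a pair_pre_digraph \<Rightarrow> 'a \<Rightarrow> 'a set" where
  "neighborhood G v = {u. (v, u) \<in> parcs G}"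

definition degree :: "'a pair_pre_digraph \<Rightarrow> 'a \<Rightarrow> nat" where
  "degree G v = out_degree (with_proj G) v"


section \<open>Roman domination\<close>

text \<open>Values of \<open>f\<close> outside the vertex set are irrelevant and left unconstrained.\<close>

definition roman_dominating :: "'a pair_pre_digraph \<Rightarrow> ('a \<Rightarrow> nat) \<Rightarrow> bool" where
  "roman_dominating G f \<longleftrightarrow> f ` pverts G \<subseteq> {0, 1, 2} \<and>
     (\<forall>v\<in>pverts G. f v = 0 \<longrightarrow> (\<exists>u\<in>neighborhood G v. f u = 2))"

definition weight :: "'a pair_pre_digraph \<Rightarrow> ('a \<Rightarrow> nat) \<Rightarrow> nat" where
  "weight G f = (\<Sum>v\<in>pverts G. f v)"

definition roman_number :: "'a pair_pre_digraph \<Rightarrow> nat" where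
  "roman_number G = (LEAST k. \<exists>f. roman_dominating G f \<and> weight G f = k)"

definition roman_function :: "'a pair_pre_digraph \<Rightarrow> ('a \<Rightarrow> nat) \<Rightarrow> bool" where
  "roman_function G f \<longleftrightarrow> roman_dominating G f \<and> weight G f = roman_number G"

definition value_class :: "nat set \<Rightarrow> 'a pair_pre_digraph \<Rightarrow> 'a set" where
  "value_class X G = {v \<in> pverts G. {f v | f. roman_function G f} = X}"

definition roman_excellent :: "'a pair_pre_digraph \<Rightarrow> bool" where
  "roman_excellent G \<longleftrightarrow> (\<forall>v\<in>pverts G. \<exists>f. roman_function G f \<and> f v \<noteq> 0)"


section \<open>Labeled graphs\<close>

datatype status = StA | StB | StC | StD

text \<open>As for Roman dominating functions, only the statuses of the vertices matter.\<close>

type_synonym 'a labeled = "'a pair_pre_digraph \<times> ('a \<Rightarrow> status)"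

definition status_set :: "status \<Rightarrow> 'a labeled \<Rightarrow> 'a set" where
  "status_set X = (\<lambda>(T, S). {v \<in> pverts T. S v = X})"

text \<open>
  \<open>pattern ss es\<close> has the vertices 0, 1, ..., \<open>length ss - 1\<close>, where vertex \<open>i\<close> has
  status \<open>ss ! i\<close>, and the undirected edges listed in \<open>es\<close>.
\<close>

definition pattern :: "status list \<Rightarrow> (nat \<times> nat) list \<Rightarrow> nat labeled" where
  "pattern ss es = (\<lparr>pverts = {..<length ss}, parcs = set es \<union> (set es)\<inverse>\<rparr>, nth ss)"

definition H1 :: "nat labeled" where
  "H1 = pattern [StD, StD] [(0, 1)]"

definition H2 :: "nat labeled" where
  "H2 = pattern [StA, StB, StB, StA] [(0, 1), (1, 2), (2, 3)]"

text \<open>In \<open>H3\<close> to \<open>H7\<close> the vertices 0 and 1 are the two adjacent vertices of status C.\<close>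

definition H3 :: "nat labeled" where
  "H3 = pattern [StC, StC, StA, StA, StA, StA]
     [(0, 1), (0, 2), (0, 3), (1, 4), (1, 5)]"

definition H4 :: "nat labeled" where
  "H4 = pattern [StC, StC, StA, StA, StA, StD, StD]
     [(0, 1), (0, 2), (0, 3), (1, 4), (1, 5), (5, 6)]"

definition H5 :: "nat labeled" where
  "H5 = pattern [StC, StC, StA, StD, StD, StA, StD, StD]
     [(0, 1), (0, 2), (0, 3), (3, 4), (1, 5), (1, 6), (6, 7)]"

definition H6 :: "nat labeled" where
  "H6 = pattern [StC, StC, StA, StA, StD, StD, StD, StD]
     [(0, 1), (0, 2), (0, 3), (1, 4), (4, 5), (1, 6), (6, 7)]"

definition H7 :: "nat labeled" where
  "H7 = pattern [StC, StC, StA, StD, StD, StD, StD, StD, StD]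
     [(0, 1), (0, 2), (0, 3), (3, 4), (1, 5), (5, 6), (1, 7), (7, 8)]"

definition F1 :: "nat labeled" where
  "F1 = pattern [StA, StC, StA] [(0, 1), (1, 2)]"

definition F2 :: "nat labeled" where
  "F2 = pattern [StA, StC, StD, StD] [(0, 1), (1, 2), (2, 3)]"

definition F3 :: "nat labeled" where
  "F3 = pattern [StD, StD, StC, StD, StD] [(0, 1), (1, 2), (2, 3), (3, 4)]"

definition F4 :: "nat labeled" where
  "F4 = pattern [StC, StD, StD] [(0, 1), (1, 2)]"


section \<open>The family of labeled trees\<close>

definition graph_image :: "('a \<Rightarrow> 'b) \<Rightarrow> 'a pair_pre_digraph \<Rightarrow> 'b pair_pre_digraph" where
  "graph_image \<phi> G = \<lparr>pverts = \<phi> ` pverts G, parcs = map_prod \<phi> \<phi> ` parcs G\<rparr>"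

definition is_copy :: "'b labeled \<Rightarrow> 'a labeled \<Rightarrow> bool" where
  "is_copy = (\<lambda>(H, I) (T, S). \<exists>\<phi>. inj_on \<phi> (pverts H) \<and> T = graph_image \<phi> H \<and>
     (\<forall>w\<in>pverts H. S (\<phi> w) = I w))"

text \<open>
  \<open>attach_edge X (F, J) (T', S') (T, S)\<close>: \<open>(T, S)\<close> arises from \<open>(T', S')\<close> by adding a disjoint copy
  of \<open>(F, J)\<close> and an edge between a vertex \<open>u\<close> of \<open>T'\<close> of status \<open>X\<close> and a vertex \<open>x\<close> of status C
  of the copy.
\<close>

definition attach_edge :: "status \<Rightarrow> 'b labeled \<Rightarrow> 'a labeled \<Rightarrow> 'a labeled \<Rightarrow> bool" where
  "attach_edge X = (\<lambda>(F, J) (T', S') (T, S). \<exists>\<phi> u x.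
     inj_on \<phi> (pverts F) \<and> \<phi> ` pverts F \<inter> pverts T' = {} \<and>
     u \<in> pverts T' \<and> S' u = X \<and> x \<in> pverts F \<and> J x = StC \<and>
     pverts T = pverts T' \<union> pverts (graph_image \<phi> F) \<and>
     parcs T = parcs T' \<union> parcs (graph_image \<phi> F) \<union> {(u, \<phi> x), (\<phi> x, u)} \<and>
     (\<forall>w\<in>pverts T'. S w = S' w) \<and>
     (\<forall>w\<in>pverts F. S (\<phi> w) = J w))"

text \<open>
  \<open>identify X (H, I) (T', S') (T, S)\<close>: \<open>(T, S)\<close> arises from \<open>(T', S')\<close> by identifying a vertex \<open>u\<close> of
  \<open>T'\<close> of status \<open>X\<close> with a vertex \<open>v\<close> of status A of a disjoint copy of \<open>(H, I)\<close>.  The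
  identification is expressed by a renaming \<open>\<phi>\<close> of \<open>H\<close> that sends \<open>v\<close> to \<open>u\<close> and the other
  vertices outside of \<open>T'\<close>.  The identified vertex keeps the status \<open>X\<close>.
\<close>

definition identify :: "status \<Rightarrow> 'b labeled \<Rightarrow> 'a labeled \<Rightarrow> 'a labeled \<Rightarrow> bool" where
  "identify X = (\<lambda>(H, I) (T', S') (T, S). \<exists>\<phi> u v.
     inj_on \<phi> (pverts H) \<and> \<phi> ` pverts H \<inter> pverts T' = {u} \<and>
     S' u = X \<and> v \<in> pverts H \<and> I v = StA \<and> \<phi> v = u \<and>
     pverts T = pverts T' \<union> pverts (graph_image \<phi> H) \<and>
     parcs T = parcs T' \<union> parcs (graph_image \<phi> H) \<and>
     (\<forall>w\<in>pverts T'. S w = S' w) \<and>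
     (\<forall>w\<in>pverts H - {v}. S (\<phi> w) = I w))"

inductive_set tree_family :: "'a labeled set" where
  base: "L \<in> {H1, H2, H3, H4, H5} \<Longrightarrow> is_copy L M \<Longrightarrow> M \<in> tree_family"
| O1: "M' \<in> tree_family \<Longrightarrow> L \<in> {F1, F2, F3} \<Longrightarrow> attach_edge StC L M' M \<Longrightarrow> M \<in> tree_family"
| O2: "M' \<in> tree_family \<Longrightarrow> attach_edge StD F4 M' M \<Longrightarrow> M \<in> tree_family"
| O3: "M' \<in> tree_family \<Longrightarrow> L \<in> {H2, H3, H4, H5, H6, H7} \<Longrightarrow> identify StA L M' M \<Longrightarrow> M \<in> tree_family"
| O4: "M' \<in> tree_family \<Longrightarrow> L \<in> {H3, H4, H6} \<Longrightarrow> identify StD L M' M \<Longrightarrow> M \<in> tree_family"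

end

theory Submission
  imports Defs
begin

text \<open>
  Family implies excellent: by induction over the construction, every Roman dominating function in
  which the vertices of status C are exempt from being dominated has weight at least the Roman
  domination number, with equality only if every vertex \<open>v\<close> has a value allowed by its status, and
  every allowed value is attained. All copies of \<open>H3\<close>, ..., \<open>H7\<close> are two arms of type \<open>F1\<close>, \<open>F2\<close>
  or \<open>F3\<close> joined at their vertices of status C.

  Excellent implies family: for an edge \<open>wv\<close> only two bits of information about the branch of \<open>w\<close>
  matter to \<open>v\<close>. These bits obey local rules, and excellence leaves so few possibilities that the
  number of neighbours whose branch becomes cheaper once they are dominated by \<open>v\<close> is 0 (status A),
  1 (status D) or 2 (status B or C); this determines all adjacencies between the statuses. A tree
  labeled in this way is exhausted by operations starting from a copy of \<open>H1\<close>, \<open>H2\<close> or \<open>H3\<close>,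
  because any edge that leaves a partially built subtree shows which operation comes next.
\<close>

section \<open>Roman domination with exempt vertices\<close>

text \<open>Values alone cannot prove the characterization of the statuses: B and C both allow
  exactly 0 and 2. The induction over the family therefore also carries neighbourhood data
  (\<open>local_shape\<close>), from which degree and neighbours in the class of 0 and 2 tell B from
  C. In the converse direction, cutting end pieces off an excellent tree would require that the
  remainder is again excellent, with compatible statuses. This is avoided: all statuses are read off
  the whole tree, excellence enters only through \<open>supports_level\<close>, and the growth phase
  sees nothing but adjacencies. The levels 0, 1, 2 express the balance at a vertex, measured against
  the sum of the minima of its branches: value 2 costs two units and saves one for every neighbour
  that \<open>raises\<close> it, value 1 costs one unit, and value 0 is free exactly if some branch
  \<open>supports\<close> the vertex. Excellence forbids that value 0 always wins, which couples the
  two bits at both ends of every edge.\<close>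

definition rdf :: "('a \<times> 'a) set \<Rightarrow> 'a set \<Rightarrow> 'a set \<Rightarrow> ('a \<Rightarrow> nat) \<Rightarrow> bool" where
  "rdf E X Z f \<longleftrightarrow>
     (\<forall>v\<in>X. f v \<le> 2 \<and> (f v = 0 \<longrightarrow> v \<in> Z \<or> (\<exists>u\<in>X. (v, u) \<in> E \<and> f u = 2)))"

fun status_values :: "status \<Rightarrow> nat set" where
  "status_values StA = {0, 1}"
| "status_values StB = {0, 2}"
| "status_values StC = {0, 2}"
| "status_values StD = {0, 1, 2}"

text \<open>Exempting the vertices of status C from being dominated makes the lower bound inductive:
  an edge added between two of them then gives no advantage.\<close>

definition tight :: "('a \<times> 'a) set \<Rightarrow> 'a set \<Rightarrow> ('a \<Rightarrow> status) \<Rightarrow> nat \<Rightarrow> bool" where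
  "tight E X S g \<longleftrightarrow> (\<forall>f. rdf E X {v. S v = StC} f \<longrightarrow>
     g \<le> sum f X \<and> (sum f X = g \<longrightarrow> (\<forall>v\<in>X. f v \<in> status_values (S v))))"

definition attains :: "('a \<times> 'a) set \<Rightarrow> 'a set \<Rightarrow> 'a set \<Rightarrow> ('a \<Rightarrow> status) \<Rightarrow> nat \<Rightarrow> bool" where
  "attains E X Z S g \<longleftrightarrow> (\<forall>v\<in>X. \<forall>i\<in>status_values (S v). \<exists>f. rdf E X Z f \<and> sum f X = g \<and> f v = i)"

text \<open>The lower bound is asked for with exemptions, attainment without. An ordinary Roman
  dominating function is subject to both, so \<open>g\<close> is forced to be the Roman domination
  number and the values at \<open>v\<close> are exactly \<open>status_values (S v)\<close>.\<close>

definition good :: "('a \<times> 'a) set \<Rightarrow> 'a set \<Rightarrow> ('a \<Rightarrow> status) \<Rightarrow> nat \<Rightarrow> bool" where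
  "good E X S g \<longleftrightarrow> finite X \<and> E \<subseteq> X \<times> X \<and> tight E X S g \<and> attains E X {} S g"

text \<open>In O4 a vertex of status A takes over the values of one of status D, so the cost of the
  additional value 2 has to be controlled.\<close>

definition promotable ::
    "('a \<times> 'a) set \<Rightarrow> 'a set \<Rightarrow> 'a set \<Rightarrow> ('a \<Rightarrow> status) \<Rightarrow> nat \<Rightarrow> 'a \<Rightarrow> bool" where
  "promotable E X Z S g v \<longleftrightarrow>
     (\<exists>f. rdf E X Z f \<and> f v = 2 \<and> sum f X = g + 1) \<and>
     (\<forall>f. rdf E X {v. S v = StC} f \<longrightarrow> f v = 2 \<longrightarrow> sum f X = g + 1 \<longrightarrow>
        (\<forall>w\<in>X - {v}. f w \<in> status_values (S w)))"

text \<open>In \<open>attains\<close> the vertex \<open>x\<close> is exempt because it may be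
  dominated through the edge that later joins the arm to another vertex of status C.\<close>

definition arm :: "('a \<times> 'a) set \<Rightarrow> 'a set \<Rightarrow> ('a \<Rightarrow> status) \<Rightarrow> nat \<Rightarrow> 'a \<Rightarrow> bool" where
  "arm E X S g x \<longleftrightarrow> finite X \<and> E \<subseteq> X \<times> X \<and> x \<in> X \<and> S x = StC \<and> tight E X S g \<and> attains E X {x} S g \<and>
     (\<forall>v\<in>X. S v = StA \<longrightarrow> promotable E X {x} S g v)"

section \<open>Monotonicity and congruence\<close>

lemma rdf_mono: "rdf E X Z f \<Longrightarrow> Z \<subseteq> Z' \<Longrightarrow> rdf E X Z' f"
  by (fastforce simp: rdf_def)

lemma rdf_cong:
  assumes "\<And>v. v \<in> X \<Longrightarrow> f v = f' v" and "X \<inter> Z = X \<inter> Z'"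
  shows "rdf E X Z f \<longleftrightarrow> rdf E X Z' f'"
  unfolding rdf_def using assms by (intro ball_cong) auto

lemma tight_cong:
  assumes "\<And>v. v \<in> X \<Longrightarrow> S v = S' v"
  shows "tight E X S g \<longleftrightarrow> tight E X S' g"
proof -
  have "rdf E X {v. S v = StC} f \<longleftrightarrow> rdf E X {v. S' v = StC} f" for f
    by (rule rdf_cong) (auto simp: assms)
  then show ?thesis using assms by (simp add: tight_def)
qed

lemma attains_cong:
  assumes "\<And>v. v \<in> X \<Longrightarrow> S v = S' v"
  shows "attains E X Z S g \<longleftrightarrow> attains E X Z S' g"
  using assms by (simp add: attains_def)

lemma good_cong:
  assumes "\<And>v. v \<in> X \<Longrightarrow> S v = S' v"
  shows "good E X S g \<longleftrightarrow> good E X S' g"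
  by (simp add: good_def tight_cong[OF assms] attains_cong[OF assms])

lemma attainsI:
  assumes "\<And>f. f \<in> Fs \<Longrightarrow> rdf E X Z f \<and> sum f X = g"
    and "\<And>v i. v \<in> X \<Longrightarrow> i \<in> status_values (S v) \<Longrightarrow> \<exists>f\<in>Fs. f v = i"
  shows "attains E X Z S g"
  using assms unfolding attains_def by blast

section \<open>The three arms and the two smallest trees\<close>

lemma arm_AA:
  assumes "distinct [x, a, b]" "S x = StC" "S a = StA" "S b = StA"
  shows "arm {(x, a), (a, x), (x, b), (b, x)} {x, a, b} S 2 x" (is "arm ?E ?X S 2 x")
proof -
  \<comment> \<open>Domination is translated into arithmetic conditions, so that tightness becomes a
    problem for linear arithmetic.\<close>
  have num: "f x \<le> 2" "f a \<le> 2" "f b \<le> 2" "f a = 0 \<Longrightarrow> f x = 2" "f b = 0 \<Longrightarrow> f x = 2"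
    if "rdf ?E ?X {v. S v = StC} f" for f
    using that assms by (auto simp: rdf_def)
  have sum: "sum f ?X = f x + f a + f b" for f :: "'a \<Rightarrow> nat"
    using assms by simp
  have "tight ?E ?X S 2"
    unfolding tight_def
  proof (intro allI impI)
    fix f assume "rdf ?E ?X {v. S v = StC} f"
    from num[OF this] show "2 \<le> sum f ?X \<and> (sum f ?X = 2 \<longrightarrow> (\<forall>v\<in>?X. f v \<in> status_values (S v)))"
      unfolding sum using assms by simp linarith
  qed
  moreover have "attains ?E ?X {x} S 2"
    \<comment> \<open>Either the leaves pay for themselves and \<open>x\<close> is left to the
      outside, or \<open>x\<close> pays 2 and serves both leaves.\<close>
    by (rule attainsI[where Fs = "{(\<lambda>_. 1)(x := 0), (\<lambda>_. 0)(x := 2)}"])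
      (use assms in \<open>auto simp: rdf_def\<close>)
  moreover have "promotable ?E ?X {x} S 2 a"
    unfolding promotable_def
    by (intro conjI exI[of _ "(\<lambda>_. 1)(x := 0, a := 2)"])
      (use assms in \<open>auto simp: rdf_def\<close>)
  moreover have "promotable ?E ?X {x} S 2 b"
    unfolding promotable_def
    by (intro conjI exI[of _ "(\<lambda>_. 1)(x := 0, b := 2)"])
      (use assms in \<open>auto simp: rdf_def\<close>)
  ultimately show ?thesis using assms by (auto simp: arm_def)
qed

lemma arm_AD:
  assumes "distinct [x, a, d, e]" "S x = StC" "S a = StA" "S d = StD" "S e = StD"
  shows "arm {(x, a), (a, x), (x, d), (d, x), (d, e), (e, d)} {x, a, d, e} S 3 x" (is "arm ?E ?X S 3 x")
proof -
  have num: "f x \<le> 2" "f a \<le> 2" "f d \<le> 2" "f e \<le> 2" "f a = 0 \<Longrightarrow> f x = 2"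
      "f d = 0 \<Longrightarrow> f x = 2 \<or> f e = 2" "f e = 0 \<Longrightarrow> f d = 2"
    if "rdf ?E ?X {v. S v = StC} f" for f
    using that assms by (auto simp: rdf_def)
  have sum: "sum f ?X = f x + f a + f d + f e" for f :: "'a \<Rightarrow> nat"
    using assms by simp
  have "tight ?E ?X S 3"
    unfolding tight_def
  proof (intro allI impI)
    fix f assume "rdf ?E ?X {v. S v = StC} f"
    from num[OF this] show "3 \<le> sum f ?X \<and> (sum f ?X = 3 \<longrightarrow> (\<forall>v\<in>?X. f v \<in> status_values (S v)))"
      unfolding sum using assms by simp linarith
  qed
  moreover have "attains ?E ?X {x} S 3"
    by (rule attainsI[where Fs = "{(\<lambda>_. 1)(x := 0), (\<lambda>_. 0)(x := 2, e := 1),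
          (\<lambda>_. 0)(a := 1, d := 2), (\<lambda>_. 0)(a := 1, e := 2)}"])
      (use assms in \<open>auto simp: rdf_def\<close>)
  moreover have "promotable ?E ?X {x} S 3 a"
    unfolding promotable_def
  \<comment> \<open>Here 2 on \<open>a\<close> replaces the 1 it has in a minimum function; the pair
    \<open>d\<close>, \<open>e\<close> still costs 2.\<close>
  proof (intro conjI allI impI exI[of _ "(\<lambda>_. 0)(a := 2, d := 2)"])
    fix f assume "rdf ?E ?X {v. S v = StC} f" "f a = 2" "sum f ?X = 3 + 1"
    moreover have "?X - {a} = {x, d, e}" using assms by auto
    ultimately show "\<forall>w\<in>?X - {a}. f w \<in> status_values (S w)"
      using num[OF \<open>rdf ?E ?X _ f\<close>] assms unfolding sum by simp linarith
  qed (use assms in \<open>auto simp: rdf_def\<close>)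
  ultimately show ?thesis using assms by (auto simp: arm_def)
qed

lemma arm_DD:
  assumes "distinct [x, d, e, d', e']" "S x = StC" "S d = StD" "S e = StD" "S d' = StD" "S e' = StD"
  shows "arm {(x, d), (d, x), (d, e), (e, d), (x, d'), (d', x), (d', e'), (e', d')}
    {x, d, e, d', e'} S 4 x" (is "arm ?E ?X S 4 x")
proof -
  have num: "f x \<le> 2" "f d \<le> 2" "f e \<le> 2" "f d' \<le> 2" "f e' \<le> 2"
      "f d = 0 \<Longrightarrow> f x = 2 \<or> f e = 2" "f e = 0 \<Longrightarrow> f d = 2"
      "f d' = 0 \<Longrightarrow> f x = 2 \<or> f e' = 2" "f e' = 0 \<Longrightarrow> f d' = 2"
    if "rdf ?E ?X {v. S v = StC} f" for f
    using that assms by (auto simp: rdf_def)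
  have sum: "sum f ?X = f x + f d + f e + f d' + f e'" for f :: "'a \<Rightarrow> nat"
    using assms by simp
  have "tight ?E ?X S 4"
    unfolding tight_def
  proof (intro allI impI)
    fix f assume "rdf ?E ?X {v. S v = StC} f"
    from num[OF this] show "4 \<le> sum f ?X \<and> (sum f ?X = 4 \<longrightarrow> (\<forall>v\<in>?X. f v \<in> status_values (S v)))"
      unfolding sum using assms by simp linarith
  qed
  moreover
  \<comment> \<open>The evaluation of the function updates below needs the disequalities in the
    reverse orientation, too.\<close>
  have "distinct [e', d', e, d, x]"
    using assms(1) by auto
  have "attains ?E ?X {x} S 4"
  proof (rule attainsI)
    let ?Fs = "{(\<lambda>_. 1)(x := 0), (\<lambda>_. 0)(x := 2, e := 1, e' := 1),
      (\<lambda>_. 0)(d := 2, d' := 2), (\<lambda>_. 0)(e := 2, e' := 2)}"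
    show "rdf ?E ?X {x} f \<and> sum f ?X = 4" if "f \<in> ?Fs" for f
      using that assms \<open>distinct [e', d', e, d, x]\<close> by (elim insertE emptyE) (simp_all add: rdf_def)
    show "\<exists>f\<in>?Fs. f v = i" if "v \<in> ?X" "i \<in> status_values (S v)" for v i
      using that assms \<open>distinct [e', d', e, d, x]\<close> by (elim insertE emptyE) auto
  qed
  ultimately show ?thesis using assms by (auto simp: arm_def)
qed

lemma good_H1:
  assumes "d \<noteq> e" "S d = StD" "S e = StD"
  shows "good {(d, e), (e, d)} {d, e} S 2"
proof -
  have "tight {(d, e), (e, d)} {d, e} S 2"
    using assms by (auto simp: tight_def rdf_def)
  moreover have "attains {(d, e), (e, d)} {d, e} {} S 2"
    by (rule attainsI[where Fs = "{(\<lambda>_. 1), (\<lambda>_. 0)(d := 2), (\<lambda>_. 0)(e := 2)}"])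
      (use assms in \<open>auto simp: rdf_def\<close>)
  ultimately show ?thesis by (auto simp: good_def)
qed

lemma good_H2:
  assumes "distinct [a, b, b', a']" "S a = StA" "S b = StB" "S b' = StB" "S a' = StA"
  shows "good {(a, b), (b, a), (b, b'), (b', b), (b', a'), (a', b')} {a, b, b', a'} S 3"
    (is "good ?E ?X S 3")
proof -
  have num: "f a \<le> 2" "f b \<le> 2" "f b' \<le> 2" "f a' \<le> 2" "f a = 0 \<Longrightarrow> f b = 2"
      "f b = 0 \<Longrightarrow> f a = 2 \<or> f b' = 2" "f b' = 0 \<Longrightarrow> f b = 2 \<or> f a' = 2" "f a' = 0 \<Longrightarrow> f b' = 2"
    if "rdf ?E ?X {v. S v = StC} f" for f
    using that assms by (auto simp: rdf_def)
  have sum: "sum f ?X = f a + f b + f b' + f a'" for f :: "'a \<Rightarrow> nat"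
    using assms by simp
  have "tight ?E ?X S 3"
    unfolding tight_def
  proof (intro allI impI)
    fix f assume "rdf ?E ?X {v. S v = StC} f"
    from num[OF this] show "3 \<le> sum f ?X \<and> (sum f ?X = 3 \<longrightarrow> (\<forall>v\<in>?X. f v \<in> status_values (S v)))"
      unfolding sum using assms by simp linarith
  qed
  moreover have "attains ?E ?X {} S 3"
    by (rule attainsI[where Fs = "{(\<lambda>_. 0)(a := 1, b' := 2), (\<lambda>_. 0)(b := 2, a' := 1)}"])
      (use assms in \<open>auto simp: rdf_def\<close>)
  ultimately show ?thesis by (auto simp: good_def)
qed

section \<open>Joining two trees by an edge between vertices of status C\<close>

lemma tight_join:
  assumes 1: "finite X1" "E1 \<subseteq> X1 \<times> X1" "tight E1 X1 S g1"
    and 2: "finite X2" "E2 \<subseteq> X2 \<times> X2" "tight E2 X2 S g2"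
    and disj: "X1 \<inter> X2 = {}" and "S u = StC" "S x = StC" "u \<in> X1" "x \<in> X2"
    and f: "rdf (E1 \<union> E2 \<union> {(u, x), (x, u)}) (X1 \<union> X2) {v. S v = StC} f"
  shows "rdf E1 X1 {v. S v = StC} f" "rdf E2 X2 {v. S v = StC} f"
    "sum f (X1 \<union> X2) = sum f X1 + sum f X2"
proof -
  \<comment> \<open>Both ends of the new edge are exempt, so no vertex that needs domination obtains
    it through this edge, and the restrictions to the two sides stay admissible.\<close>
  show "rdf E1 X1 {v. S v = StC} f"
    unfolding rdf_def
  proof (intro ballI conjI impI)
    fix v assume "v \<in> X1"
    then show "f v \<le> 2" using f by (auto simp: rdf_def)
    assume "f v = 0"
    with f \<open>v \<in> X1\<close> have "S v = StC \<or> (\<exists>w\<in>X1\<union>X2. (v, w) \<in> E1 \<union> E2 \<union> {(u, x), (x, u)} \<and> f w = 2)"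
      by (auto simp: rdf_def)
    then show "v \<in> {v. S v = StC} \<or> (\<exists>w\<in>X1. (v, w) \<in> E1 \<and> f w = 2)"
      using assms \<open>v \<in> X1\<close> by blast
  qed
  show "rdf E2 X2 {v. S v = StC} f"
    unfolding rdf_def
  proof (intro ballI conjI impI)
    fix v assume "v \<in> X2"
    then show "f v \<le> 2" using f by (auto simp: rdf_def)
    assume "f v = 0"
    with f \<open>v \<in> X2\<close> have "S v = StC \<or> (\<exists>w\<in>X1\<union>X2. (v, w) \<in> E1 \<union> E2 \<union> {(u, x), (x, u)} \<and> f w = 2)"
      by (auto simp: rdf_def)
    then show "v \<in> {v. S v = StC} \<or> (\<exists>w\<in>X2. (v, w) \<in> E2 \<and> f w = 2)"
      using assms \<open>v \<in> X2\<close> by blast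
  qed
  show "sum f (X1 \<union> X2) = sum f X1 + sum f X2"
    using 1 2 disj by (simp add: sum.union_disjoint)
qed

text \<open>The value 2 at \<open>x\<close> does two things: it dominates \<open>u\<close> across
  the new edge, and it makes the exemption of \<open>x\<close> irrelevant because \<open>x\<close>
  does not have value 0. Hence the union is free of exemptions.\<close>

lemma rdf_combine_disjoint:
  assumes "X1 \<inter> X2 = {}" "finite X1" "finite X2"
    and f1: "rdf E1 X1 {u} f1" and f2: "rdf E2 X2 Z f2" and u: "f2 x = 2" "x \<in> X2"
    and "Z \<subseteq> {x}" "(u, x) \<in> E" "E1 \<subseteq> E" "E2 \<subseteq> E"
  obtains f where "rdf E (X1 \<union> X2) {} f" "sum f (X1 \<union> X2) = sum f1 X1 + sum f2 X2"
    "\<forall>v\<in>X1. f v = f1 v" "\<forall>v\<in>X2. f v = f2 v"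
proof -
  define f where "f \<equiv> \<lambda>v. if v \<in> X1 then f1 v else f2 v"
  have f: "\<forall>v\<in>X1. f v = f1 v" "\<forall>v\<in>X2. f v = f2 v"
    using assms(1) by (auto simp: f_def)
  have "rdf E (X1 \<union> X2) {} f"
    unfolding rdf_def
  proof (intro ballI conjI impI)
    fix v assume v: "v \<in> X1 \<union> X2"
    then show "f v \<le> 2" using f f1 f2 by (auto simp: rdf_def)
    assume "f v = 0"
    show "v \<in> {} \<or> (\<exists>w\<in>X1\<union>X2. (v, w) \<in> E \<and> f w = 2)"
    proof (cases "v \<in> X1")
      case True
      with \<open>f v = 0\<close> f f1 have "v = u \<or> (\<exists>w\<in>X1. (v, w) \<in> E1 \<and> f1 w = 2)"
        by (auto simp: rdf_def)
      with f assms show ?thesis by (metis UnCI subsetD)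
    next
      case False
      with v \<open>f v = 0\<close> f f2 have "v \<in> Z \<or> (\<exists>w\<in>X2. (v, w) \<in> E2 \<and> f2 w = 2)" "v \<in> X2"
        by (auto simp: rdf_def)
      moreover have "v \<notin> Z" using \<open>f v = 0\<close> u f \<open>Z \<subseteq> {x}\<close> by auto
      ultimately show ?thesis using f assms by (metis UnCI subsetD)
    qed
  qed
  moreover have "sum f (X1 \<union> X2) = sum f1 X1 + sum f2 X2"
    using assms f by (simp add: sum.union_disjoint)
  ultimately show ?thesis using f that by blast
qed

text \<open>A function with the desired value on one side is combined with one that has value 2 at
  the contact vertex of the other side; status C always allows this value.\<close>

lemma good_join:
  assumes 1: "finite X1" "E1 \<subseteq> X1 \<times> X1" "tight E1 X1 S g1" "attains E1 X1 {u} S g1"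
    and 2: "finite X2" "E2 \<subseteq> X2 \<times> X2" "tight E2 X2 S g2" "attains E2 X2 {x} S g2"
    and disj: "X1 \<inter> X2 = {}" and C: "S u = StC" "S x = StC" "u \<in> X1" "x \<in> X2"
  shows "good (E1 \<union> E2 \<union> {(u, x), (x, u)}) (X1 \<union> X2) S (g1 + g2)" (is "good ?E ?X S ?g")
proof -
  note split = tight_join[OF 1(1-3) 2(1-3) disj C]
  have "tight ?E ?X S ?g"
    unfolding tight_def
  proof (intro allI impI)
    fix f assume f: "rdf ?E ?X {v. S v = StC} f"
    show "?g \<le> sum f ?X \<and> (sum f ?X = ?g \<longrightarrow> (\<forall>v\<in>?X. f v \<in> status_values (S v)))"
      proof -
      have "g1 \<le> sum f X1" "sum f X1 = g1 \<longrightarrow> (\<forall>v\<in>X1. f v \<in> status_values (S v))"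
          "g2 \<le> sum f X2" "sum f X2 = g2 \<longrightarrow> (\<forall>v\<in>X2. f v \<in> status_values (S v))"
        using 1(3) 2(3) split(1,2)[OF f] by (simp_all add: tight_def)
      then show ?thesis using split(3)[OF f] by auto
    qed
  qed
  moreover have "attains ?E ?X {} S ?g"
    unfolding attains_def
  proof (intro ballI)
    have sub: "(u, x) \<in> ?E" "E1 \<subseteq> ?E" "E2 \<subseteq> ?E" by auto
    fix v i assume vi: "v \<in> ?X" "i \<in> status_values (S v)"
    show "\<exists>f. rdf ?E ?X {} f \<and> sum f ?X = ?g \<and> f v = i"
    proof (cases "v \<in> X1")
      case True
      from 1(4) vi True obtain f1 where "rdf E1 X1 {u} f1" "sum f1 X1 = g1" "f1 v = i"
        by (auto simp: attains_def)
      moreover from 2(4) C obtain f2 where "rdf E2 X2 {x} f2" "sum f2 X2 = g2" "f2 x = 2"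
        by (fastforce simp: attains_def)
      ultimately show ?thesis
        using rdf_combine_disjoint[of X1 X2 E1 u f1 E2 "{x}" f2 x ?E] 1(1) 2(1) disj C(4) True sub
        by (metis order_refl)
    next
      case False
      with 2(4) vi obtain f2 where "rdf E2 X2 {x} f2" "sum f2 X2 = g2" "f2 v = i" "v \<in> X2"
        by (auto simp: attains_def)
      moreover from 1(4) C obtain f1 where "rdf E1 X1 {u} f1" "sum f1 X1 = g1" "f1 u = 2"
        by (fastforce simp: attains_def)
      moreover have "X2 \<inter> X1 = {}" "(x, u) \<in> ?E" "E2 \<subseteq> ?E" "E1 \<subseteq> ?E" using disj by auto
      ultimately obtain f where "rdf ?E (X2 \<union> X1) {} f" "sum f (X2 \<union> X1) = g2 + g1" "f v = i"
        using rdf_combine_disjoint[of X2 X1 E2 x f2 E1 "{u}" f1 u ?E] 1(1) 2(1) C(3)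
        by (metis order_refl)
      then show ?thesis by (metis Un_commute add.commute)
    qed
  qed
  ultimately show ?thesis using 1 2 C by (auto simp: good_def)
qed

lemma good_attach_arm:
  assumes "good E1 X1 S g1" "arm E2 X2 S g2 x" "X1 \<inter> X2 = {}" "S u = StC" "u \<in> X1"
  shows "good (E1 \<union> E2 \<union> {(u, x), (x, u)}) (X1 \<union> X2) S (g1 + g2)"
proof (rule good_join)
  show "attains E1 X1 {u} S g1"
    using assms(1) unfolding good_def attains_def by (meson rdf_mono empty_subsetI)
qed (use assms in \<open>auto simp: good_def arm_def\<close>)

lemma arms_good:
  assumes "arm E1 X1 S g1 u" "arm E2 X2 S g2 x" "X1 \<inter> X2 = {}"
  shows "good (E1 \<union> E2 \<union> {(u, x), (x, u)}) (X1 \<union> X2) S (g1 + g2)"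
  by (rule good_join) (use assms in \<open>auto simp: arm_def\<close>)

text \<open>Only the arm that contains \<open>a\<close> pays for the promotion. Conversely, value 2
  is not allowed for status A, so this arm exceeds \<open>g1\<close>; a total excess of 1 then
  leaves the other arm at its minimum.\<close>

lemma arms_promotable:
  assumes 1: "arm E1 X1 S g1 u" and 2: "arm E2 X2 S g2 x" and disj: "X1 \<inter> X2 = {}"
    and a: "a \<in> X1" "S a = StA"
  shows "promotable (E1 \<union> E2 \<union> {(u, x), (x, u)}) (X1 \<union> X2) {} S (g1 + g2) a"
    (is "promotable ?E ?X {} S ?g a")
proof -
  have one: "finite X1" "E1 \<subseteq> X1 \<times> X1" "tight E1 X1 S g1" "S u = StC" "u \<in> X1"
      "promotable E1 X1 {u} S g1 a"
    and two: "finite X2" "E2 \<subseteq> X2 \<times> X2" "tight E2 X2 S g2" "S x = StC" "x \<in> X2"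
      "attains E2 X2 {x} S g2"
    using 1 2 a by (auto simp: arm_def)
  note split = tight_join[OF one(1-3) two(1-3) disj one(4) two(4) one(5) two(5)]
  have "\<exists>f. rdf ?E ?X {} f \<and> f a = 2 \<and> sum f ?X = ?g + 1"
  proof -
    from one obtain f1 where "rdf E1 X1 {u} f1" "f1 a = 2" "sum f1 X1 = g1 + 1"
      by (auto simp: promotable_def)
    moreover from two obtain f2 where "rdf E2 X2 {x} f2" "sum f2 X2 = g2" "f2 x = 2"
      by (fastforce simp: attains_def)
    moreover have "(u, x) \<in> ?E" "E1 \<subseteq> ?E" "E2 \<subseteq> ?E" by auto
    ultimately obtain f where "rdf ?E ?X {} f" "sum f ?X = (g1 + 1) + g2" "f a = 2"
      using rdf_combine_disjoint[of X1 X2 E1 u f1 E2 "{x}" f2 x ?E] one(1) two(1,5) disj a(1)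
      by (metis order_refl)
    then show ?thesis by (metis add.assoc add.commute)
  qed
  moreover have "\<forall>w\<in>?X - {a}. f w \<in> status_values (S w)"
    if f: "rdf ?E ?X {v. S v = StC} f" and "f a = 2" and sum: "sum f ?X = ?g + 1" for f
  proof -
    note split = split[OF f]
    have "g2 \<le> sum f X2" "sum f X2 = g2 \<longrightarrow> (\<forall>v\<in>X2. f v \<in> status_values (S v))"
      using two(3) split(2) by (auto simp: tight_def)
    moreover have "g1 \<le> sum f X1" "sum f X1 \<noteq> g1"
      using one(3) split(1) a \<open>f a = 2\<close> by (fastforce simp: tight_def)+
    ultimately have "sum f X2 = g2" "sum f X1 = g1 + 1"
      using split(3) sum by linarith+
    moreover have "\<forall>w\<in>X1 - {a}. f w \<in> status_values (S w)"
      using one(6) split(1) \<open>f a = 2\<close> \<open>sum f X1 = g1 + 1\<close> by (auto simp: promotable_def)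
    ultimately show ?thesis using \<open>sum f X2 = g2 \<longrightarrow> _\<close> by blast
  qed
  ultimately show ?thesis by (auto simp: promotable_def)
qed

section \<open>Gluing two trees at a common vertex\<close>

lemma sum_upd_one:
  fixes f :: "'a \<Rightarrow> nat"
  assumes "finite X" "u \<in> X" "f u = 0"
  shows "sum (f(u := 1)) X = sum f X + 1"
  using assms by (simp add: sum.remove[of X u])

text \<open>Only vertices of value 2 dominate others, so lowering another value to 0 endangers no
  vertex but \<open>u\<close>.\<close>

lemma rdf_release:
  assumes "rdf E X Z f" "f u \<noteq> 2"
  shows "rdf E X (insert u Z) (f(u := 0))"
proof -
  have "(f(u := 0)) w = 2" if "f w = 2" for w
    using assms(2) that by auto
  then show ?thesis
    using assms(1) unfolding rdf_def by (metis fun_upd_apply insertCI le0)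
qed

text \<open>A vertex other than \<open>u\<close> has all its neighbours in one part. Only
  \<open>u\<close> can lose its dominating neighbour by the restriction, and value 1 at
  \<open>u\<close> repairs this.\<close>

lemma rdf_restrict_glue:
  assumes "E1 \<subseteq> X1 \<times> X1" "E2 \<subseteq> X2 \<times> X2" "X1 \<inter> X2 = {u}"
    and f: "rdf (E1 \<union> E2) (X1 \<union> X2) Z f"
  shows "f u \<noteq> 0 \<or> (\<exists>w\<in>X1. (u, w) \<in> E1 \<and> f w = 2) \<Longrightarrow> rdf E1 X1 Z f"
    and "f u = 0 \<Longrightarrow> rdf E1 X1 Z (f(u := 1))"
proof -
  have *: "f v \<le> 2 \<and> (f v = 0 \<longrightarrow> v \<noteq> u \<longrightarrow> v \<in> Z \<or> (\<exists>w\<in>X1. (v, w) \<in> E1 \<and> f w = 2))"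
    if "v \<in> X1" for v
  proof (intro conjI impI)
    show "f v \<le> 2" using f that by (auto simp: rdf_def)
    assume "f v = 0" "v \<noteq> u"
    then have "v \<in> Z \<or> (\<exists>w\<in>X1 \<union> X2. (v, w) \<in> E1 \<union> E2 \<and> f w = 2)"
      using f that by (auto simp: rdf_def)
    moreover have "v \<notin> X2" using \<open>v \<noteq> u\<close> assms(3) that by blast
    ultimately show "v \<in> Z \<or> (\<exists>w\<in>X1. (v, w) \<in> E1 \<and> f w = 2)"
      using assms(1,2) by blast
  qed
  show "rdf E1 X1 Z f" if "f u \<noteq> 0 \<or> (\<exists>w\<in>X1. (u, w) \<in> E1 \<and> f w = 2)"
    using * that unfolding rdf_def by metis
  show "rdf E1 X1 Z (f(u := 1))" if "f u = 0"
    unfolding rdf_def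
  proof (intro ballI conjI impI)
    fix v assume v: "v \<in> X1"
    then show "(f(u := 1)) v \<le> 2" using *[OF v] by simp
    assume 0: "(f(u := 1)) v = 0"
    then have "v \<noteq> u" "f v = 0" by (auto split: if_splits)
    with *[OF v] have "v \<in> Z \<or> (\<exists>w\<in>X1. (v, w) \<in> E1 \<and> f w = 2)" by blast
    then show "v \<in> Z \<or> (\<exists>w\<in>X1. (v, w) \<in> E1 \<and> (f(u := 1)) w = 2)"
      using that by (metis fun_upd_other zero_neq_numeral)
  qed
qed

text \<open>A common value at \<open>u\<close> is kept. Otherwise both values are at most 1 and
  dominate nothing, so the smaller one suffices: if it is 0, then \<open>u\<close> is dominated
  inside the part it comes from. As minimum and maximum add up to the two values, gluing saves the
  maximum.\<close>

lemma rdf_combine_glue: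
  assumes fin: "finite X1" "finite X2" and u: "X1 \<inter> X2 = {u}"
    and f1: "rdf E1 X1 {} f1" and f2: "rdf E2 X2 {} f2"
    and eq: "f1 u = f2 u \<or> f1 u \<le> 1 \<and> f2 u \<le> 1"
  obtains f where "rdf (E1 \<union> E2) (X1 \<union> X2) {} f"
    "sum f (X1 \<union> X2) + max (f1 u) (f2 u) = sum f1 X1 + sum f2 X2"
    "f u = min (f1 u) (f2 u)" "\<forall>v\<in>X1 - {u}. f v = f1 v" "\<forall>v\<in>X2 - {u}. f v = f2 v"
proof -
  define f where "f = (\<lambda>v. if v = u then min (f1 u) (f2 u) else if v \<in> X1 then f1 v else f2 v)"
  have vals: "f u = min (f1 u) (f2 u)" "\<forall>v\<in>X1 - {u}. f v = f1 v" "\<forall>v\<in>X2 - {u}. f v = f2 v"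
    using u by (auto simp: f_def)
  have two: "f w = 2" if "w \<in> X1 \<and> f1 w = 2 \<or> w \<in> X2 \<and> f2 w = 2" for w
    using that vals eq by (cases "w = u") auto
  have "rdf (E1 \<union> E2) (X1 \<union> X2) {} f"
    unfolding rdf_def
  proof (intro ballI conjI impI)
    fix v assume v: "v \<in> X1 \<union> X2"
    have le: "\<forall>v\<in>X1. f1 v \<le> 2" "\<forall>v\<in>X2. f2 v \<le> 2"
      using f1 f2 by (auto simp: rdf_def)
    then show "f v \<le> 2"
      using v by (auto simp: f_def min_le_iff_disj)
    assume 0: "f v = 0"
    have "v \<in> X1 \<and> f1 v = 0 \<or> v \<in> X2 \<and> f2 v = 0"
      using 0 v u by (cases "v = u") (auto simp: f_def min_def split: if_splits)
    then have "(\<exists>w\<in>X1. (v, w) \<in> E1 \<and> f1 w = 2) \<or> (\<exists>w\<in>X2. (v, w) \<in> E2 \<and> f2 w = 2)"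
      using f1 f2 by (auto simp: rdf_def)
    then show "v \<in> {} \<or> (\<exists>w\<in>X1 \<union> X2. (v, w) \<in> E1 \<union> E2 \<and> f w = 2)"
      using two by blast
  qed
  moreover have "sum f (X1 \<union> X2) + max (f1 u) (f2 u) = sum f1 X1 + sum f2 X2"
  proof -
    have "u \<in> X1" "u \<in> X2" using u by auto
    have "sum f (X1 \<union> X2) = f u + sum f ((X1 - {u}) \<union> (X2 - {u}))"
      using fin u by (subst sum.remove[of _ u]) (auto intro!: arg_cong[where f = "sum f"])
    also have "sum f ((X1 - {u}) \<union> (X2 - {u})) = sum f1 (X1 - {u}) + sum f2 (X2 - {u})"
      using fin u vals by (subst sum.union_disjoint) auto
    finally show ?thesis
      using vals(1) sum.remove[of X1 u f1] sum.remove[of X2 u f2] fin \<open>u \<in> X1\<close> \<open>u \<in> X2\<close>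
      by (auto simp: max_def min_def)
  qed
  ultimately show ?thesis using vals that by blast
qed

text \<open>The weight drops by 1 because both parts count a 1 at \<open>u\<close>. The second part
  always sees \<open>u\<close> with status A, hence the update of \<open>S\<close>. If
  \<open>u\<close> keeps status D, the value 2 must become available: it costs one extra unit in the
  second part, but is counted twice, so that (g1) + (g2 + 1) - 2 is again the claimed
  weight.\<close>

lemma good_glue:
  assumes 1: "good E1 X1 S g1" and 2: "good E2 X2 (S(u := StA)) g2" and u: "X1 \<inter> X2 = {u}"
    and Su: "S u = StA \<or> S u = StD \<and> promotable E2 X2 {} (S(u := StA)) g2 u"
  shows "good (E1 \<union> E2) (X1 \<union> X2) S (g1 + g2 - 1)" (is "good ?E ?X S ?g")
proof -
  let ?S = "S(u := StA)"
  have fin: "finite X1" "finite X2" and sub: "E1 \<subseteq> X1 \<times> X1" "E2 \<subseteq> X2 \<times> X2"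
    and t1: "tight E1 X1 S g1" and t2: "tight E2 X2 ?S g2"
    and a1: "attains E1 X1 {} S g1" and a2: "attains E2 X2 {} ?S g2"
    using 1 2 by (auto simp: good_def)
  have ux: "u \<in> X1" "u \<in> X2" using u by auto
  have C: "{v. S v = StC} = {v. ?S v = StC}" using Su by auto
  obtain h1 where h1: "rdf E1 X1 {} h1" "sum h1 X1 = g1" "h1 u = 1"
    using a1 Su ux by (fastforce simp: attains_def)
  obtain h2 where h2: "rdf E2 X2 {} h2" "sum h2 X2 = g2" "h2 u = 1"
    using a2 ux by (fastforce simp: attains_def)
  \<comment> \<open>Positivity makes the truncated subtraction in the claimed weight exact.\<close>
  have pos: "g1 \<ge> 1" "g2 \<ge> 1"
    using h1 h2 fin ux member_le_sum[of u X1 h1] member_le_sum[of u X2 h2] by auto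
  have "tight ?E ?X S ?g"
    unfolding tight_def
  proof (intro allI impI)
    fix f assume f: "rdf ?E ?X {v. S v = StC} f"
    show "?g \<le> sum f ?X \<and> (sum f ?X = ?g \<longrightarrow> (\<forall>v\<in>?X. f v \<in> status_values (S v)))" (is ?thesis)
    proof -
    have f': "rdf (E2 \<union> E1) (X2 \<union> X1) {v. ?S v = StC} f"
      using f by (simp add: Un_commute C)
    note r1 = rdf_restrict_glue[OF sub u f]
    note r2 = rdf_restrict_glue[OF sub(2,1) _ f', of u]
    have u': "X2 \<inter> X1 = {u}" using u by auto
    have sum: "sum f ?X + f u = sum f X1 + sum f X2"
      using fin u by (simp add: sum.union_inter[symmetric])
    have T1: "g1 \<le> sum h X1" "sum h X1 = g1 \<Longrightarrow> v \<in> X1 \<Longrightarrow> h v \<in> status_values (S v)"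
      if "rdf E1 X1 {v. S v = StC} h" for h v
      using t1 that by (auto simp: tight_def)
    have T2: "g2 \<le> sum h X2" "sum h X2 = g2 \<Longrightarrow> v \<in> X2 \<Longrightarrow> h v \<in> status_values (?S v)"
      if "rdf E2 X2 {v. ?S v = StC} h" for h v
      using t2 that unfolding tight_def by blast+
    have le2: "f u \<le> 2" using f ux by (auto simp: rdf_def)
    \<comment> \<open>With value 0 or 1 at \<open>u\<close>, there are admissible functions on the
      two parts whose weights exceed that of \<open>f\<close> by one in total. This settles the
      bound and, in the case of equality, the values.\<close>
    have key: ?thesis
      if h: "rdf E1 X1 {v. S v = StC} h1" "rdf E2 X2 {v. ?S v = StC} h2"
        and eq: "\<forall>v\<in>X1 - {u}. h1 v = f v" "\<forall>v\<in>X2 - {u}. h2 v = f v"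
        and val: "f u \<in> status_values (S u)" and hs: "sum h1 X1 + sum h2 X2 = sum f ?X + 1" for h1 h2
    proof -
      note T = T1[OF h(1)] T2[OF h(2)]
      have "f v \<in> status_values (S v)" if "sum f ?X = ?g" "v \<in> ?X" for v
      proof -
        have "sum h1 X1 = g1" "sum h2 X2 = g2" using T(1,3) hs that(1) pos by linarith+
        then have "v \<in> X1 \<Longrightarrow> h1 v \<in> status_values (S v)" "v \<in> X2 \<Longrightarrow> h2 v \<in> status_values (?S v)"
          using T by auto
        with eq val that(2) show ?thesis by (cases "v = u") auto
      qed
      then show ?thesis using T(1,3) hs by auto
    qed
    consider "f u = 0" "\<exists>w\<in>X1. (u, w) \<in> E1 \<and> f w = 2" | "f u = 0" "\<exists>w\<in>X2. (u, w) \<in> E2 \<and> f w = 2"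
      | "f u = 1" | "f u = 2"
    proof -
      have "\<exists>w\<in>?X. (u, w) \<in> ?E \<and> f w = 2" if "f u = 0"
      proof -
        from f ux(1) that have "S u = StC \<or> (\<exists>w\<in>?X. (u, w) \<in> ?E \<and> f w = 2)"
          unfolding rdf_def by blast
        then show ?thesis using Su by auto
      qed
      then have "f u = 0 \<Longrightarrow> (\<exists>w\<in>X1. (u, w) \<in> E1 \<and> f w = 2) \<or> (\<exists>w\<in>X2. (u, w) \<in> E2 \<and> f w = 2)"
        using sub by blast
      moreover have "f u = 0 \<or> f u = 1 \<or> f u = 2" using le2 by linarith
      ultimately show ?thesis using that by metis
    qed
    then show ?thesis
    proof cases
      \<comment> \<open>Here \<open>u\<close> is dominated inside \<open>X1\<close>; in
        \<open>X2\<close> it receives value 1, which is the extra unit.\<close>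
      case 1
      then have "rdf E1 X1 {v. S v = StC} f" "rdf E2 X2 {v. ?S v = StC} (f(u := 1))"
        using r1(1) r2(2)[OF u'] by auto
      then show ?thesis
        by (rule key) (use 1 Su sum fin ux sum_upd_one[of X2 u f] in auto)
    next
      case 2
      then have "rdf E1 X1 {v. S v = StC} (f(u := 1))" "rdf E2 X2 {v. ?S v = StC} f"
        using r2(1)[OF u'] r1(2) by auto
      then show ?thesis
        by (rule key) (use 2 Su sum fin ux sum_upd_one[of X1 u f] in auto)
    next
      case 3
      then have "rdf E1 X1 {v. S v = StC} f" "rdf E2 X2 {v. ?S v = StC} f"
        using r1(1) r2(1)[OF u'] by auto
      then show ?thesis
        by (rule key) (use 3 Su sum in auto)
    next
      case 4
      then have R: "rdf E1 X1 {v. S v = StC} f" "rdf E2 X2 {v. ?S v = StC} f"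
        using r1(1) r2(1)[OF u'] by auto
      note T = T1[OF R(1)] T2[OF R(2)]
      \<comment> \<open>Status A does not allow value 2, so the second part is not at its
        minimum.\<close>
      have X2: "g2 + 1 \<le> sum f X2" using T(3) T(4)[of u] 4 ux by fastforce
      show ?thesis
      proof (cases "S u = StA")
        case True
        then have "g1 + 1 \<le> sum f X1" using T(1) T(2)[of u] 4 ux by fastforce
        then have "?g < sum f ?X" using X2 sum 4 pos by linarith
        then show ?thesis by simp
      next
        case False
        with Su have D: "S u = StD" "promotable E2 X2 {} ?S g2 u" by auto
        have "f v \<in> status_values (S v)" if "sum f ?X = ?g" "v \<in> ?X" for v
        proof (cases "v \<in> X1")
          case True
          have "sum f X1 = g1" using X2 T(1) sum 4 that pos by linarith
          with T(2) True show ?thesis by blast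
        next
          case False
          have "sum f X2 = g2 + 1" using X2 T(1) sum 4 that pos by linarith
          then have "\<forall>w\<in>X2 - {u}. f w \<in> status_values (?S w)"
            using D(2) R(2) 4 unfolding promotable_def by blast
          then show ?thesis using False that ux(1) by (cases "v = u") auto
        qed
        moreover have "?g \<le> sum f ?X" using X2 T(1) sum 4 pos by linarith
        ultimately show ?thesis by blast
      qed
    qed
    qed
  qed
  moreover have "attains ?E ?X {} S ?g"
    unfolding attains_def
  proof (intro ballI)
    fix v i assume v: "v \<in> ?X" and i: "i \<in> status_values (S v)"
    show "\<exists>f. rdf ?E ?X {} f \<and> sum f ?X = ?g \<and> f v = i"
    proof (cases "v \<in> X1")
      case True
      with a1 i obtain f1 where f1: "rdf E1 X1 {} f1" "sum f1 X1 = g1" "f1 v = i"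
        by (auto simp: attains_def)
      have "f1 u \<le> 2" using f1 ux by (auto simp: rdf_def)
      then consider "f1 u \<le> 1" | "f1 u = 2" by linarith
      then show ?thesis
      proof cases
        case 1
        have "f1 u = h2 u \<or> f1 u \<le> 1 \<and> h2 u \<le> 1" "max (f1 u) (h2 u) = 1" "min (f1 u) (h2 u) = f1 u"
          using 1 h2(3) by auto
        with rdf_combine_glue[OF fin u f1(1) h2(1)]
        obtain f where "rdf ?E ?X {} f" "sum f ?X + 1 = g1 + g2" "f u = f1 u" "\<forall>v\<in>X1 - {u}. f v = f1 v"
          unfolding f1(2) h2(2) by metis
        then show ?thesis using True f1(3) by (metis Diff_iff add_diff_cancel_right' singletonD)
      next
        case 2
        \<comment> \<open>Tightness of the first part excludes value 2 at a vertex of status A, so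
          \<open>u\<close> has status D.\<close>
        have "promotable E2 X2 {} ?S g2 u"
          using Su t1 f1 2 ux rdf_mono[OF f1(1)] by (fastforce simp: tight_def)
        then obtain f2 where f2: "rdf E2 X2 {} f2" "f2 u = 2" "sum f2 X2 = g2 + 1"
          by (auto simp: promotable_def)
        have "f1 u = f2 u \<or> f1 u \<le> 1 \<and> f2 u \<le> 1" "max (f1 u) (f2 u) = 2" "min (f1 u) (f2 u) = f1 u"
          using 2 f2(2) by auto
        with rdf_combine_glue[OF fin u f1(1) f2(1)]
        obtain f where "rdf ?E ?X {} f" "sum f ?X + 2 = g1 + (g2 + 1)" "f u = f1 u" "\<forall>v\<in>X1 - {u}. f v = f1 v"
          unfolding f1(2) f2(3) by metis
        then show ?thesis using True f1(3)
          by (intro exI[of _ f]) (auto simp: numeral_2_eq_2)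
      qed
    next
      case False
      with v i u have v2: "v \<in> X2 - {u}" "i \<in> status_values (?S v)" by auto
      with a2 obtain f2 where f2: "rdf E2 X2 {} f2" "sum f2 X2 = g2" "f2 v = i"
        unfolding attains_def by blast
      have "f2 u \<in> status_values (?S u)"
        using t2 f2 ux rdf_mono[OF f2(1)] unfolding tight_def by blast
      then have "f2 u \<le> 1" by auto
      then have "h1 u = f2 u \<or> h1 u \<le> 1 \<and> f2 u \<le> 1" "max (h1 u) (f2 u) = 1"
        using h1(3) by auto
      with rdf_combine_glue[OF fin u h1(1) f2(1)]
      obtain f where "rdf ?E ?X {} f" "sum f ?X + 1 = g1 + g2" "\<forall>v\<in>X2 - {u}. f v = f2 v"
        unfolding h1(2) f2(2) by metis
      then show ?thesis using v2 f2(3) by (metis add_diff_cancel_right')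
    qed
  qed
  ultimately show ?thesis using fin sub by (auto simp: good_def)
qed

text \<open>The old vertex \<open>u\<close> acts as a second neighbour of \<open>x\<close> with
  status D. Value 2 at \<open>x\<close> can relieve \<open>u\<close> and save one unit in the old
  tree, but then \<open>x\<close>, \<open>d\<close>, \<open>e\<close> cost at least 3; in all other
  cases the old tree is on its own and the new vertices cost at least 2.\<close>

lemma good_attach_F4:
  assumes 1: "good E1 X1 S g1" and u: "u \<in> X1" "S u = StD"
    and new: "x \<notin> X1" "d \<notin> X1" "e \<notin> X1" "distinct [x, d, e]"
    and S: "S x = StC" "S d = StD" "S e = StD"
  shows "good (E1 \<union> {(x, d), (d, x), (d, e), (e, d)} \<union> {(u, x), (x, u)}) (X1 \<union> {x, d, e}) S (g1 + 2)"
    (is "good ?E ?X S ?g")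
proof -
  have fin: "finite X1" and sub: "E1 \<subseteq> X1 \<times> X1" and t1: "tight E1 X1 S g1" and a1: "attains E1 X1 {} S g1"
    using 1 by (auto simp: good_def)
  have sum: "sum f ?X = sum f X1 + (f x + f d + f e)" for f :: "'a \<Rightarrow> nat"
    using fin new by (subst sum.union_disjoint) auto
  have nin: "(v, w) \<notin> E1" "(w, v) \<notin> E1" if "v \<notin> X1" for v w
    using sub that by auto
  have "tight ?E ?X S ?g"
    unfolding tight_def
  proof (intro allI impI)
    fix f assume f: "rdf ?E ?X {v. S v = StC} f"
    have X1: "f v \<le> 2 \<and> (f v = 0 \<longrightarrow> S v = StC \<or> (\<exists>w\<in>X1. (v, w) \<in> E1 \<and> f w = 2) \<or> v = u \<and> f x = 2)"
      if "v \<in> X1" for v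
    proof -
      have "v \<noteq> x" "v \<noteq> d" "v \<noteq> e" using that new by auto
      with f that sub show ?thesis unfolding rdf_def by blast
    qed
    have num: "f x \<le> 2" "f d \<le> 2" "f e \<le> 2" "f e = 0 \<Longrightarrow> f d = 2" "f d = 0 \<Longrightarrow> f x = 2 \<or> f e = 2"
    proof -
      show "f x \<le> 2" "f d \<le> 2" "f e \<le> 2" using f by (auto simp: rdf_def)
      have "f e = 0 \<Longrightarrow> e \<in> {v. S v = StC} \<or> (\<exists>w\<in>?X. (e, w) \<in> ?E \<and> f w = 2)"
        "f d = 0 \<Longrightarrow> d \<in> {v. S v = StC} \<or> (\<exists>w\<in>?X. (d, w) \<in> ?E \<and> f w = 2)"
        using f unfolding rdf_def by blast+
      then show "f e = 0 \<Longrightarrow> f d = 2" "f d = 0 \<Longrightarrow> f x = 2 \<or> f e = 2"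
        using S new u nin by auto
    qed
    have T: "g1 \<le> sum h X1" "sum h X1 = g1 \<Longrightarrow> v \<in> X1 \<Longrightarrow> h v \<in> status_values (S v)"
      if "rdf E1 X1 {v. S v = StC} h" for h v
      using t1 that by (auto simp: tight_def)
    show "?g \<le> sum f ?X \<and> (sum f ?X = ?g \<longrightarrow> (\<forall>v\<in>?X. f v \<in> status_values (S v)))"
    proof (cases "f x = 2 \<and> f u = 0")
      case True
      have "rdf E1 X1 {v. S v = StC} (f(u := 1))"
        unfolding rdf_def
      proof (intro ballI conjI impI)
        fix v assume v: "v \<in> X1"
        then show "(f(u := 1)) v \<le> 2" using X1[OF v] by simp
        assume 0: "(f(u := 1)) v = 0"
        then have "v \<noteq> u" "f v = 0" by (auto split: if_splits)
        with X1[OF v] have "S v = StC \<or> (\<exists>w\<in>X1. (v, w) \<in> E1 \<and> f w = 2)" by blast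
        moreover have "(f(u := 1)) w = 2" if "f w = 2" for w using True that by auto
        ultimately show "v \<in> {v. S v = StC} \<or> (\<exists>w\<in>X1. (v, w) \<in> E1 \<and> (f(u := 1)) w = 2)"
          by blast
      qed
      note T' = T[OF this]
      have sum': "sum (f(u := 1)) X1 = sum f X1 + 1"
        using fin u True by (intro sum_upd_one) auto
      have de: "f d + f e \<ge> 1" using num by linarith
      have "f v \<in> status_values (S v)" if "sum f ?X = ?g" "v \<in> ?X" for v
      proof (cases "v \<in> X1")
        case v: True
        have "sum (f(u := 1)) X1 = g1" using sum[of f] sum' True T'(1) that de by linarith
        from T'(2)[OF this v] u True show ?thesis by (cases "v = u") auto
      next
        case False
        then show ?thesis using that S True num by auto
      qed
      then show ?thesis using sum[of f] T'(1) sum' de True by auto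
    next
      case False
      then have "rdf E1 X1 {v. S v = StC} f"
        using X1 unfolding rdf_def by blast
      note T' = T[OF this]
      have "f v \<in> status_values (S v)" if "sum f ?X = ?g" "v \<in> ?X" for v
      proof (cases "v \<in> X1")
        case v: True
        have "sum f X1 = g1" using sum[of f] T'(1) that num by linarith
        from T'(2)[OF this v] show ?thesis .
      next
        case v: False
        have "f x \<noteq> 1" using sum[of f] T'(1) that num by linarith
        then show ?thesis using that S num v by auto
      qed
      moreover have "f x + f d + f e \<ge> 2" using num by linarith
      ultimately show ?thesis using sum[of f] T'(1) by auto
    qed
  qed
  moreover have "attains ?E ?X {} S ?g"
    unfolding attains_def
  proof (intro ballI)
    \<comment> \<open>Extension by prescribed values \<open>p\<close>, \<open>q\<close>,
      \<open>r\<close> at \<open>x\<close>, \<open>d\<close>, \<open>e\<close>; the old vertex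
      \<open>u\<close> may stay undominated precisely when \<open>p\<close> is 2.\<close>
    have ext: "\<exists>f. rdf ?E ?X {} f \<and> sum f ?X = sum f1 X1 + (p + q + r) \<and> (\<forall>v\<in>X1. f v = f1 v) \<and>
        f x = p \<and> f d = q \<and> f e = r"
      if f1: "rdf E1 X1 (if p = 2 then {u} else {}) f1" and "p \<le> 2" "q \<le> 2" "r \<le> 2"
        and "p = 0 \<Longrightarrow> f1 u = 2 \<or> q = 2" "q = 0 \<Longrightarrow> p = 2 \<or> r = 2" "r = 0 \<Longrightarrow> q = 2" for f1 p q r
    proof -
      obtain f where vals: "\<forall>v\<in>X1. f v = f1 v" "f x = p" "f d = q" "f e = r"
      proof
        show "\<forall>v\<in>X1. (f1(x := p, d := q, e := r)) v = f1 v" using new by auto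
      qed (use new in auto)
      have "sum f X1 = sum f1 X1" using vals(1) by (intro sum.cong) auto
      then have sum': "sum f ?X = sum f1 X1 + (p + q + r)" unfolding sum vals(2-4) by simp
      have "rdf ?E ?X {} f"
        unfolding rdf_def
      proof (intro ballI conjI impI)
        fix v assume v: "v \<in> ?X"
        show "f v \<le> 2"
        proof (cases "v \<in> X1")
          case True
          then show ?thesis using f1 vals(1) by (auto simp: rdf_def)
        next
          case False
          with v have "v = x \<or> v = d \<or> v = e" by auto
          then show ?thesis using vals(2-4) that(2-4) by metis
        qed
        assume 0: "f v = 0"
        show "v \<in> {} \<or> (\<exists>w\<in>?X. (v, w) \<in> ?E \<and> f w = 2)"
        proof (cases "v \<in> X1")
          case True
          then have "(v = u \<and> p = 2) \<or> (\<exists>w\<in>X1. (v, w) \<in> E1 \<and> f1 w = 2)"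
            using f1 0 vals(1) by (auto simp: rdf_def split: if_splits)
          then show ?thesis
          proof
            assume "v = u \<and> p = 2"
            then show ?thesis using vals(2) by blast
          next
            assume "\<exists>w\<in>X1. (v, w) \<in> E1 \<and> f1 w = 2"
            then obtain w where "w \<in> X1" "(v, w) \<in> E1" "f1 w = 2" by blast
            then show ?thesis using vals(1) by (intro disjI2 bexI[of _ w]) auto
          qed
        next
          case False
          with v have "v = x \<or> v = d \<or> v = e" by auto
          moreover have "x = v \<longrightarrow> f u = 2 \<or> f d = 2" "d = v \<longrightarrow> f x = 2 \<or> f e = 2" "e = v \<longrightarrow> f d = 2"
            using that(5-7) vals u 0 by auto
          ultimately show ?thesis using u by blast
        qed
      qed
      with vals sum' show ?thesis by blast
    qed
    have real: "\<exists>f1. rdf E1 X1 {} f1 \<and> sum f1 X1 = g1 \<and> f1 v = i"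
      if "v \<in> X1" "i \<in> status_values (S v)" for v i
      using a1 that by (auto simp: attains_def)
    obtain k2 where k2: "rdf E1 X1 {} k2" "sum k2 X1 = g1" "k2 u = 2" using real[of u 2] u by auto
    obtain k1 where k1: "rdf E1 X1 {} k1" "sum k1 X1 = g1" "k1 u = 1" using real[of u 1] u by auto
    have k0: "rdf E1 X1 {u} (k1(u := 0))"
      using rdf_release[OF k1(1), of u] k1(3) by simp
    have "sum k1 X1 = sum (k1(u := 0)) X1 + 1"
      using sum_upd_one[of X1 u "k1(u := 0)"] fin u k1(3) by (simp add: fun_upd_idem)
    then have k0s: "sum (k1(u := 0)) X1 + 3 = ?g" using k1(2) by simp
    fix v i assume v: "v \<in> ?X" and i: "i \<in> status_values (S v)"
    show "\<exists>f. rdf ?E ?X {} f \<and> sum f ?X = ?g \<and> f v = i"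
    proof (cases "v \<in> X1")
      case True
      with real[OF this i] obtain f1 where "rdf E1 X1 {} f1" "sum f1 X1 = g1" "f1 v = i" by auto
      \<comment> \<open>The value 2 at \<open>d\<close> dominates \<open>x\<close> and
        \<open>e\<close>, so any function on the old tree will do.\<close>
      with ext[of 0 f1 2 0] True show ?thesis by auto
    next
      case False
      have pick: "\<exists>f. rdf ?E ?X {} f \<and> sum f ?X = ?g \<and> f v = i"
        if "\<exists>f. rdf ?E ?X {} f \<and> sum f ?X = ?g \<and> f x = p \<and> f d = q \<and> f e = r"
          and "v = x \<and> i = p \<or> v = d \<and> i = q \<or> v = e \<and> i = r" for p q r
        using that by blast
      have "\<exists>f. rdf ?E ?X {} f \<and> sum f ?X = ?g \<and> f x = 0 \<and> f d = 2 \<and> f e = 0"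
        using ext[of 0 k2 2 0] k2 by simp blast
      note p1 = pick[OF this]
      have "\<exists>f. rdf ?E ?X {} f \<and> sum f ?X = ?g \<and> f x = 0 \<and> f d = 1 \<and> f e = 1"
        using ext[of 0 k2 1 1] k2 by simp blast
      note p2 = pick[OF this]
      have "\<exists>f. rdf ?E ?X {} f \<and> sum f ?X = ?g \<and> f x = 0 \<and> f d = 0 \<and> f e = 2"
        using ext[of 0 k2 0 2] k2 by simp blast
      note p3 = pick[OF this]
      have "\<exists>f. rdf ?E ?X {} f \<and> sum f ?X = ?g \<and> f x = 2 \<and> f d = 0 \<and> f e = 1"
        using ext[of 2 "k1(u := 0)" 0 1] k0 unfolding k0s[symmetric] by simp blast
      note p4 = pick[OF this]
      have "v = x \<and> (i = 0 \<or> i = 2) \<or> (v = d \<or> v = e) \<and> (i = 0 \<or> i = 1 \<or> i = 2)"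
        using False v i S by auto
      then show ?thesis using p1 p2 p3 p4 by argo
    qed
  qed
  moreover have "finite ?X" using fin by simp
  moreover have "?E \<subseteq> ?X \<times> ?X" using sub u(1) by blast
  ultimately show ?thesis unfolding good_def by blast
qed

section \<open>Labelings of the family\<close>

lemma pattern_altdef:
  "pattern ss es = (\<lparr>pverts = set [0..<length ss],
     parcs = set (concat (map (\<lambda>(a, b). [(a, b), (b, a)]) es))\<rparr>, (!) ss)"
proof -
  have "set es \<union> (set es)\<inverse> = set (concat (map (\<lambda>(a, b). [(a, b), (b, a)]) es))"
    by (induction es) auto
  then show ?thesis by (simp add: pattern_def lessThan_atLeast0)
qed

lemma patterns_explicit:
  "H1 = (\<lparr>pverts = {0, 1}, parcs = {(0, 1), (1, 0)}\<rparr>, (!) [StD, StD])"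
  "H2 = (\<lparr>pverts = {0, 1, 2, 3}, parcs = {(0, 1), (1, 0), (1, 2), (2, 1), (2, 3), (3, 2)}\<rparr>,
     (!) [StA, StB, StB, StA])"
  "H3 = (\<lparr>pverts = {0, 1, 2, 3, 4, 5}, parcs = {(0, 1), (1, 0), (0, 2), (2, 0), (0, 3), (3, 0),
     (1, 4), (4, 1), (1, 5), (5, 1)}\<rparr>, (!) [StC, StC, StA, StA, StA, StA])"
  "H4 = (\<lparr>pverts = {0, 1, 2, 3, 4, 5, 6}, parcs = {(0, 1), (1, 0), (0, 2), (2, 0), (0, 3), (3, 0),
     (1, 4), (4, 1), (1, 5), (5, 1), (5, 6), (6, 5)}\<rparr>, (!) [StC, StC, StA, StA, StA, StD, StD])"
  "H5 = (\<lparr>pverts = {0, 1, 2, 3, 4, 5, 6, 7}, parcs = {(0, 1), (1, 0), (0, 2), (2, 0), (0, 3), (3, 0),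
     (3, 4), (4, 3), (1, 5), (5, 1), (1, 6), (6, 1), (6, 7), (7, 6)}\<rparr>,
     (!) [StC, StC, StA, StD, StD, StA, StD, StD])"
  "H6 = (\<lparr>pverts = {0, 1, 2, 3, 4, 5, 6, 7}, parcs = {(0, 1), (1, 0), (0, 2), (2, 0), (0, 3), (3, 0),
     (1, 4), (4, 1), (4, 5), (5, 4), (1, 6), (6, 1), (6, 7), (7, 6)}\<rparr>,
     (!) [StC, StC, StA, StA, StD, StD, StD, StD])"
  "H7 = (\<lparr>pverts = {0, 1, 2, 3, 4, 5, 6, 7, 8}, parcs = {(0, 1), (1, 0), (0, 2), (2, 0), (0, 3), (3, 0),
     (3, 4), (4, 3), (1, 5), (5, 1), (5, 6), (6, 5), (1, 7), (7, 1), (7, 8), (8, 7)}\<rparr>,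
     (!) [StC, StC, StA, StD, StD, StD, StD, StD, StD])"
  "F1 = (\<lparr>pverts = {0, 1, 2}, parcs = {(0, 1), (1, 0), (1, 2), (2, 1)}\<rparr>, (!) [StA, StC, StA])"
  "F2 = (\<lparr>pverts = {0, 1, 2, 3}, parcs = {(0, 1), (1, 0), (1, 2), (2, 1), (2, 3), (3, 2)}\<rparr>,
     (!) [StA, StC, StD, StD])"
  "F3 = (\<lparr>pverts = {0, 1, 2, 3, 4}, parcs = {(0, 1), (1, 0), (1, 2), (2, 1), (2, 3), (3, 2),
     (3, 4), (4, 3)}\<rparr>, (!) [StD, StD, StC, StD, StD])"
  "F4 = (\<lparr>pverts = {0, 1, 2}, parcs = {(0, 1), (1, 0), (1, 2), (2, 1)}\<rparr>, (!) [StC, StD, StD])"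
  unfolding H1_def H2_def H3_def H4_def H5_def H6_def H7_def F1_def F2_def F3_def F4_def pattern_altdef
  by (simp_all add: upt_rec numeral_eq_Suc)

lemma distinct_map_inj:
  assumes "inj_on \<phi> A" "distinct xs" "set xs \<subseteq> A"
  shows "distinct (map \<phi> xs)"
  using assms by (simp add: distinct_map inj_on_subset)

text \<open>This is what separates B from C, which share their values. The clause for B fixes the
  whole neighbourhood; the clause for C only names two neighbours and therefore survives later
  attachments.\<close>

definition local_shape :: "('a \<times> 'a) set \<Rightarrow> 'a set \<Rightarrow> ('a \<Rightarrow> status) \<Rightarrow> bool" where
  "local_shape E X S \<longleftrightarrow> (\<forall>v\<in>X.
     (S v = StB \<longrightarrow> (\<exists>b a. {w. (v, w) \<in> E} = {b, a} \<and> S b = StB \<and> S a = StA)) \<and>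
     (S v = StC \<longrightarrow> (\<exists>p q. p \<noteq> q \<and> (v, p) \<in> E \<and> (v, q) \<in> E \<and> S p \<in> {StA, StD} \<and> S q \<in> {StA, StD})))"

lemma local_shape_StC:
  assumes "local_shape E X S" "v \<in> X" "S v = StC"
  obtains p q where "p \<noteq> q" "(v, p) \<in> E" "(v, q) \<in> E" "S p \<in> {StA, StD}" "S q \<in> {StA, StD}"
  using assms unfolding local_shape_def by metis

lemma local_shapeI:
  assumes "\<And>v. v \<in> X \<Longrightarrow> S v = StB \<Longrightarrow> {w. (v, w) \<in> E} = {b v, a v} \<and> S (b v) = StB \<and> S (a v) = StA"
    and "\<And>v. v \<in> X \<Longrightarrow> S v = StC \<Longrightarrow> p v \<noteq> q v \<and> (v, p v) \<in> E \<and> (v, q v) \<in> E \<and>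
      S (p v) \<in> {StA, StD} \<and> S (q v) \<in> {StA, StD}"
  shows "local_shape E X S"
  using assms unfolding local_shape_def by metis

text \<open>What O4 requires of its copy: any vertex of status A may become the identified one, so
  all of them have to be promotable.\<close>

definition gluable :: "('a \<times> 'a) set \<Rightarrow> 'a set \<Rightarrow> ('a \<Rightarrow> status) \<Rightarrow> bool" where
  "gluable E X S \<longleftrightarrow> (\<exists>g. good E X S g \<and> (\<forall>a\<in>X. S a = StA \<longrightarrow> promotable E X {} S g a))"

lemma arms_gluable:
  assumes "arm E1 X1 S g1 u" "arm E2 X2 S g2 x" "X1 \<inter> X2 = {}"
    and "E = E1 \<union> E2 \<union> {(u, x), (x, u)}" "X = X1 \<union> X2"
  shows "gluable E X S"
  unfolding gluable_def
proof (intro exI conjI ballI impI)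
  show "good E X S (g1 + g2)" using arms_good assms by metis
  fix a assume "a \<in> X" "S a = StA"
  then consider "a \<in> X1" | "a \<in> X2" using assms by auto
  then show "promotable E X {} S (g1 + g2) a"
  proof cases
    case 1
    then show ?thesis using arms_promotable[OF assms(1-3)] \<open>S a = StA\<close> assms(4,5) by simp
  next
    case 2
    have "X2 \<inter> X1 = {}" "E = E2 \<union> E1 \<union> {(x, u), (u, x)}" "X = X2 \<union> X1" using assms by auto
    then show ?thesis using arms_promotable[OF assms(2,1)] 2 \<open>S a = StA\<close> by (simp add: add.commute)
  qed
qed

section \<open>Copies of the patterns\<close>

definition image_arcs :: "(nat \<Rightarrow> 'a) \<Rightarrow> nat labeled \<Rightarrow> ('a \<times> 'a) set" where
  "image_arcs \<phi> L = parcs (graph_image \<phi> (fst L))"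

definition image_verts :: "(nat \<Rightarrow> 'a) \<Rightarrow> nat labeled \<Rightarrow> 'a set" where
  "image_verts \<phi> L = \<phi> ` pverts (fst L)"

lemmas image_explicit = image_arcs_def image_verts_def graph_image_def patterns_explicit

lemma gluable_copy:
  assumes inj: "inj_on \<phi> (pverts (fst L))" and S: "\<forall>w\<in>pverts (fst L). S (\<phi> w) = snd L w"
    and L: "L \<in> {H3, H4, H5, H6, H7}"
  shows "gluable (image_arcs \<phi> L) (image_verts \<phi> L) S"
proof -
  consider "L = H3" | "L = H4" | "L = H5" | "L = H6" | "L = H7" using L by auto
  then show ?thesis
  proof cases
    case 1
    have d: "distinct (map \<phi> [0, 2, 3, 1, 4, 5])"
      by (rule distinct_map_inj[OF inj]) (auto simp: 1 patterns_explicit)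
    show ?thesis
      by (rule arms_gluable[OF arm_AA[of "\<phi> 0" "\<phi> 2" "\<phi> 3"] arm_AA[of "\<phi> 1" "\<phi> 4" "\<phi> 5"]])
        (use d S in \<open>auto simp: 1 image_explicit\<close>)
  next
    case 2
    have d: "distinct (map \<phi> [0, 2, 3, 1, 4, 5, 6])"
      by (rule distinct_map_inj[OF inj]) (auto simp: 2 patterns_explicit)
    show ?thesis
      by (rule arms_gluable[OF arm_AA[of "\<phi> 0" "\<phi> 2" "\<phi> 3"] arm_AD[of "\<phi> 1" "\<phi> 4" "\<phi> 5" "\<phi> 6"]])
        (use d S in \<open>auto simp: 2 image_explicit\<close>)
  next
    case 3
    have d: "distinct (map \<phi> [0, 2, 3, 4, 1, 5, 6, 7])"
      by (rule distinct_map_inj[OF inj]) (auto simp: 3 patterns_explicit)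
    show ?thesis
      by (rule arms_gluable[OF arm_AD[of "\<phi> 0" "\<phi> 2" "\<phi> 3" "\<phi> 4"] arm_AD[of "\<phi> 1" "\<phi> 5" "\<phi> 6" "\<phi> 7"]])
        (use d S in \<open>auto simp: 3 image_explicit\<close>)
  next
    case 4
    have d: "distinct (map \<phi> [0, 2, 3, 1, 4, 5, 6, 7])"
      by (rule distinct_map_inj[OF inj]) (auto simp: 4 patterns_explicit)
    show ?thesis
      by (rule arms_gluable[OF arm_AA[of "\<phi> 0" "\<phi> 2" "\<phi> 3"] arm_DD[of "\<phi> 1" "\<phi> 4" "\<phi> 5" "\<phi> 6" "\<phi> 7"]])
        (use d S in \<open>auto simp: 4 image_explicit\<close>)
  next
    case 5
    have d: "distinct (map \<phi> [0, 2, 3, 4, 1, 5, 6, 7, 8])"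
      by (rule distinct_map_inj[OF inj]) (auto simp: 5 patterns_explicit)
    show ?thesis
      by (rule arms_gluable[OF arm_AD[of "\<phi> 0" "\<phi> 2" "\<phi> 3" "\<phi> 4"] arm_DD[of "\<phi> 1" "\<phi> 5" "\<phi> 6" "\<phi> 7" "\<phi> 8"]])
        (use d S in \<open>auto simp: 5 image_explicit\<close>)
  qed
qed

lemma good_copy:
  assumes inj: "inj_on \<phi> (pverts (fst L))" and S: "\<forall>w\<in>pverts (fst L). S (\<phi> w) = snd L w"
    and L: "L \<in> {H1, H2, H3, H4, H5, H6, H7}"
  shows "\<exists>g. good (image_arcs \<phi> L) (image_verts \<phi> L) S g"
proof -
  consider "L = H1" | "L = H2" | "L \<in> {H3, H4, H5, H6, H7}" using L by auto
  then show ?thesis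
  proof cases
    case 1
    have d: "distinct (map \<phi> [0, 1])"
      by (rule distinct_map_inj[OF inj]) (auto simp: 1 patterns_explicit)
    show ?thesis
      using good_H1[of "\<phi> 0" "\<phi> 1" S] d S by (auto simp: 1 image_explicit)
  next
    case 2
    have d: "distinct (map \<phi> [0, 1, 2, 3])"
      by (rule distinct_map_inj[OF inj]) (auto simp: 2 patterns_explicit)
    show ?thesis
      using good_H2[of "\<phi> 0" "\<phi> 1" "\<phi> 2" "\<phi> 3" S] d S by (auto simp: 2 image_explicit)
  next
    case 3
    from gluable_copy[OF inj S this] show ?thesis by (auto simp: gluable_def)
  qed
qed

lemma arm_copy:
  assumes inj: "inj_on \<phi> (pverts (fst L))" and S: "\<forall>w\<in>pverts (fst L). S (\<phi> w) = snd L w"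
    and L: "L \<in> {F1, F2, F3}" and x: "x \<in> pverts (fst L)" "snd L x = StC"
  shows "\<exists>g. arm (image_arcs \<phi> L) (image_verts \<phi> L) S g (\<phi> x)"
proof -
  consider "L = F1" | "L = F2" | "L = F3" using L by auto
  then show ?thesis
  proof cases
    case 1
    have d: "distinct (map \<phi> [1, 0, 2])"
      by (rule distinct_map_inj[OF inj]) (auto simp: 1 patterns_explicit)
    have "x = 1" using x by (auto simp: 1 patterns_explicit)
    moreover have "arm {(\<phi> 1, \<phi> 0), (\<phi> 0, \<phi> 1), (\<phi> 1, \<phi> 2), (\<phi> 2, \<phi> 1)} {\<phi> 1, \<phi> 0, \<phi> 2} S 2 (\<phi> 1)"
      by (rule arm_AA) (use d S in \<open>auto simp: 1 patterns_explicit\<close>)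
    ultimately show ?thesis by (auto simp: 1 image_explicit insert_commute)
  next
    case 2
    have d: "distinct (map \<phi> [1, 0, 2, 3])"
      by (rule distinct_map_inj[OF inj]) (auto simp: 2 patterns_explicit)
    have "x = 1" using x by (auto simp: 2 patterns_explicit)
    moreover have "arm {(\<phi> 1, \<phi> 0), (\<phi> 0, \<phi> 1), (\<phi> 1, \<phi> 2), (\<phi> 2, \<phi> 1), (\<phi> 2, \<phi> 3), (\<phi> 3, \<phi> 2)}
        {\<phi> 1, \<phi> 0, \<phi> 2, \<phi> 3} S 3 (\<phi> 1)"
      by (rule arm_AD) (use d S in \<open>auto simp: 2 patterns_explicit\<close>)
    ultimately show ?thesis by (auto simp: 2 image_explicit insert_commute)
  next
    case 3
    have d: "distinct (map \<phi> [2, 1, 0, 3, 4])"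
      by (rule distinct_map_inj[OF inj]) (auto simp: 3 patterns_explicit)
    have "x = 2" using x by (auto simp: 3 patterns_explicit)
    moreover have "arm {(\<phi> 2, \<phi> 1), (\<phi> 1, \<phi> 2), (\<phi> 1, \<phi> 0), (\<phi> 0, \<phi> 1), (\<phi> 2, \<phi> 3), (\<phi> 3, \<phi> 2),
        (\<phi> 3, \<phi> 4), (\<phi> 4, \<phi> 3)} {\<phi> 2, \<phi> 1, \<phi> 0, \<phi> 3, \<phi> 4} S 4 (\<phi> 2)"
      by (rule arm_DD) (use d S in \<open>auto simp: 3 patterns_explicit\<close>)
    ultimately show ?thesis by (auto simp: 3 image_explicit insert_commute)
  qed
qed

lemma local_shape_copy:
  assumes inj: "inj_on \<phi> (pverts (fst L))" and S: "\<forall>w\<in>pverts (fst L). S (\<phi> w) = snd L w"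
    and L: "L \<in> {H1, H2, H3, H4, H5, H6, H7, F1, F2, F3}"
  shows "local_shape (image_arcs \<phi> L) (image_verts \<phi> L) S"
proof -
  have *: "local_shape (parcs (fst L)) (pverts (fst L)) (snd L)"
    using L
  proof (elim insertE emptyE)
    show ?thesis if "L = H2"
      unfolding that
      \<comment> \<open>The inner vertices 1 and 2 are each other's partners. There is no vertex of
        status C, so \<open>p\<close> and \<open>q\<close> are arbitrary; likewise below for missing
        statuses.\<close>
      by (rule local_shapeI[where b = "\<lambda>v. if v = 1 then 2 else 1" and a = "\<lambda>v. if v = 1 then 0 else 3"
            and p = id and q = id])
        (auto simp: patterns_explicit)
    show ?thesis if "L = H1"
      unfolding that local_shape_def by (auto simp: patterns_explicit)
    show ?thesis if "L = H3"
      unfolding that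
      by (rule local_shapeI[where p = "\<lambda>v. if v = 0 then 2 else 4" and q = "\<lambda>v. if v = 0 then 3 else 5"
            and a = id and b = id])
        (auto simp: patterns_explicit)
    show ?thesis if "L = H4"
      unfolding that
      by (rule local_shapeI[where p = "\<lambda>v. if v = 0 then 2 else 4" and q = "\<lambda>v. if v = 0 then 3 else 5"
            and a = id and b = id])
        (auto simp: patterns_explicit)
    show ?thesis if "L = H5"
      unfolding that
      by (rule local_shapeI[where p = "\<lambda>v. if v = 0 then 2 else 5" and q = "\<lambda>v. if v = 0 then 3 else 6"
            and a = id and b = id])
        (auto simp: patterns_explicit)
    show ?thesis if "L = H6"
      unfolding that
      by (rule local_shapeI[where p = "\<lambda>v. if v = 0 then 2 else 4" and q = "\<lambda>v. if v = 0 then 3 else 6"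
            and a = id and b = id])
        (auto simp: patterns_explicit)
    show ?thesis if "L = H7"
      unfolding that
      by (rule local_shapeI[where p = "\<lambda>v. if v = 0 then 2 else 5" and q = "\<lambda>v. if v = 0 then 3 else 7"
            and a = id and b = id])
        (auto simp: patterns_explicit)
    show ?thesis if "L = F1"
      unfolding that
      by (rule local_shapeI[where p = "\<lambda>v. if v = 0 then 0 else 0" and q = "\<lambda>v. if v = 0 then 2 else 2"
            and a = id and b = id])
        (auto simp: patterns_explicit)
    show ?thesis if "L = F2"
      unfolding that
      by (rule local_shapeI[where p = "\<lambda>v. if v = 0 then 0 else 0" and q = "\<lambda>v. if v = 0 then 2 else 2"
            and a = id and b = id])
        (auto simp: patterns_explicit)
    show ?thesis if "L = F3"
      unfolding that
      by (rule local_shapeI[where p = "\<lambda>v. if v = 0 then 1 else 1" and q = "\<lambda>v. if v = 0 then 3 else 3"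
            and a = id and b = id])
        (auto simp: patterns_explicit)
  qed
  have wf: "parcs (fst L) \<subseteq> pverts (fst L) \<times> pverts (fst L)"
    using L by (elim insertE emptyE) (auto simp: patterns_explicit)
  \<comment> \<open>Injectivity gives an equality of neighbourhoods, which the clause for status B
    needs.\<close>
  have nb: "{w. (\<phi> v, w) \<in> image_arcs \<phi> L} = \<phi> ` {w. (v, w) \<in> parcs (fst L)}" if v: "v \<in> pverts (fst L)" for v
  proof (intro equalityI subsetI)
    fix y assume "y \<in> {w. (\<phi> v, w) \<in> image_arcs \<phi> L}"
    then obtain v' w where "(v', w) \<in> parcs (fst L)" "\<phi> v = \<phi> v'" "y = \<phi> w"
      by (auto simp: image_arcs_def graph_image_def)
    moreover from this have "v' = v" using inj v wf by (auto dest: inj_onD)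
    ultimately show "y \<in> \<phi> ` {w. (v, w) \<in> parcs (fst L)}" by blast
  qed (force simp: image_arcs_def graph_image_def)
  show ?thesis
    unfolding local_shape_def image_verts_def
  proof (intro ballI conjI impI)
    fix v' assume "v' \<in> \<phi> ` pverts (fst L)"
    then obtain v where v: "v' = \<phi> v" "v \<in> pverts (fst L)" by auto
    { assume "S v' = StB"
      with v S * obtain b a where ba: "{w. (v, w) \<in> parcs (fst L)} = {b, a}" "snd L b = StB" "snd L a = StA"
        unfolding local_shape_def by metis
      from ba(1) wf have "b \<in> pverts (fst L)" "a \<in> pverts (fst L)" by auto
      then have "S (\<phi> b) = StB" "S (\<phi> a) = StA" using S ba(2,3) by auto
      moreover have "{w. (v', w) \<in> image_arcs \<phi> L} = {\<phi> b, \<phi> a}" using nb[OF v(2)] v(1) ba(1) by simp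
      ultimately show "\<exists>b a. {w. (v', w) \<in> image_arcs \<phi> L} = {b, a} \<and> S b = StB \<and> S a = StA"
        by blast }
    { assume "S v' = StC"
      then have "snd L v = StC" using v S by simp
      from local_shape_StC[OF * v(2) this]
      obtain p q where pq: "p \<noteq> q" "(v, p) \<in> parcs (fst L)" "(v, q) \<in> parcs (fst L)"
          "snd L p \<in> {StA, StD}" "snd L q \<in> {StA, StD}" .
      then have X: "p \<in> pverts (fst L)" "q \<in> pverts (fst L)" using wf by auto
      then have "\<phi> p \<noteq> \<phi> q" using inj pq(1) by (simp add: inj_on_eq_iff)
      moreover have "(v', \<phi> p) \<in> image_arcs \<phi> L" "(v', \<phi> q) \<in> image_arcs \<phi> L"
        using pq(2,3) nb[OF v(2)] v(1) by blast+
      moreover have "S (\<phi> p) = snd L p" "S (\<phi> q) = snd L q" using S X by blast+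
      ultimately show "\<exists>p q. p \<noteq> q \<and> (v', p) \<in> image_arcs \<phi> L \<and> (v', q) \<in> image_arcs \<phi> L \<and>
          S p \<in> {StA, StD} \<and> S q \<in> {StA, StD}"
        using pq(4,5) by (intro exI[of _ "\<phi> p"] exI[of _ "\<phi> q"]) simp }
  qed
qed

text \<open>A vertex of status B next to \<open>u\<close> would lose its neighbour of status A if
  \<open>u\<close> kept status D, so that case requires a copy without status B. For a vertex of
  status C, neighbours of status A and D are equally good.\<close>

lemma local_shape_glue:
  assumes "local_shape E1 X1 S" "local_shape E2 X2 (S(u := StA))" "X1 \<inter> X2 = {u}"
    and "E1 \<subseteq> X1 \<times> X1" "E2 \<subseteq> X2 \<times> X2"
    and Su: "S u = StA \<or> S u = StD \<and> (\<forall>v\<in>X2. S v \<noteq> StB)"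
  shows "local_shape (E1 \<union> E2) (X1 \<union> X2) S"
  unfolding local_shape_def
proof (intro ballI conjI impI)
  fix v assume v: "v \<in> X1 \<union> X2"
  { assume B: "S v = StB"
    then have "v \<noteq> u" using Su by auto
    show "\<exists>b a. {w. (v, w) \<in> E1 \<union> E2} = {b, a} \<and> S b = StB \<and> S a = StA"
    proof (cases "v \<in> X1")
      case True
      have "v \<notin> X2" using assms(3) True \<open>v \<noteq> u\<close> by blast
      then have "{w. (v, w) \<in> E1 \<union> E2} = {w. (v, w) \<in> E1}" using assms(5) by blast
      with assms(1) True B show ?thesis unfolding local_shape_def by metis
    next
      case False
      then have eq: "{w. (v, w) \<in> E1 \<union> E2} = {w. (v, w) \<in> E2}" using assms(4) by blast
      have "v \<in> X2" "S u = StA" using False v B Su by auto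
      then have "S(u := StA) = S" by auto
      with assms(2) \<open>v \<in> X2\<close> B eq show ?thesis unfolding local_shape_def by metis
    qed }
  { assume C: "S v = StC"
    then have "v \<noteq> u" using Su by auto
    show "\<exists>p q. p \<noteq> q \<and> (v, p) \<in> E1 \<union> E2 \<and> (v, q) \<in> E1 \<union> E2 \<and> S p \<in> {StA, StD} \<and> S q \<in> {StA, StD}"
    proof (cases "v \<in> X1")
      case True
      from local_shape_StC[OF assms(1) this C] show ?thesis by blast
    next
      case False
      with v have "v \<in> X2" by auto
      moreover have "(S(u := StA)) v = StC" using C \<open>v \<noteq> u\<close> by simp
      ultimately obtain p q where "p \<noteq> q" "(v, p) \<in> E2" "(v, q) \<in> E2"
          "(S(u := StA)) p \<in> {StA, StD}" "(S(u := StA)) q \<in> {StA, StD}"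
        using local_shape_StC[OF assms(2)] by metis
      moreover have "S w \<in> {StA, StD}" if "(S(u := StA)) w \<in> {StA, StD}" for w
        using that Su by (cases "w = u") auto
      ultimately show ?thesis by blast
    qed }
qed

text \<open>The vertex \<open>u\<close> gains a neighbour, which the clause for status B would not
  tolerate. The neighbours required at \<open>x\<close> may include \<open>u\<close> itself; for
  \<open>F4\<close> they do.\<close>

lemma local_shape_attach:
  assumes 1: "local_shape E1 X1 S" and 2: "\<forall>v\<in>X2 - {x}. S v \<noteq> StB \<and> S v \<noteq> StC"
    and "X1 \<inter> X2 = {}" "E1 \<subseteq> X1 \<times> X1" "E2 \<subseteq> X2 \<times> X2" "u \<in> X1" "S u \<noteq> StB" "S x = StC" "x \<in> X2"
    and pq: "p \<noteq> q" "(x, p) \<in> E2 \<union> {(x, u)}" "(x, q) \<in> E2 \<union> {(x, u)}" "S p \<in> {StA, StD}" "S q \<in> {StA, StD}"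
  shows "local_shape (E1 \<union> E2 \<union> {(u, x), (x, u)}) (X1 \<union> X2) S" (is "local_shape ?E _ S")
  unfolding local_shape_def
proof (intro ballI conjI impI)
  fix v assume v: "v \<in> X1 \<union> X2"
  { assume B: "S v = StB"
    with 2 assms v have "v \<in> X1" "v \<noteq> u" by auto
    then have "{w. (v, w) \<in> ?E} = {w. (v, w) \<in> E1}" using assms by auto
    with 1 \<open>v \<in> X1\<close> B show "\<exists>b a. {w. (v, w) \<in> ?E} = {b, a} \<and> S b = StB \<and> S a = StA"
      unfolding local_shape_def by metis }
  { assume C: "S v = StC"
    show "\<exists>p q. p \<noteq> q \<and> (v, p) \<in> ?E \<and> (v, q) \<in> ?E \<and> S p \<in> {StA, StD} \<and> S q \<in> {StA, StD}"
    proof (cases "v \<in> X1")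
      case True
      from local_shape_StC[OF 1 this C] show ?thesis by blast
    next
      case False
      with v 2 C have "v = x" by auto
      with pq show ?thesis by blast
    qed }
qed

lemma local_shape_cong:
  assumes "\<And>v. v \<in> X \<Longrightarrow> S v = S' v" "E \<subseteq> X \<times> X"
  shows "local_shape E X S \<Longrightarrow> local_shape E X S'"
proof -
  have "local_shape E X S'" if L: "local_shape E X S"
    unfolding local_shape_def
  proof (intro ballI conjI impI)
    fix v assume v: "v \<in> X"
    { assume "S' v = StB"
      with v L assms(1) obtain b a where ba: "{w. (v, w) \<in> E} = {b, a}" "S b = StB" "S a = StA"
        unfolding local_shape_def by metis
      moreover from this have "b \<in> X" "a \<in> X" using assms(2) by auto
      ultimately show "\<exists>b a. {w. (v, w) \<in> E} = {b, a} \<and> S' b = StB \<and> S' a = StA"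
        using assms(1) by metis }
    { assume "S' v = StC"
      then have "S v = StC" using v assms(1) by simp
      from local_shape_StC[OF L v this]
      obtain p q where pq: "p \<noteq> q" "(v, p) \<in> E" "(v, q) \<in> E" "S p \<in> {StA, StD}" "S q \<in> {StA, StD}" .
      then have "p \<in> X" "q \<in> X" using assms(2) by auto
      then have "S' p = S p" "S' q = S q" using assms(1) by simp_all
      with pq show "\<exists>p q. p \<noteq> q \<and> (v, p) \<in> E \<and> (v, q) \<in> E \<and> S' p \<in> {StA, StD} \<and> S' q \<in> {StA, StD}"
        by (intro exI[of _ p] exI[of _ q]) simp }
  qed
  then show "local_shape E X S \<Longrightarrow> local_shape E X S'" .
qed

section \<open>The invariant of the family\<close>

definition certified :: "'a labeled \<Rightarrow> bool" where
  "certified M \<longleftrightarrow> pverts (fst M) \<noteq> {} \<and> (\<exists>g. good (parcs (fst M)) (pverts (fst M)) (snd M) g) \<and>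
     local_shape (parcs (fst M)) (pverts (fst M)) (snd M)"

lemma graph_image_sel:
  "pverts (graph_image \<phi> (fst L)) = image_verts \<phi> L" "parcs (graph_image \<phi> (fst L)) = image_arcs \<phi> L"
  by (simp_all add: graph_image_def image_verts_def image_arcs_def)

lemma attach_edge_iff:
  "attach_edge X L (T', S') (T, S) \<longleftrightarrow> (\<exists>\<phi> u x.
     inj_on \<phi> (pverts (fst L)) \<and> \<phi> ` pverts (fst L) \<inter> pverts T' = {} \<and>
     u \<in> pverts T' \<and> S' u = X \<and> x \<in> pverts (fst L) \<and> snd L x = StC \<and>
     pverts T = pverts T' \<union> image_verts \<phi> L \<and>
     parcs T = parcs T' \<union> image_arcs \<phi> L \<union> {(u, \<phi> x), (\<phi> x, u)} \<and>
     (\<forall>w\<in>pverts T'. S w = S' w) \<and> (\<forall>w\<in>pverts (fst L). S (\<phi> w) = snd L w))"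
  by (cases L) (simp add: attach_edge_def flip: graph_image_sel)

lemma identify_iff:
  "identify X L (T', S') (T, S) \<longleftrightarrow> (\<exists>\<phi> u v.
     inj_on \<phi> (pverts (fst L)) \<and> \<phi> ` pverts (fst L) \<inter> pverts T' = {u} \<and>
     S' u = X \<and> v \<in> pverts (fst L) \<and> snd L v = StA \<and> \<phi> v = u \<and>
     pverts T = pverts T' \<union> image_verts \<phi> L \<and>
     parcs T = parcs T' \<union> image_arcs \<phi> L \<and>
     (\<forall>w\<in>pverts T'. S w = S' w) \<and> (\<forall>w\<in>pverts (fst L) - {v}. S (\<phi> w) = snd L w))"
  by (cases L) (simp add: identify_def flip: graph_image_sel)

lemma certified_base:
  assumes "L \<in> {H1, H2, H3, H4, H5}" "is_copy L M"
  shows "certified M"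
proof -
  from assms(2) obtain \<phi> where inj: "inj_on \<phi> (pverts (fst L))" and M: "fst M = graph_image \<phi> (fst L)"
    and S: "\<forall>w\<in>pverts (fst L). snd M (\<phi> w) = snd L w"
    by (auto simp: is_copy_def split: prod.splits)
  have "L \<in> {H1, H2, H3, H4, H5, H6, H7}" "L \<in> {H1, H2, H3, H4, H5, H6, H7, F1, F2, F3}"
    using assms(1) by auto
  from good_copy[OF inj S this(1)] local_shape_copy[OF inj S this(2)]
  have "\<exists>g. good (image_arcs \<phi> L) (image_verts \<phi> L) (snd M) g"
    "local_shape (image_arcs \<phi> L) (image_verts \<phi> L) (snd M)" .
  moreover have "pverts (fst L) \<noteq> {}" using assms(1) by (auto simp: patterns_explicit)
  ultimately show ?thesis
    unfolding certified_def M graph_image_sel by (auto simp: image_verts_def)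
qed

lemma certified_attach_arm:
  assumes M': "certified M'" and L: "L \<in> {F1, F2, F3}" and att: "attach_edge StC L M' M"
  shows "certified M"
proof -
  obtain T' S' T S where eq: "M' = (T', S')" "M = (T, S)" by fastforce
  from att obtain \<phi> u x where inj: "inj_on \<phi> (pverts (fst L))"
    and disj: "\<phi> ` pverts (fst L) \<inter> pverts T' = {}" and u: "u \<in> pverts T'" "S' u = StC"
    and x: "x \<in> pverts (fst L)" "snd L x = StC"
    and V: "pverts T = pverts T' \<union> image_verts \<phi> L"
    and E: "parcs T = parcs T' \<union> image_arcs \<phi> L \<union> {(u, \<phi> x), (\<phi> x, u)}"
    and S': "\<forall>w\<in>pverts T'. S w = S' w" and S: "\<forall>w\<in>pverts (fst L). S (\<phi> w) = snd L w"
    unfolding eq attach_edge_iff by blast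
  from M' obtain g where g: "good (parcs T') (pverts T') S' g" and sh: "local_shape (parcs T') (pverts T') S'"
    by (auto simp: certified_def eq)
  then have g: "good (parcs T') (pverts T') S g" and sub: "parcs T' \<subseteq> pverts T' \<times> pverts T'"
    using S' good_cong[of "pverts T'" S S'] by (auto simp: good_def)
  have sh: "local_shape (parcs T') (pverts T') S"
    by (rule local_shape_cong[OF _ sub sh]) (use S' in auto)
  from arm_copy[OF inj S L x] obtain k where arm: "arm (image_arcs \<phi> L) (image_verts \<phi> L) S k (\<phi> x)" ..
  have Su: "S u = StC" using u S' by auto
  have disj': "pverts T' \<inter> image_verts \<phi> L = {}" using disj by (auto simp: image_verts_def)
  have "local_shape (parcs T) (pverts T) S"
  proof -
    have "local_shape (image_arcs \<phi> L) (image_verts \<phi> L) S"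
      by (rule local_shape_copy[OF inj S]) (use L in auto)
    moreover have "\<phi> x \<in> image_verts \<phi> L" "S (\<phi> x) = StC" and sub2: "image_arcs \<phi> L \<subseteq> image_verts \<phi> L \<times> image_verts \<phi> L"
      using arm by (auto simp: arm_def)
    ultimately obtain p q where "p \<noteq> q" "(\<phi> x, p) \<in> image_arcs \<phi> L" "(\<phi> x, q) \<in> image_arcs \<phi> L"
        "S p \<in> {StA, StD}" "S q \<in> {StA, StD}"
      using local_shape_StC by metis
    moreover have "\<forall>w\<in>pverts (fst L) - {x}. snd L w \<noteq> StB \<and> snd L w \<noteq> StC"
      using L x by (elim insertE emptyE) (auto simp: patterns_explicit)
    then have "\<forall>v\<in>image_verts \<phi> L - {\<phi> x}. S v \<noteq> StB \<and> S v \<noteq> StC"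
      using S by (auto simp: image_verts_def)
    ultimately show ?thesis
      unfolding V E
      using local_shape_attach[OF sh _ disj' sub sub2 u(1) _ \<open>S (\<phi> x) = StC\<close> \<open>\<phi> x \<in> image_verts \<phi> L\<close>] Su
      by (metis Un_iff status.distinct(7))
  qed
  moreover have "good (parcs T) (pverts T) S (g + k)"
    unfolding V E by (rule good_attach_arm[OF g arm disj' Su u(1)])
  ultimately show ?thesis using u V by (auto simp: certified_def eq)
qed

lemma certified_attach_F4:
  assumes M': "certified M'" and att: "attach_edge StD F4 M' M"
  shows "certified M"
proof -
  obtain T' S' T S where eq: "M' = (T', S')" "M = (T, S)" by fastforce
  from att obtain \<phi> u x where inj: "inj_on \<phi> (pverts (fst F4))"
    and disj: "\<phi> ` pverts (fst F4) \<inter> pverts T' = {}" and u: "u \<in> pverts T'" "S' u = StD"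
    and x: "x \<in> pverts (fst F4)" "snd F4 x = StC"
    and V: "pverts T = pverts T' \<union> image_verts \<phi> F4"
    and E: "parcs T = parcs T' \<union> image_arcs \<phi> F4 \<union> {(u, \<phi> x), (\<phi> x, u)}"
    and S': "\<forall>w\<in>pverts T'. S w = S' w" and S: "\<forall>w\<in>pverts (fst F4). S (\<phi> w) = snd F4 w"
    unfolding eq attach_edge_iff by blast
  from M' obtain g where g: "good (parcs T') (pverts T') S' g" and sh: "local_shape (parcs T') (pverts T') S'"
    by (auto simp: certified_def eq)
  then have g: "good (parcs T') (pverts T') S g" and sub: "parcs T' \<subseteq> pverts T' \<times> pverts T'"
    using S' good_cong[of "pverts T'" S S'] by (auto simp: good_def)
  have sh: "local_shape (parcs T') (pverts T') S"
    by (rule local_shape_cong[OF _ sub sh]) (use S' in auto)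
  have Su: "S u = StD" using u S' by auto
  have d: "distinct (map \<phi> [0, 1, 2])"
    by (rule distinct_map_inj[OF inj]) (auto simp: patterns_explicit)
  have "x = 0" using x by (auto simp: patterns_explicit)
  have V4: "image_verts \<phi> F4 = {\<phi> 0, \<phi> 1, \<phi> 2}"
    and E4: "image_arcs \<phi> F4 = {(\<phi> 0, \<phi> 1), (\<phi> 1, \<phi> 0), (\<phi> 1, \<phi> 2), (\<phi> 2, \<phi> 1)}"
    by (auto simp: image_explicit)
  have S4: "S (\<phi> 0) = StC" "S (\<phi> 1) = StD" "S (\<phi> 2) = StD"
    using S by (auto simp: patterns_explicit)
  have disj': "\<phi> 0 \<notin> pverts T'" "\<phi> 1 \<notin> pverts T'" "\<phi> 2 \<notin> pverts T'"
    using disj by (auto simp: patterns_explicit)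
  have "good (parcs T) (pverts T) S (g + 2)"
    unfolding V E V4 E4 \<open>x = 0\<close> by (rule good_attach_F4[OF g u(1) Su disj' _ S4]) (use d in auto)
  moreover have "local_shape (parcs T) (pverts T) S"
    unfolding V E V4 E4 \<open>x = 0\<close>
    by (rule local_shape_attach[OF sh, where p = u and q = "\<phi> 1"])
      (use S4 Su disj' u sub d in auto)
  ultimately show ?thesis using u V by (auto simp: certified_def eq)
qed

lemma certified_identify:
  assumes M': "certified M'" and id: "identify X L M' M"
    and X: "X = StA \<and> L \<in> {H2, H3, H4, H5, H6, H7} \<or> X = StD \<and> L \<in> {H3, H4, H6}"
  shows "certified M"
proof -
  obtain T' S' T S where eq: "M' = (T', S')" "M = (T, S)" by fastforce
  from id obtain \<phi> u v where inj: "inj_on \<phi> (pverts (fst L))"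
    and int: "\<phi> ` pverts (fst L) \<inter> pverts T' = {u}" and u: "S' u = X"
    and v: "v \<in> pverts (fst L)" "snd L v = StA" "\<phi> v = u"
    and V: "pverts T = pverts T' \<union> image_verts \<phi> L"
    and E: "parcs T = parcs T' \<union> image_arcs \<phi> L"
    and S': "\<forall>w\<in>pverts T'. S w = S' w" and S: "\<forall>w\<in>pverts (fst L) - {v}. S (\<phi> w) = snd L w"
    unfolding eq identify_iff by blast
  \<comment> \<open>Inside the copy the identified vertex counts as status A, whatever status it
    keeps in the tree.\<close>
  let ?S = "S(u := StA)"
  have SL: "\<forall>w\<in>pverts (fst L). ?S (\<phi> w) = snd L w"
  proof
    fix w assume w: "w \<in> pverts (fst L)"
    then have "\<phi> w = u \<longleftrightarrow> w = v" using inj v by (auto simp: inj_on_eq_iff)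
    then show "?S (\<phi> w) = snd L w" using w v S by auto
  qed
  from M' obtain g where g: "good (parcs T') (pverts T') S' g" and sh: "local_shape (parcs T') (pverts T') S'"
    by (auto simp: certified_def eq)
  then have g: "good (parcs T') (pverts T') S g" and sub: "parcs T' \<subseteq> pverts T' \<times> pverts T'"
    using S' good_cong[of "pverts T'" S S'] by (auto simp: good_def)
  have sh: "local_shape (parcs T') (pverts T') S"
    by (rule local_shape_cong[OF _ sub sh]) (use S' in auto)
  have uT: "u \<in> pverts T'" using int by auto
  have Su: "S u = X" using u uT S' by auto
  have int': "pverts T' \<inter> image_verts \<phi> L = {u}" using int by (auto simp: image_verts_def)
  have "\<exists>k. good (image_arcs \<phi> L) (image_verts \<phi> L) ?S k \<and>
      (X = StD \<longrightarrow> promotable (image_arcs \<phi> L) (image_verts \<phi> L) {} ?S k u)"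
  proof (cases "X = StD")
    case True
    then have "gluable (image_arcs \<phi> L) (image_verts \<phi> L) ?S"
      using X by (intro gluable_copy[OF inj SL]) auto
    then show ?thesis using int' unfolding gluable_def by fastforce
  next
    case False
    then have "L \<in> {H1, H2, H3, H4, H5, H6, H7}" using X by auto
    from good_copy[OF inj SL this] False show ?thesis by blast
  qed
  then obtain k where k: "good (image_arcs \<phi> L) (image_verts \<phi> L) ?S k"
    "X = StD \<longrightarrow> promotable (image_arcs \<phi> L) (image_verts \<phi> L) {} ?S k u" by blast
  have "good (parcs T) (pverts T) S (g + k - 1)"
    unfolding V E by (rule good_glue[OF g k(1) int']) (use X Su k(2) in auto)
  moreover have "local_shape (parcs T) (pverts T) S"
    unfolding V E
  proof (rule local_shape_glue[OF sh _ int' sub])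
    show "local_shape (image_arcs \<phi> L) (image_verts \<phi> L) ?S"
      by (rule local_shape_copy[OF inj SL]) (use X in auto)
    show "image_arcs \<phi> L \<subseteq> image_verts \<phi> L \<times> image_verts \<phi> L" using k by (auto simp: good_def)
    have "\<forall>w\<in>image_verts \<phi> L. S w \<noteq> StB" if "X = StD"
    proof
      fix y assume "y \<in> image_verts \<phi> L"
      then obtain w where w: "y = \<phi> w" "w \<in> pverts (fst L)" by (auto simp: image_verts_def)
      have "L \<in> {H3, H4, H6}" using that X by auto
      then have "snd L w \<noteq> StB" using w(2) by (elim insertE emptyE) (auto simp: patterns_explicit)
      then show "S y \<noteq> StB" using SL w Su that by (auto split: if_splits)
    qed
    then show "S u = StA \<or> S u = StD \<and> (\<forall>w\<in>image_verts \<phi> L. S w \<noteq> StB)"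
      using X Su by auto
  qed
  ultimately show ?thesis using uT V by (auto simp: certified_def eq)
qed

lemma tree_family_certified: "M \<in> tree_family \<Longrightarrow> certified M"
proof (induction rule: tree_family.induct)
  case (base L M) then show ?case by (rule certified_base)
next
  case (O1 M' L M) then show ?case using certified_attach_arm by blast
next
  case (O2 M' M) then show ?case using certified_attach_F4 by blast
next
  case (O3 M' L M) then show ?case using certified_identify by blast
next
  case (O4 M' L M) then show ?case using certified_identify by blast
qed

section \<open>Branches of a tree\<close>

text \<open>Below, \<open>E\<close> stays the arc set of the whole tree while \<open>X\<close>
  shrinks to a branch; the condition in \<open>rdf\<close> that the dominating vertex lies in
  \<open>X\<close> confines domination to the branch.\<close>

definition rdf_number :: "('a \<times> 'a) set \<Rightarrow> 'a set \<Rightarrow> 'a set \<Rightarrow> nat" where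
  "rdf_number E X Z = (LEAST k. \<exists>f. rdf E X Z f \<and> sum f X = k)"

lemma rdf_number_attained: "\<exists>f. rdf E X Z f \<and> sum f X = rdf_number E X Z"
  unfolding rdf_number_def by (rule LeastI_ex) (auto simp: rdf_def intro!: exI[of _ "\<lambda>_. 1"])

lemma rdf_number_le: "rdf E X Z f \<Longrightarrow> rdf_number E X Z \<le> sum f X"
  unfolding rdf_number_def by (rule Least_le) auto

lemma rdf_fill:
  assumes "rdf E X (insert u Z) f" "f u = 0"
  shows "rdf E X Z (f(u := 1))"
proof -
  have "(f(u := 1)) w = 2" if "f w = 2" for w
    using assms(2) that by auto
  moreover have "v \<noteq> u \<and> f v = 0" if "(f(u := 1)) v = 0" for v
    using that by (auto split: if_splits)
  moreover have "(f(u := 1)) v \<le> 2" if "f v \<le> 2" for v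
    using that by simp
  ultimately show ?thesis
    using assms(1) unfolding rdf_def by (metis insertE)
qed

text \<open>An exemption that is actually used can be repaid by value 1. So exempting one vertex
  saves 0 or 1, and a single bit records which.\<close>

lemma rdf_number_le_Suc_free:
  assumes "finite X" "u \<in> X"
  shows "rdf_number E X {} \<le> rdf_number E X {u} + 1"
proof -
  obtain f where f: "rdf E X {u} f" "sum f X = rdf_number E X {u}"
    using rdf_number_attained by metis
  show ?thesis
  proof (cases "f u = 0")
    case True
    then have "rdf E X {} (f(u := 1))" using f rdf_fill by metis
    from rdf_number_le[OF this] show ?thesis
      using sum_upd_one[of X u f] assms True f by simp
  next
    case False
    with f have "rdf E X {} f" by (auto simp: rdf_def)
    from rdf_number_le[OF this] show ?thesis using f by simp
  qed
qed

text \<open>Acyclicity takes the form in which it is used: every edge is a bridge, so that its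
  deletion, in both orientations, separates its ends.\<close>

locale utree =
  fixes V :: "'a set" and E :: "('a \<times> 'a) set"
  assumes fin: "finite V" and sub: "E \<subseteq> V \<times> V"
    and sym: "\<And>u v. (u, v) \<in> E \<Longrightarrow> (v, u) \<in> E"
    and conn: "\<And>u v. u \<in> V \<Longrightarrow> v \<in> V \<Longrightarrow> (u, v) \<in> E\<^sup>*"
    and bridge: "\<And>u w. (u, w) \<in> E \<Longrightarrow> (u, w) \<notin> (E - {(u, w), (w, u)})\<^sup>*"
begin

definition nbrs :: "'a \<Rightarrow> 'a set" where
  "nbrs v = {w. (v, w) \<in> E}"

definition branch :: "'a \<Rightarrow> 'a \<Rightarrow> 'a set" where
  "branch w v = {x. (w, x) \<in> (E - {(w, v), (v, w)})\<^sup>*}"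

lemma irrefl: "(u, u) \<notin> E"
  using bridge by blast

lemma nbrs_iff: "w \<in> nbrs v \<longleftrightarrow> (v, w) \<in> E"
  by (simp add: nbrs_def)

lemma nbrs_sym: "w \<in> nbrs v \<longleftrightarrow> v \<in> nbrs w"
  using sym by (auto simp: nbrs_def)

lemma nbrs_V: "nbrs v \<subseteq> V"
  using sub by (auto simp: nbrs_def)

lemma finite_nbrs: "finite (nbrs v)"
  using nbrs_V fin by (rule finite_subset)

lemma self_branch: "w \<in> branch w v"
  by (simp add: branch_def)

lemma notin_branch: "w \<in> nbrs v \<Longrightarrow> v \<notin> branch w v"
  using bridge[of w v] sym by (auto simp: branch_def nbrs_def)

text \<open>The deleted edge is the only exit: whoever leaves the branch goes from \<open>w\<close>
  to \<open>v\<close>.\<close>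

lemma branch_step:
  assumes "w \<in> nbrs v" "x \<in> branch w v" "(x, y) \<in> E"
  shows "y \<in> branch w v \<or> x = w \<and> y = v"
proof (cases "(x, y) \<in> {(w, v), (v, w)}")
  case True
  then show ?thesis using notin_branch assms by auto
next
  case False
  then have "(x, y) \<in> E - {(w, v), (v, w)}" using assms by auto
  then show ?thesis using assms(2) by (auto simp: branch_def intro: rtrancl_into_rtrancl)
qed

lemma branch_V: "w \<in> nbrs v \<Longrightarrow> branch w v \<subseteq> V"
proof
  fix x assume w: "w \<in> nbrs v" and "x \<in> branch w v"
  then have "(w, x) \<in> (E - {(w, v), (v, w)})\<^sup>*" by (simp add: branch_def)
  then show "x \<in> V" by induction (use w nbrs_V sub in auto)
qed

lemma finite_branch: "w \<in> nbrs v \<Longrightarrow> finite (branch w v)"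
  using branch_V fin by (rule finite_subset)

text \<open>A walk that starts in \<open>w'\<close> and avoids \<open>v\<close> cannot enter the
  branch of \<open>w\<close>, since by symmetry it would have to enter through
  \<open>v\<close>.\<close>

lemma branch_disjoint:
  assumes w: "w \<in> nbrs v" and w': "w' \<in> nbrs v" and "w \<noteq> w'"
  shows "branch w v \<inter> branch w' v = {}"
proof -
  have w'_notin: "w' \<notin> branch w v"
    using branch_step[OF w, of w' v] w' notin_branch[OF w] \<open>w \<noteq> w'\<close> by (auto simp: nbrs_iff intro: sym)
  have "x \<notin> branch w v" if "(w', x) \<in> (E - {(w', v), (v, w')})\<^sup>*" for x
    using that
  proof induction
    case base
    show ?case by (rule w'_notin)
  next
    case (step x y)
    then have "x \<noteq> v" using notin_branch[OF w'] by (auto simp: branch_def)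
    then show ?case using branch_step[OF w, of y x] step sym by blast
  qed
  then show ?thesis by (auto simp: branch_def)
qed

lemma branch_cover:
  assumes "v \<in> V"
  shows "V = insert v (\<Union>w\<in>nbrs v. branch w v)"
proof
  show "V \<subseteq> insert v (\<Union>w\<in>nbrs v. branch w v)"
  proof
    fix x assume "x \<in> V"
    with assms have "(v, x) \<in> E\<^sup>*" by (rule conn)
    then show "x \<in> insert v (\<Union>w\<in>nbrs v. branch w v)"
    proof induction
      case (step x y)
      show ?case
      proof (cases "x = v")
        case True
        then show ?thesis using step(2) self_branch by (intro insertI2 UN_I[of y]) (auto simp: nbrs_iff)
      next
        case False
        then obtain w where "w \<in> nbrs v" "x \<in> branch w v" using step(3) by auto
        from branch_step[OF this step(2)] this(1) show ?thesis by auto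
      qed
    qed simp
  qed
qed (use assms branch_V in auto)

text \<open>The branch of \<open>v\<close> seen from \<open>p\<close> consists of \<open>v\<close>
  and the branches at its other neighbours. This turns statements about stars into a recursion for
  the bits sent along the edges.\<close>

lemma branch_unfold:
  assumes p: "p \<in> nbrs v"
  shows "branch v p = insert v (\<Union>w\<in>nbrs v - {p}. branch w v)"
proof
  have v: "v \<in> nbrs p" using p nbrs_sym by simp
  show "branch v p \<subseteq> insert v (\<Union>w\<in>nbrs v - {p}. branch w v)"
  proof
    fix x assume "x \<in> branch v p"
    then have "(v, x) \<in> (E - {(v, p), (p, v)})\<^sup>*" by (simp add: branch_def)
    then show "x \<in> insert v (\<Union>w\<in>nbrs v - {p}. branch w v)"
    proof induction
      case (step x y)
      show ?case
      proof (cases "x = v")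
        case True
        then show ?thesis using step(2) self_branch by (intro insertI2 UN_I[of y]) (auto simp: nbrs_iff)
      next
        case False
        then obtain w where "w \<in> nbrs v - {p}" "x \<in> branch w v" using step(3) by auto
        moreover from this have "y \<in> branch w v \<or> x = w \<and> y = v"
          using branch_step step(2) by blast
        ultimately show ?thesis by auto
      qed
    qed simp
  qed
  have "x \<in> branch v p" if w: "w \<in> nbrs v - {p}" and "x \<in> branch w v" for w x
  proof -
    have "(w, x) \<in> (E - {(w, v), (v, w)})\<^sup>*" using that by (simp add: branch_def)
    then show ?thesis
    proof induction
      case base
      have "(v, w) \<in> E - {(v, p), (p, v)}" using w p irrefl by (auto simp: nbrs_iff)
      then show ?case by (auto simp: branch_def)
    next
      case (step x y)
      then have "x \<noteq> v" using notin_branch[of w v] w by (auto simp: branch_def)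
      then show ?case using branch_step[OF v, of x y] step by auto
    qed
  qed
  then show "insert v (\<Union>w\<in>nbrs v - {p}. branch w v) \<subseteq> branch v p"
    using self_branch by auto
qed

text \<open>All that \<open>v\<close> needs to know about the branch at its neighbour \<open>w\<close>: whether the branch costs one more
  if \<open>w\<close> is not dominated from outside, and whether it can dominate \<open>v\<close> at no extra cost.\<close>

definition raises :: "'a \<Rightarrow> 'a \<Rightarrow> bool" where
  "raises w v \<longleftrightarrow> rdf_number E (branch w v) {w} < rdf_number E (branch w v) {}"

definition supports :: "'a \<Rightarrow> 'a \<Rightarrow> bool" where
  "supports w v \<longleftrightarrow>
     (\<exists>f. rdf E (branch w v) {} f \<and> sum f (branch w v) = rdf_number E (branch w v) {} \<and> f w = 2)"

section \<open>Minimum weights of a vertex with some of its branches\<close>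

context
  fixes v :: 'a and M :: "'a set"
  assumes M: "M \<subseteq> nbrs v"
begin

text \<open>Two choices of \<open>M\<close> matter: all neighbours give the whole tree, and all but
  \<open>p\<close> give the branch of \<open>v\<close> seen from \<open>p\<close>.\<close>

definition star :: "'a set" where
  "star = insert v (\<Union>w\<in>M. branch w v)"

definition base_weight :: nat where
  "base_weight = (\<Sum>w\<in>M. rdf_number E (branch w v) {})"

definition n_raises :: nat where
  "n_raises = card {w \<in> M. raises w v}"

lemma finite_M: "finite M"
  using M finite_nbrs finite_subset by blast

lemma sum_star: "sum f star = f v + (\<Sum>w\<in>M. sum f (branch w v))" for f :: "'a \<Rightarrow> nat"
proof -
  have "sum f star = f v + sum f (\<Union>w\<in>M. branch w v)"
    unfolding star_def using M notin_branch finite_branch finite_M by (subst sum.insert) auto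
  also have "sum f (\<Union>w\<in>M. branch w v) = (\<Sum>w\<in>M. sum f (branch w v))"
    using M finite_branch finite_M branch_disjoint[of _ v] by (intro sum.UNION_disjoint) blast+
  finally show ?thesis .
qed

text \<open>A branch touches \<open>v\<close> only through its root \<open>w\<close>, so
  \<open>v\<close> can dominate nothing in it except \<open>w\<close>.\<close>

lemma star_restrict:
  assumes f: "rdf E star {v} f" and w: "w \<in> M"
  shows "rdf E (branch w v) (if f v = 2 then {w} else {}) f"
  unfolding rdf_def
proof (intro ballI conjI impI)
  have wn: "w \<in> nbrs v" using w M by auto
  fix x assume x: "x \<in> branch w v"
  then have xs: "x \<in> star" "x \<noteq> v" using w notin_branch[OF wn] by (auto simp: star_def)
  then show "f x \<le> 2" using f by (auto simp: rdf_def)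
  assume "f x = 0"
  with f xs obtain y where "(x, y) \<in> E" "f y = 2" by (auto simp: rdf_def)
  with branch_step[OF wn x this(1)]
  show "x \<in> (if f v = 2 then {w} else {}) \<or> (\<exists>y\<in>branch w v. (x, y) \<in> E \<and> f y = 2)" by auto
qed

lemma sum_raises: "(\<Sum>w\<in>M. if raises w v then 1 else 0) = n_raises"
  using finite_M by (simp add: n_raises_def sum.If_cases Int_def)

text \<open>A value other than 2 at \<open>v\<close> helps no branch. Value 2 exempts all roots,
  which lowers the minimum of a branch by one exactly if it raises.\<close>

lemma star_lower:
  assumes f: "rdf E star {v} f"
  shows "f v \<noteq> 2 \<Longrightarrow> base_weight + f v \<le> sum f star"
    and "f v = 2 \<Longrightarrow> base_weight + 2 \<le> sum f star + n_raises"
proof -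
  assume "f v \<noteq> 2"
  then have "rdf_number E (branch w v) {} \<le> sum f (branch w v)" if "w \<in> M" for w
    using star_restrict[OF f that] rdf_number_le by simp
  then show "base_weight + f v \<le> sum f star"
    unfolding sum_star base_weight_def by (simp add: sum_mono)
next
  assume 2: "f v = 2"
  have "rdf_number E (branch w v) {} \<le> sum f (branch w v) + (if raises w v then 1 else 0)" if "w \<in> M" for w
  proof -
    have "rdf_number E (branch w v) {w} \<le> sum f (branch w v)"
      using star_restrict[OF f that] rdf_number_le 2 by simp
    moreover have "rdf_number E (branch w v) {} \<le> rdf_number E (branch w v) {w} + 1"
      using that M finite_branch self_branch by (intro rdf_number_le_Suc_free) auto
    ultimately show ?thesis by (auto simp: raises_def)
  qed
  then have "base_weight \<le> (\<Sum>w\<in>M. sum f (branch w v) + (if raises w v then 1 else 0))"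
    unfolding base_weight_def by (rule sum_mono)
  then show "base_weight + 2 \<le> sum f star + n_raises"
    unfolding sum_star 2 sum.distrib sum_raises by simp
qed

text \<open>Equality pushes every branch to its own minimum, and the vertex that dominates
  \<open>v\<close> has to be the root of its branch.\<close>

lemma star_lower_supports:
  assumes f: "rdf E star {} f" and "f v = 0" and eq: "sum f star = base_weight"
  shows "\<exists>w\<in>M. supports w v"
proof -
  have f': "rdf E star {v} f" using f by (rule rdf_mono) simp
  have r: "rdf E (branch w v) {} f" if "w \<in> M" for w
    using star_restrict[OF f' that] \<open>f v = 0\<close> by simp
  have le: "rdf_number E (branch w v) {} \<le> sum f (branch w v)" if "w \<in> M" for w
    using r[OF that] by (rule rdf_number_le)
  have "(\<Sum>w\<in>M. rdf_number E (branch w v) {}) = (\<Sum>w\<in>M. sum f (branch w v))"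
    using eq \<open>f v = 0\<close> unfolding sum_star base_weight_def by simp
  then have sums: "sum f (branch w v) = rdf_number E (branch w v) {}" if "w \<in> M" for w
    using sum_mono_inv[where f = "\<lambda>w. rdf_number E (branch w v) {}" and g = "\<lambda>w. sum f (branch w v)", OF _ le that finite_M]
    by simp
  have "v \<in> star" by (simp add: star_def)
  with f \<open>f v = 0\<close> obtain y where y: "y \<in> star" "(v, y) \<in> E" "f y = 2" by (auto simp: rdf_def)
  then obtain w where w: "w \<in> M" "y \<in> branch w v" using irrefl by (auto simp: star_def)
  then have "y = w"
    using branch_step[of w v y v] notin_branch[of w v] M sym[OF y(2)] by auto
  then show ?thesis using w r sums y by (auto simp: supports_def)
qed

lemma star_combine:
  assumes F: "\<And>w. w \<in> M \<Longrightarrow> rdf E (branch w v) (if i = 2 then {w} else {}) (F w)"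
    and "i \<le> 2" and i: "i = 0 \<Longrightarrow> v \<in> Z \<or> (\<exists>w\<in>M. F w w = 2)"
  shows "\<exists>f. rdf E star Z f \<and> f v = i \<and> sum f star = i + (\<Sum>w\<in>M. sum (F w) (branch w v))"
proof -
  \<comment> \<open>Disjointness of the branches makes the description denote the only branch that
    contains \<open>x\<close>.\<close>
  define f where "f x = (if x = v then i else F (THE w. w \<in> M \<and> x \<in> branch w v) x)" for x
  have fw: "f x = F w x" if "w \<in> M" "x \<in> branch w v" for w x
  proof -
    have "(THE w. w \<in> M \<and> x \<in> branch w v) = w"
      using that branch_disjoint[of _ v w] M by (intro the_equality) auto
    moreover have "x \<noteq> v" using that notin_branch M by auto
    ultimately show ?thesis by (simp add: f_def)
  qed
  have fv: "f v = i" by (simp add: f_def)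
  have "rdf E star Z f"
    unfolding rdf_def
  proof (intro ballI conjI impI)
    fix x assume x: "x \<in> star"
    then consider "x = v" | w where "w \<in> M" "x \<in> branch w v" by (auto simp: star_def)
    then have "f x \<le> 2 \<and> (f x = 0 \<longrightarrow> x \<in> Z \<or> (\<exists>u\<in>star. (x, u) \<in> E \<and> f u = 2))"
    proof cases
      case 1
      have "\<exists>u\<in>star. (v, u) \<in> E \<and> f u = 2" if "w \<in> M" "F w w = 2" for w
        using that fw[of w w] self_branch M by (auto simp: star_def nbrs_iff intro!: bexI[of _ w])
      then show ?thesis using 1 fv i \<open>i \<le> 2\<close> by auto
    next
      case (2 w)
      have le: "f x \<le> 2" using F[OF 2(1)] fw 2 by (auto simp: rdf_def)
      have "\<exists>u\<in>star. (x, u) \<in> E \<and> f u = 2" if "f x = 0"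
      proof -
        have "(i = 2 \<and> x = w) \<or> (\<exists>u\<in>branch w v. (x, u) \<in> E \<and> F w u = 2)"
          using F[OF 2(1)] fw[OF 2] 2(2) that by (auto simp: rdf_def split: if_splits)
        then show ?thesis
        proof
          assume "i = 2 \<and> x = w"
          moreover have "(w, v) \<in> E" using 2(1) M sym by (auto simp: nbrs_iff)
          ultimately show ?thesis using fv by (auto simp: star_def)
        next
          assume "\<exists>u\<in>branch w v. (x, u) \<in> E \<and> F w u = 2"
          then obtain u where "u \<in> branch w v" "(x, u) \<in> E" "F w u = 2" by blast
          then show ?thesis using fw[OF 2(1)] 2(1) by (intro bexI[of _ u]) (auto simp: star_def)
        qed
      qed
      with le show ?thesis by blast
    qed
    then show "f x \<le> 2" "f x = 0 \<Longrightarrow> x \<in> Z \<or> (\<exists>u\<in>star. (x, u) \<in> E \<and> f u = 2)" by auto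
  qed
  moreover have "sum f star = i + (\<Sum>w\<in>M. sum (F w) (branch w v))"
    unfolding sum_star fv using fw by (auto intro!: sum.cong)
  ultimately show ?thesis using fv by blast
qed

text \<open>For the values 0 and 1 minimum functions \<open>F\<close> of the branches are combined,
  chosen with value 2 at every root that supports \<open>v\<close>. For value 2 the functions
  \<open>G\<close> leave the roots to \<open>v\<close> and so save one unit per raising
  branch.\<close>

lemma star_upper:
  shows "\<exists>f. rdf E star {v} f \<and> sum f star = base_weight"
    and "\<exists>w\<in>M. supports w v \<Longrightarrow> \<exists>f. rdf E star {} f \<and> f v = 0 \<and> sum f star = base_weight"
    and "\<exists>f. rdf E star {} f \<and> f v = 1 \<and> sum f star = base_weight + 1"
    and "\<exists>f. rdf E star {} f \<and> f v = 2 \<and> sum f star + n_raises = base_weight + 2"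
proof -
  have "\<forall>w. \<exists>f. rdf E (branch w v) {} f \<and> sum f (branch w v) = rdf_number E (branch w v) {} \<and>
      (supports w v \<longrightarrow> f w = 2)"
    using rdf_number_attained unfolding supports_def by metis
  then obtain F where F: "\<And>w. rdf E (branch w v) {} (F w)"
      "\<And>w. sum (F w) (branch w v) = rdf_number E (branch w v) {}" "\<And>w. supports w v \<Longrightarrow> F w w = 2"
    by metis
  have F2: "rdf E (branch w v) (if i = 2 then {w} else {}) (F w)" for w and i :: nat
    using F(1) rdf_mono by fastforce
  show "\<exists>f. rdf E star {v} f \<and> sum f star = base_weight"
    using star_combine[where i = 0 and F = F and Z = "{v}"] F2[where i = 0] F(2) by (auto simp: base_weight_def)
  show "\<exists>f. rdf E star {} f \<and> f v = 0 \<and> sum f star = base_weight" if "\<exists>w\<in>M. supports w v"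
  proof -
    have "\<exists>w\<in>M. F w w = 2" using that F(3) by blast
    then show ?thesis
      using star_combine[where i = 0 and F = F and Z = "{}"] F2[where i = 0] F(2) by (auto simp: base_weight_def)
  qed
  show "\<exists>f. rdf E star {} f \<and> f v = 1 \<and> sum f star = base_weight + 1"
    using star_combine[where i = 1 and F = F and Z = "{}"] F2[where i = 1] F(2) by (auto simp: base_weight_def)
  have "\<forall>w. \<exists>f. rdf E (branch w v) {w} f \<and>
      (w \<in> M \<longrightarrow> sum f (branch w v) + (if raises w v then 1 else 0) = rdf_number E (branch w v) {})"
  proof
    fix w
    have le: "rdf_number E (branch w v) {} \<le> rdf_number E (branch w v) {w} + 1" if "w \<in> M"
      using that M finite_branch self_branch by (intro rdf_number_le_Suc_free) auto
    show "\<exists>f. rdf E (branch w v) {w} f \<and>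
      (w \<in> M \<longrightarrow> sum f (branch w v) + (if raises w v then 1 else 0) = rdf_number E (branch w v) {})"
    proof (cases "raises w v")
      case True
      obtain f where "rdf E (branch w v) {w} f" "sum f (branch w v) = rdf_number E (branch w v) {w}"
        using rdf_number_attained by metis
      then show ?thesis using True le by (intro exI[of _ f]) (auto simp: raises_def)
    next
      case False
      then show ?thesis using F(1,2) rdf_mono by (intro exI[of _ "F w"]) fastforce
    qed
  qed
  then obtain G where G: "\<And>w. rdf E (branch w v) {w} (G w)"
    "\<And>w. w \<in> M \<Longrightarrow> sum (G w) (branch w v) + (if raises w v then 1 else 0) = rdf_number E (branch w v) {}"
    by metis
  obtain f where f: "rdf E star {} f" "f v = 2" "sum f star = 2 + (\<Sum>w\<in>M. sum (G w) (branch w v))"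
    using star_combine[where i = 2 and F = G and Z = "{}"] G(1) by auto
  have "(\<Sum>w\<in>M. sum (G w) (branch w v)) + n_raises = base_weight"
    unfolding sum_raises[symmetric] base_weight_def sum.distrib[symmetric] using G(2) by (intro sum.cong) auto
  then show "\<exists>f. rdf E star {} f \<and> f v = 2 \<and> sum f star + n_raises = base_weight + 2"
    using f by (intro exI[of _ f]) auto
qed

text \<open>With value 2, 1 or 0 at \<open>v\<close>, the optimal weights are \<open>base_weight + 2 - n_raises\<close>,
  \<open>base_weight + 1\<close> and at least \<open>base_weight\<close>, the last bound being attained iff a branch supports \<open>v\<close>.\<close>

lemma star_messages:
  shows "rdf_number E star {v} < rdf_number E star {} \<longleftrightarrow> n_raises \<le> 1 \<and> \<not> (\<exists>w\<in>M. supports w v)" (is ?A)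
    and "(\<exists>f. rdf E star {} f \<and> sum f star = rdf_number E star {} \<and> f v = 2) \<longleftrightarrow>
      n_raises \<ge> 2 \<or> n_raises = 1 \<and> \<not> (\<exists>w\<in>M. supports w v)" (is ?B)
    and "n_raises \<le> 1 \<Longrightarrow> \<exists>w\<in>M. supports w v \<Longrightarrow> rdf E star {} f \<Longrightarrow>
      sum f star = rdf_number E star {} \<Longrightarrow> f v = 0" (is "_ \<Longrightarrow> _ \<Longrightarrow> _ \<Longrightarrow> _ \<Longrightarrow> ?C")
proof -
  let ?z = "\<exists>w\<in>M. supports w v"
  have vs: "v \<in> star" by (simp add: star_def)
  obtain f0 where f0: "rdf E star {} f0" "sum f0 star = rdf_number E star {}" using rdf_number_attained by metis
  obtain f1 where f1: "rdf E star {v} f1" "sum f1 star = rdf_number E star {v}" using rdf_number_attained by metis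
  have f0': "rdf E star {v} f0" using f0(1) by (rule rdf_mono) simp
  have free: "rdf_number E star {v} \<le> base_weight" using star_upper(1) rdf_number_le by metis
  have one: "rdf_number E star {} \<le> base_weight + 1" using star_upper(3) rdf_number_le by metis
  obtain f2 where f2: "rdf E star {} f2" "f2 v = 2" "sum f2 star + n_raises = base_weight + 2"
    using star_upper(4) by blast
  have f2': "rdf E star {v} f2" using f2(1) by (rule rdf_mono) simp
  have two: "rdf_number E star {} + n_raises \<le> base_weight + 2" "rdf_number E star {v} + n_raises \<le> base_weight + 2"
    using rdf_number_le[OF f2(1)] rdf_number_le[OF f2'] f2(3) by linarith+
  have zero: "rdf_number E star {} \<le> base_weight" if ?z using star_upper(2)[OF that] rdf_number_le by metis
  have low: "(if f v = 2 then base_weight + 2 \<le> sum f star + n_raises else base_weight + f v \<le> sum f star)"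
      "f v = 0 \<or> f v = 1 \<or> f v = 2" if "rdf E star {v} f" for f
  proof -
    show "if f v = 2 then base_weight + 2 \<le> sum f star + n_raises else base_weight + f v \<le> sum f star"
      using star_lower[OF that] by auto
    have "f v \<le> 2" using that vs by (auto simp: rdf_def)
    then show "f v = 0 \<or> f v = 1 \<or> f v = 2" by linarith
  qed
  have lowz: "?z" if "rdf E star {} f" "f v = 0" "sum f star = base_weight" for f
    using star_lower_supports[OF that] .
  note l0 = low[OF f0'] and l1 = low[OF f1(1)]
  have z0: "?z \<or> sum f0 star \<noteq> base_weight \<or> f0 v \<noteq> 0" using lowz[OF f0(1)] by blast
  show ?A
  proof (cases ?z)
    case True
    then show ?thesis using l1 f1(2) zero two by (auto split: if_splits)
  next
    case False
    then show ?thesis using l0 l1 z0 f0(2) f1(2) free one two by (auto split: if_splits)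
  qed
  show ?B
  proof
    assume "\<exists>f. rdf E star {} f \<and> sum f star = rdf_number E star {} \<and> f v = 2"
    then obtain f where f: "rdf E star {} f" "sum f star = rdf_number E star {}" "f v = 2" by blast
    have "rdf E star {v} f" using f(1) by (rule rdf_mono) simp
    from low(1)[OF this] f one zero show "n_raises \<ge> 2 \<or> n_raises = 1 \<and> \<not> ?z"
      by (cases ?z) auto
  next
    assume n: "n_raises \<ge> 2 \<or> n_raises = 1 \<and> \<not> ?z"
    have "sum f2 star = rdf_number E star {}"
    proof (cases "n_raises \<ge> 2")
      case True
      then show ?thesis using l0 f0(2) f2(3) two by (auto split: if_splits)
    next
      case False
      with n have "n_raises = 1" "\<not> ?z" by auto
      then show ?thesis using l0 z0 f0(2) f2(3) two by (auto split: if_splits)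
    qed
    then show "\<exists>f. rdf E star {} f \<and> sum f star = rdf_number E star {} \<and> f v = 2" using f2 by blast
  qed
  show "f v = 0" if "n_raises \<le> 1" ?z "rdf E star {} f" "sum f star = rdf_number E star {}" for f
  proof -
    have "rdf E star {v} f" using that(3) by (rule rdf_mono) simp
    from low[OF this] zero[OF that(2)] that(1,4) show ?thesis by (auto split: if_splits)
  qed
qed

end

end

section \<open>Excellent trees\<close>

context utree
begin

definition excellent :: bool where
  "excellent \<longleftrightarrow> (\<forall>v\<in>V. \<exists>f. rdf E V {} f \<and> sum f V = rdf_number E V {} \<and> f v \<noteq> 0)"

text \<open>With value 2 at \<open>v\<close>, the best total is the sum of the branch minima plus 2
  minus this number.\<close>

definition level :: "'a \<Rightarrow> nat" where
  "level v = card {w \<in> nbrs v. raises w v}"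

lemma level_split:
  assumes "p \<in> nbrs v"
  shows "level v = n_raises v (nbrs v - {p}) + (if raises p v then 1 else 0)"
proof -
  have fin': "finite {w \<in> nbrs v - {p}. raises w v}" using finite_nbrs by simp
  have "{w \<in> nbrs v. raises w v} =
      (if raises p v then insert p {w \<in> nbrs v - {p}. raises w v} else {w \<in> nbrs v - {p}. raises w v})"
    using assms by auto
  then show ?thesis
    using fin' by (simp add: level_def n_raises_def[of "nbrs v - {p}" v])
qed

text \<open>Seen from \<open>p\<close>, the vertex \<open>v\<close> has only its other neighbours.
  Their number of raising ones is the level without the contribution of \<open>p\<close>, which
  explains the thresholds shifted by one here and in \<open>supports_iff\<close>.\<close>

lemma raises_iff:
  assumes "p \<in> nbrs v"
  shows "raises v p \<longleftrightarrow> level v \<le> (if raises p v then 2 else 1) \<and> \<not> (\<exists>w\<in>nbrs v - {p}. supports w v)"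
  using star_messages(1)[of "nbrs v - {p}" v] level_split[OF assms] branch_unfold[OF assms]
  by (auto simp: raises_def star_def)

lemma supports_iff:
  assumes "p \<in> nbrs v"
  shows "supports v p \<longleftrightarrow> level v \<ge> (if raises p v then 3 else 2) \<or>
    level v = (if raises p v then 2 else 1) \<and> \<not> (\<exists>w\<in>nbrs v - {p}. supports w v)"
  using star_messages(2)[of "nbrs v - {p}" v] level_split[OF assms] branch_unfold[OF assms]
  by (auto simp: supports_def[of v p] star_def)

end

section \<open>Consequences of excellence for the levels\<close>

locale excellent_tree = utree +
  assumes excellent: excellent
begin

text \<open>A supporting neighbour makes value 0 free, while at level at most 1 both other values
  cost at least one unit. Then every minimum function would vanish at \<open>v\<close>, against
  excellence.\<close>

lemma supports_level:
  assumes "w \<in> nbrs v" "supports w v"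
  shows "level v \<ge> 2"
proof (rule ccontr)
  assume "\<not> level v \<ge> 2"
  moreover have "v \<in> V" using assms(1) nbrs_sym nbrs_V by auto
  moreover have "star v (nbrs v) = V" using branch_cover[OF \<open>v \<in> V\<close>] by (simp add: star_def)
  ultimately have "f v = 0" if "rdf E V {} f" "sum f V = rdf_number E V {}" for f
    using star_messages(3)[of "nbrs v" v f] assms that by (auto simp: n_raises_def level_def)
  then show False using excellent \<open>v \<in> V\<close> unfolding excellent_def by metis
qed

text \<open>With three raising neighbours, value 2 stays profitable at \<open>v\<close> without the
  help of \<open>w\<close>: thus \<open>v\<close> supports \<open>w\<close> and does not raise it.
  Then \<open>w\<close> has level at least 2, and without being raised by \<open>v\<close> it cannot
  raise \<open>v\<close>.\<close>

lemma level_le_2: "level v \<le> 2"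
proof (rule ccontr)
  assume l: "\<not> level v \<le> 2"
  then have "{w \<in> nbrs v. raises w v} \<noteq> {}" unfolding level_def by (metis card.empty le0)
  then obtain w where w: "w \<in> nbrs v" "raises w v" by auto
  then have v: "v \<in> nbrs w" using nbrs_sym by simp
  have "supports v w" "\<not> raises v w" using supports_iff[OF w(1)] raises_iff[OF w(1)] l w by auto
  with supports_level[OF v] raises_iff[OF v] have "\<not> raises w v" by auto
  with w show False by simp
qed

text \<open>Both raising neighbours differ from \<open>x\<close> and already pay for value 2 at
  \<open>v\<close>, which therefore supports \<open>x\<close>. This lifts \<open>x\<close> to level
  2, and the situation is symmetric.\<close>

lemma level_2_not_raises:
  assumes "level v = 2" "x \<in> nbrs v" "\<not> raises x v"
  shows "supports v x" "\<not> raises v x" "level x = 2" "supports x v"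
proof -
  have v: "v \<in> nbrs x" using assms nbrs_sym by simp
  show 1: "supports v x" "\<not> raises v x" using supports_iff[OF assms(2)] raises_iff[OF assms(2)] assms by auto
  show "level x = 2" using supports_level[OF v 1(1)] level_le_2[of x] by simp
  then show "supports x v" using supports_iff[OF v] 1 by auto
qed

lemma level_2_raises:
  assumes "level v = 2" "w \<in> nbrs v" "raises w v"
  shows "raises v w \<longleftrightarrow> \<not> (\<exists>y\<in>nbrs v - {w}. supports y v)" "supports v w \<longleftrightarrow> raises v w"
  using supports_iff[OF assms(2)] raises_iff[OF assms(2)] assms by auto

text \<open>No neighbour supports \<open>v\<close>, since that would need level 2; this fixes the
  bits on all edges at \<open>v\<close>. The vertices \<open>v\<close> and \<open>d\<close> raise
  each other and form a pair of status D.\<close>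

lemma level_1:
  assumes "level v = 1"
  obtains d where "d \<in> nbrs v" "raises d v" "level d = 1" "\<not> supports d v"
    "\<And>x. x \<in> nbrs v \<Longrightarrow> x \<noteq> d \<Longrightarrow> level x = 2 \<and> \<not> raises x v \<and> \<not> supports x v \<and> raises v x \<and> supports v x"
proof -
  obtain d where d: "{w \<in> nbrs v. raises w v} = {d}"
    using assms card_1_singletonE unfolding level_def by metis
  then have dn: "d \<in> nbrs v" "raises d v" by auto
  then have v: "v \<in> nbrs d" using nbrs_sym by simp
  have ns: "\<not> supports w v" if "w \<in> nbrs v" for w
    using supports_level[OF that] assms by auto
  have "raises v d" using raises_iff[OF dn(1)] assms ns dn by auto
  \<comment> \<open>At level 2, \<open>d\<close> would support \<open>v\<close>; at level 0,
    \<open>v\<close> could not raise it.\<close>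
  then have "level d \<le> 2" "level d \<noteq> 2" "level d \<noteq> 0"
    using level_le_2 supports_iff[OF v] raises_iff[OF v] dn ns v finite_nbrs[of d]
    by (auto simp: level_def card_gt_0_iff)
  then have "level d = 1" by linarith
  moreover have "level x = 2 \<and> \<not> raises x v \<and> \<not> supports x v \<and> raises v x \<and> supports v x"
    if x: "x \<in> nbrs v" "x \<noteq> d" for x
  proof -
    have "\<not> raises x v" using x d by auto
    moreover from this have "raises v x" "supports v x"
      using raises_iff[OF x(1)] supports_iff[OF x(1)] assms ns by auto
    moreover have "v \<in> nbrs x" using x nbrs_sym by simp
    ultimately show ?thesis using supports_level[of v x] level_le_2[of x] ns x by force
  qed
  ultimately show ?thesis using that dn ns by blast
qed

lemma level_0:
  assumes "level v = 0" "w \<in> nbrs v"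
  shows "level w = 2" "raises v w" "\<not> supports v w" "\<not> supports w v"
proof -
  have v: "v \<in> nbrs w" using assms nbrs_sym by simp
  have none: "\<not> raises x v" if "x \<in> nbrs v" for x
    using assms(1) finite_nbrs that by (auto simp: level_def)
  have ns: "\<not> supports x v" if "x \<in> nbrs v" for x
    using supports_level[OF that] assms by auto
  show r: "raises v w" "\<not> supports v w"
    using raises_iff[OF assms(2)] supports_iff[OF assms(2)] assms none ns by auto
  show "\<not> supports w v" using ns assms by simp
  have "level w \<noteq> 0" using r v finite_nbrs by (auto simp: level_def)
  \<comment> \<open>The only neighbour that raises a vertex of level 1 has level 1 itself, unlike
    \<open>v\<close>.\<close>
  moreover have "level w \<noteq> 1"
  proof
    assume "level w = 1"
    then obtain d where "\<And>x. x \<in> nbrs w \<Longrightarrow> x \<noteq> d \<Longrightarrow> \<not> raises x w" "level d = 1"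
      by (metis level_1)
    with r v assms show False by (metis zero_neq_one)
  qed
  ultimately show "level w = 2" using level_le_2[of w] by linarith
qed

text \<open>The origin of status B. Since \<open>w\<close> has level 2 and raises \<open>v\<close>,
  it must in turn be raised by \<open>v\<close>, so no other neighbour supports \<open>v\<close>. A
  neighbour that does not raise \<open>v\<close> would support it; hence all neighbours raise
  \<open>v\<close>, and there are just two.\<close>

lemma level_2_pair:
  assumes v: "level v = 2" and w: "w \<in> nbrs v" "raises w v" "level w = 2"
  obtains a where "nbrs v = {w, a}" "level a = 0" "raises a v" "raises v w" "w \<noteq> a"
proof -
  have vw: "v \<in> nbrs w" using w nbrs_sym by simp
  have r: "raises v w" using level_2_not_raises(2)[OF w(3) vw] w(2) by blast
  then have ns: "\<not> supports y v" if "y \<in> nbrs v - {w}" for y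
    using level_2_raises[OF v w(1,2)] that by blast
  then have all: "raises y v" if "y \<in> nbrs v" for y
    using level_2_not_raises(4)[OF v that] w(2) that by blast
  then have "{y \<in> nbrs v. raises y v} = nbrs v" by auto
  then have "card (nbrs v) = 2" using v by (simp add: level_def)
  then obtain x y where "nbrs v = {x, y}" "x \<noteq> y" by (meson card_2_iff)
  with w(1) obtain a where a: "nbrs v = {w, a}" "w \<noteq> a" by (metis insertE insert_commute singletonD)
  then have an: "a \<in> nbrs v" "v \<in> nbrs a" "\<not> supports a v" "raises a v" using ns all nbrs_sym by auto
  \<comment> \<open>As \<open>a\<close> raises \<open>v\<close>, level 2 would make it support
    \<open>v\<close>; so would level 1, where only the partner of level 1 goes unsupported. Support
    by \<open>a\<close> has been excluded.\<close>
  have "level a \<noteq> 2"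
    using level_2_not_raises(2)[OF _ an(2)] level_2_raises(2)[OF _ an(2)] an by blast
  moreover have "level a \<noteq> 1"
  proof
    assume "level a = 1"
    then obtain d where "level d = 1" "\<And>x. x \<in> nbrs a \<Longrightarrow> x \<noteq> d \<Longrightarrow> supports a x"
      by (metis level_1)
    with an v show False by fastforce
  qed
  ultimately have "level a = 0" using level_le_2[of a] by linarith
  with a an r that show ?thesis by blast
qed

section \<open>The statuses of an excellent tree\<close>

definition lab :: "'a \<Rightarrow> status" where
  "lab v = (if level v = 0 then StA else if level v = 1 then StD
    else if \<exists>w\<in>nbrs v. raises w v \<and> level w = 2 then StB else StC)"

lemma lab_iff:
  "lab v = StA \<longleftrightarrow> level v = 0" "lab v = StD \<longleftrightarrow> level v = 1"
  "lab v = StB \<longleftrightarrow> level v = 2 \<and> (\<exists>w\<in>nbrs v. raises w v \<and> level w = 2)"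
  "lab v = StC \<longleftrightarrow> level v = 2 \<and> \<not> (\<exists>w\<in>nbrs v. raises w v \<and> level w = 2)"
proof -
  have "level v = 0 \<or> level v = 1 \<or> level v = 2" using level_le_2[of v] by linarith
  then show "lab v = StA \<longleftrightarrow> level v = 0" "lab v = StD \<longleftrightarrow> level v = 1"
    "lab v = StB \<longleftrightarrow> level v = 2 \<and> (\<exists>w\<in>nbrs v. raises w v \<and> level w = 2)"
    "lab v = StC \<longleftrightarrow> level v = 2 \<and> \<not> (\<exists>w\<in>nbrs v. raises w v \<and> level w = 2)"
    by (auto simp: lab_def)
qed

lemma lab_StA: "lab v = StA \<Longrightarrow> w \<in> nbrs v \<Longrightarrow> lab w \<in> {StB, StC}"
  using level_0(1) lab_iff by auto

lemma lab_StB_pair: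
  assumes "lab v = StB"
  obtains b a where "nbrs v = {b, a}" "lab b = StB" "lab a = StA" "raises b v" "raises a v"
proof -
  from assms obtain w where v: "level v = 2" and w: "w \<in> nbrs v" "raises w v" "level w = 2"
    by (auto simp: lab_iff)
  from level_2_pair[OF this] obtain a where a: "nbrs v = {w, a}" "level a = 0" "raises a v" "raises v w" .
  moreover have "v \<in> nbrs w" using w nbrs_sym by simp
  ultimately have "lab w = StB" "lab a = StA" using w v by (auto simp: lab_iff)
  with that a w show ?thesis by blast
qed

lemma lab_StD:
  assumes "lab v = StD"
  obtains d where "d \<in> nbrs v" "lab d = StD" "\<And>w. w \<in> nbrs v \<Longrightarrow> w \<noteq> d \<Longrightarrow> lab w = StC"
proof -
  have v: "level v = 1" using assms by (simp add: lab_iff)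
  from level_1[OF this] obtain d where d: "d \<in> nbrs v" "level d = 1"
    "\<And>x. x \<in> nbrs v \<Longrightarrow> x \<noteq> d \<Longrightarrow> level x = 2" by metis
  have "lab w = StC" if w: "w \<in> nbrs v" "w \<noteq> d" for w
  proof -
    have "lab w \<noteq> StB"
    proof
      assume "lab w = StB"
      then obtain b a where "nbrs w = {b, a}" "lab b = StB" "lab a = StA" by (rule lab_StB_pair)
      moreover have "v \<in> nbrs w" using w nbrs_sym by simp
      ultimately show False using v by (auto simp: lab_iff)
    qed
    then show ?thesis using d(3)[OF w] by (auto simp: lab_iff)
  qed
  with that d show ?thesis by (auto simp: lab_iff)
qed

text \<open>The last conclusion is what forces the patterns with two vertices of status C: an arm
  with a leaf of status A never stands alone.\<close>

lemma lab_StC: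
  assumes "lab v = StC"
  obtains p q where "p \<noteq> q" "{w \<in> nbrs v. lab w \<noteq> StC} = {p, q}" "lab p \<in> {StA, StD}" "lab q \<in> {StA, StD}"
    "lab p = StA \<or> lab q = StA \<Longrightarrow> \<exists>z\<in>nbrs v. lab z = StC"
proof -
  have v: "level v = 2" and none: "\<And>w. w \<in> nbrs v \<Longrightarrow> raises w v \<Longrightarrow> level w \<noteq> 2"
    using assms by (auto simp: lab_iff)
  from v obtain p q where pq: "{w \<in> nbrs v. raises w v} = {p, q}" "p \<noteq> q"
    unfolding level_def by (meson card_2_iff)
  then have p: "p \<in> nbrs v" "raises p v" and q: "q \<in> nbrs v" "raises q v" by auto
  have AD: "lab w \<in> {StA, StD}" if "w \<in> nbrs v" "raises w v" for w
    using none[OF that] level_le_2[of w] lab_iff(1,2)[of w] by auto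
  have C: "lab x = StC" if x: "x \<in> nbrs v" "\<not> raises x v" for x
  proof -
    note x' = level_2_not_raises[OF v x]
    have "lab x \<noteq> StB"
    proof
      assume "lab x = StB"
      then obtain b a where "nbrs x = {b, a}" "raises b x" "raises a x" by (metis lab_StB_pair)
      moreover have "v \<in> nbrs x" using x nbrs_sym by simp
      ultimately show False using x' by auto
    qed
    then show ?thesis using x'(3) by (auto simp: lab_iff)
  qed
  have nonC: "{w \<in> nbrs v. lab w \<noteq> StC} = {p, q}"
    using pq(1) AD C by force
  \<comment> \<open>Otherwise \<open>x\<close> and \<open>y\<close> are the only neighbours. As
    \<open>x\<close> has level 0, it does not support \<open>v\<close>, so \<open>v\<close> both
    raises and supports \<open>y\<close>. That lifts \<open>y\<close> to level 2, which is
    impossible for a raising neighbour of a vertex of status C.\<close>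
  have cond: "\<exists>z\<in>nbrs v. lab z = StC"
    if A: "lab x = StA" and x: "x \<in> nbrs v" "raises x v" and y: "y \<in> nbrs v" "raises y v"
      and xy: "{x, y} = {p, q}" for x y
  proof (rule ccontr)
    assume no: "\<not> (\<exists>z\<in>nbrs v. lab z = StC)"
    then have N: "nbrs v = {x, y}" using nonC xy by auto
    have vx: "v \<in> nbrs x" "v \<in> nbrs y" using x y nbrs_sym by auto
    have x0: "level x = 0" using A by (simp add: lab_iff)
    note x' = level_0[OF this vx(1)]
    have "x \<noteq> y" using xy pq(2) by auto
    have "\<not> supports v x" using x'(4) .
    then have "supports y v" using level_2_raises[OF v x] N by auto
    have "raises v y" "supports v y"
      using level_2_raises[OF v y] x'(3) N by auto
    then have "level y = 2" using supports_level[OF vx(2)] level_le_2[of y] by force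
    then show False using none[OF y] by simp
  qed
  show ?thesis
    by (rule that[OF pq(2) nonC AD[OF p] AD[OF q]])
      (use cond[OF _ p q] cond[OF _ q p] in \<open>auto simp: insert_commute\<close>)
qed

end

section \<open>Growing a labeled tree\<close>

text \<open>From here on domination is forgotten: the growth uses only these adjacency
  rules.\<close>

locale structured_tree = utree +
  fixes S :: "'a \<Rightarrow> status"
  assumes StA_nbrs: "\<And>v w. S v = StA \<Longrightarrow> w \<in> nbrs v \<Longrightarrow> S w \<in> {StB, StC}"
    and StB_nbrs: "\<And>v. S v = StB \<Longrightarrow> \<exists>b a. nbrs v = {b, a} \<and> S b = StB \<and> S a = StA"
    and StC_nbrs: "\<And>v. S v = StC \<Longrightarrow> \<exists>p q. p \<noteq> q \<and> {w \<in> nbrs v. S w \<noteq> StC} = {p, q} \<and>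
      S p \<in> {StA, StD} \<and> S q \<in> {StA, StD} \<and>
      (S p = StA \<or> S q = StA \<longrightarrow> (\<exists>z\<in>nbrs v. S z = StC))"
    and StD_nbrs: "\<And>v. S v = StD \<Longrightarrow> \<exists>d\<in>nbrs v. S d = StD \<and> (\<forall>w\<in>nbrs v. w \<noteq> d \<longrightarrow> S w = StC)"
begin

definition linked :: "'a set \<Rightarrow> bool" where
  "linked X \<longleftrightarrow> (\<forall>x\<in>X. \<forall>y\<in>X. (x, y) \<in> (E \<inter> X \<times> X)\<^sup>*)"

text \<open>The neighbours that every operation of the family creates together with \<open>v\<close>.\<close>

definition companions :: "'a \<Rightarrow> 'a set" where
  "companions v = {w \<in> nbrs v. S v = StB \<or> S v = StC \<and> S w \<noteq> StC \<or> S v = StD \<and> S w = StD}"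

text \<open>An edge that leaves a complete set never leads to a companion of its end inside, which
  restricts the possible pairs of statuses at its ends.\<close>

definition complete :: "'a set \<Rightarrow> bool" where
  "complete X \<longleftrightarrow> (\<forall>v\<in>X. companions v \<subseteq> X)"

definition built :: "'a set \<Rightarrow> bool" where
  "built X \<longleftrightarrow> X \<subseteq> V \<and> X \<noteq> {} \<and> linked X \<and> complete X \<and>
     (\<lparr>pverts = X, parcs = E \<inter> X \<times> X\<rparr>, S) \<in> tree_family"

section \<open>Connected vertex sets and their companions\<close>

lemma linked_mono: "(x, y) \<in> (E \<inter> X \<times> X)\<^sup>* \<Longrightarrow> X \<subseteq> Y \<Longrightarrow> (x, y) \<in> (E \<inter> Y \<times> Y)\<^sup>*"
  by (rule rtrancl_mono[THEN subsetD, rotated]) auto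

lemma linked_singleton: "linked {x}"
  by (simp add: linked_def)

lemma linked_join:
  assumes X: "linked X" and Y: "linked Y" and e: "u \<in> X" "w \<in> Y" "(u, w) \<in> E"
  shows "linked (X \<union> Y)"
proof -
  let ?R = "(E \<inter> (X \<union> Y) \<times> (X \<union> Y))\<^sup>*"
  have uw: "(u, w) \<in> ?R" "(w, u) \<in> ?R" using e sym by auto
  have "(x, u) \<in> ?R \<and> (u, x) \<in> ?R" if "x \<in> X \<union> Y" for x
  proof (cases "x \<in> X")
    case True
    then show ?thesis using X e linked_mono[of _ _ X "X \<union> Y"] unfolding linked_def by blast
  next
    case False
    then have "(x, w) \<in> ?R" "(w, x) \<in> ?R"
      using that Y e linked_mono[of _ _ Y "X \<union> Y"] unfolding linked_def by blast+
    then show ?thesis using uw by (meson rtrancl_trans)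
  qed
  then show ?thesis unfolding linked_def by (meson rtrancl_trans)
qed

lemma linked_insert: "linked X \<Longrightarrow> u \<in> X \<Longrightarrow> (u, w) \<in> E \<Longrightarrow> linked (insert w X)"
  using linked_join[of X "{w}" u w] linked_singleton by simp

text \<open>A common vertex or a second edge between the two connected sets would bypass the bridge
  from \<open>u\<close> to \<open>w\<close>.\<close>

lemma separation:
  assumes X: "linked X" and Y: "linked Y" and e: "u \<in> X" "w \<in> Y" "(u, w) \<in> E" and "u \<notin> Y" "w \<notin> X"
  shows "X \<inter> Y = {}"
    and "E \<inter> (X \<union> Y) \<times> (X \<union> Y) = E \<inter> X \<times> X \<union> E \<inter> Y \<times> Y \<union> {(u, w), (w, u)}"
proof -
  let ?R = "(E - {(u, w), (w, u)})\<^sup>*"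
  have RX: "(u, x) \<in> ?R" if "x \<in> X" for x
  proof -
    have "(u, x) \<in> (E \<inter> X \<times> X)\<^sup>*" using X e that by (simp add: linked_def)
    then show ?thesis by (rule rtrancl_mono[THEN subsetD, rotated]) (use assms in auto)
  qed
  have RY: "(y, w) \<in> ?R" if "y \<in> Y" for y
  proof -
    have "(y, w) \<in> (E \<inter> Y \<times> Y)\<^sup>*" using Y e that by (simp add: linked_def)
    then show ?thesis by (rule rtrancl_mono[THEN subsetD, rotated]) (use assms in auto)
  qed
  have no: "(u, w) \<notin> ?R" by (rule bridge[OF e(3)])
  show disj: "X \<inter> Y = {}" using RX RY no by (meson disjoint_iff rtrancl_trans)
  have cross: "x = u \<and> y = w" if "x \<in> X" "y \<in> Y" "(x, y) \<in> E" for x y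
  proof (rule ccontr)
    assume "\<not> (x = u \<and> y = w)"
    then have "(x, y) \<in> E - {(u, w), (w, u)}" using that disj e by auto
    then show False using RX[OF that(1)] RY[OF that(2)] no by (meson rtrancl.rtrancl_into_rtrancl rtrancl_trans)
  qed
  then show "E \<inter> (X \<union> Y) \<times> (X \<union> Y) = E \<inter> X \<times> X \<union> E \<inter> Y \<times> Y \<union> {(u, w), (w, u)}"
    using e sym[OF e(3)] sym by blast
qed

lemma no_triangle: "(x, y) \<in> E \<Longrightarrow> (y, z) \<in> E \<Longrightarrow> (z, x) \<notin> E"
proof
  assume e: "(x, y) \<in> E" "(y, z) \<in> E" "(z, x) \<in> E"
  then have "x \<noteq> y" "y \<noteq> z" "z \<noteq> x" using irrefl by auto
  then have "(x, z) \<in> E - {(x, y), (y, x)}" "(z, y) \<in> E - {(x, y), (y, x)}" using e sym by auto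
  then have "(x, y) \<in> (E - {(x, y), (y, x)})\<^sup>*" by (meson r_into_rtrancl rtrancl.rtrancl_into_rtrancl)
  with bridge[OF e(1)] show False by simp
qed

lemma complete_Un: "complete X \<Longrightarrow> complete Y \<Longrightarrow> complete (X \<union> Y)"
  by (auto simp: complete_def)

lemma companions_simps:
  "S v = StA \<Longrightarrow> companions v = {}"
  "S v = StB \<Longrightarrow> companions v = nbrs v"
  "S v = StC \<Longrightarrow> companions v = {w \<in> nbrs v. S w \<noteq> StC}"
  "S v = StD \<Longrightarrow> companions v = {w \<in> nbrs v. S w = StD}"
  by (auto simp: companions_def)

lemma companions_arc: "w \<in> companions v \<Longrightarrow> (v, w) \<in> E \<and> (w, v) \<in> E"
  using sym by (auto simp: companions_def nbrs_iff)

lemma companions_StD: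
  assumes "S d = StD"
  obtains e where "companions d = {e}" "S e = StD"
proof -
  from StD_nbrs[OF assms] obtain e where "e \<in> nbrs d" "S e = StD" "\<forall>w\<in>nbrs d. w \<noteq> e \<longrightarrow> S w = StC"
    by blast
  then show ?thesis using assms by (intro that[of e]) (auto simp: companions_simps)
qed

text \<open>A vertex of status D has exactly one neighbour of this status, so the relation is
  symmetric and the vertices of status D are perfectly matched along edges.\<close>

lemma mate:
  assumes "S d = StD"
  obtains e where "S e = StD" "(d, e) \<in> E" "companions d = {e}" "companions e = {d}" "d \<noteq> e"
proof -
  obtain e where e: "companions d = {e}" "S e = StD" using companions_StD[OF assms] .
  obtain d' where d': "companions e = {d'}" using companions_StD[OF e(2)] .
  have de: "(d, e) \<in> E" "(e, d) \<in> E" using companions_arc[of e d] e by auto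
  then have "d \<in> companions e" using assms e by (auto simp: companions_simps nbrs_iff)
  with d' have "companions e = {d}" by auto
  moreover have "d \<noteq> e" using de irrefl by auto
  ultimately show ?thesis using that e de by blast
qed

section \<open>Arms at a vertex of status C, with their induced edges\<close>

definition armAA where
  "armAA x a b \<longleftrightarrow> distinct [x, a, b] \<and> S x = StC \<and> S a = StA \<and> S b = StA \<and>
     linked {x, a, b} \<and> complete {x, a, b} \<and>
     E \<inter> {x, a, b} \<times> {x, a, b} = {(x, a), (a, x), (x, b), (b, x)}"

definition armAD where
  "armAD x a d e \<longleftrightarrow> distinct [x, a, d, e] \<and> S x = StC \<and> S a = StA \<and> S d = StD \<and> S e = StD \<and>
     linked {x, a, d, e} \<and> complete {x, a, d, e} \<and>
     E \<inter> {x, a, d, e} \<times> {x, a, d, e} = {(x, a), (a, x), (x, d), (d, x), (d, e), (e, d)}"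

definition armDD where
  "armDD x d e d' e' \<longleftrightarrow> distinct [x, d, e, d', e'] \<and> S x = StC \<and> S d = StD \<and> S e = StD \<and>
     S d' = StD \<and> S e' = StD \<and> linked {x, d, e, d', e'} \<and> complete {x, d, e, d', e'} \<and>
     E \<inter> {x, d, e, d', e'} \<times> {x, d, e, d', e'} =
       {(x, d), (d, x), (d, e), (e, d), (x, d'), (d', x), (d', e'), (e', d')}"

lemma not_adjacent_A: "S a = StA \<Longrightarrow> S b \<in> {StA, StD} \<Longrightarrow> (a, b) \<notin> E \<and> (b, a) \<notin> E"
  using StA_nbrs[of a b] sym[of b a] by (auto simp: nbrs_iff)

lemma armAAI:
  assumes x: "S x = StC" "companions x = {a, b}" "a \<noteq> b" and S: "S a = StA" "S b = StA"
  shows "armAA x a b"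
proof -
  have e: "(x, a) \<in> E" "(a, x) \<in> E" "(x, b) \<in> E" "(b, x) \<in> E"
    using x companions_arc[of a x] companions_arc[of b x] by auto
  have ne: "(a, b) \<notin> E" "(b, a) \<notin> E" using not_adjacent_A S by auto
  have "linked {x, a, b}"
    using linked_insert[OF linked_insert[OF linked_singleton[of x]], of x b x a] e
    by (simp add: insert_commute)
  moreover have "complete {x, a, b}"
    using x S by (simp add: complete_def companions_simps(1))
  moreover have "E \<inter> {x, a, b} \<times> {x, a, b} = {(x, a), (a, x), (x, b), (b, x)}"
    using e ne irrefl by blast
  ultimately show ?thesis using x S by (auto simp: armAA_def)
qed

lemma armADI:
  assumes x: "S x = StC" "companions x = {a, d}" and S: "S a = StA" "S d = StD"
  obtains e where "armAD x a d e"
proof -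
  obtain e where m: "S e = StD" "(d, e) \<in> E" "companions d = {e}" "companions e = {d}" "d \<noteq> e"
    using mate[OF S(2)] .
  have e: "(x, a) \<in> E" "(a, x) \<in> E" "(x, d) \<in> E" "(d, x) \<in> E" "(e, d) \<in> E"
    using x companions_arc[of a x] companions_arc[of d x] sym[OF m(2)] by auto
  have "(x, e) \<notin> E"
    using no_triangle[of x e d] e(4,5) by blast
  moreover from this have "(e, x) \<notin> E" using sym by blast
  ultimately have ne: "(a, d) \<notin> E" "(d, a) \<notin> E" "(a, e) \<notin> E" "(e, a) \<notin> E" "(x, e) \<notin> E" "(e, x) \<notin> E"
    using not_adjacent_A S m by auto
  have "linked {x, a, d, e}"
    using linked_insert[OF linked_insert[OF linked_insert[OF linked_singleton[of x]]], of x a x d d e] e m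
    by (simp add: insert_commute)
  moreover have "complete {x, a, d, e}"
    using x S m by (simp add: complete_def companions_simps(1))
  moreover have "E \<inter> {x, a, d, e} \<times> {x, a, d, e} = {(x, a), (a, x), (x, d), (d, x), (d, e), (e, d)}"
    using e m(2) ne irrefl by blast
  ultimately show ?thesis using x S m by (intro that[of e]) (auto simp: armAD_def)
qed

lemma armDDI:
  assumes x: "S x = StC" "companions x = {d, d'}" "d \<noteq> d'" and S: "S d = StD" "S d' = StD"
  obtains e e' where "armDD x d e d' e'"
proof -
  obtain e where m: "S e = StD" "(d, e) \<in> E" "companions d = {e}" "companions e = {d}" "d \<noteq> e"
    using mate[OF S(1)] .
  obtain e' where m': "S e' = StD" "(d', e') \<in> E" "companions d' = {e'}" "companions e' = {d'}" "d' \<noteq> e'"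
    using mate[OF S(2)] .
  have e: "(x, d') \<in> E" "(d', x) \<in> E" "(x, d) \<in> E" "(d, x) \<in> E" "(e, d) \<in> E" "(e', d') \<in> E"
    using x companions_arc[of d x] companions_arc[of d' x] sym[OF m(2)] sym[OF m'(2)] by auto
  have "(d, d') \<notin> E" using no_triangle[of d d' x] e by blast
  then have dd: "(d, d') \<notin> E" "(d', d) \<notin> E" "e \<noteq> d'" "e' \<noteq> d" using sym m m' by blast+
  have "e \<noteq> e'" using m m' x(3) by auto
  have D: "y = e" if "(d, y) \<in> E" "S y = StD" for y
    using that m S by (auto simp: companions_simps nbrs_iff)
  have D': "y = e'" if "(d', y) \<in> E" "S y = StD" for y
    using that m' S by (auto simp: companions_simps nbrs_iff)
  have De: "y = d" if "(e, y) \<in> E" "S y = StD" for y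
    using that m by (auto simp: companions_simps nbrs_iff)
  have "(x, e) \<notin> E" "(x, e') \<notin> E" using no_triangle[of x e d] no_triangle[of x e' d'] e by blast+
  then have ne: "(x, e) \<notin> E" "(x, e') \<notin> E" "(e, x) \<notin> E" "(e', x) \<notin> E" "(e, e') \<notin> E" "(e', e) \<notin> E"
      "(d, e') \<notin> E" "(e', d) \<notin> E" "(d', e) \<notin> E" "(e, d') \<notin> E"
    using sym D D' De m(1) m'(1) \<open>e \<noteq> e'\<close> dd by metis+
  have "linked {x, d, e, d', e'}"
    using linked_insert[OF linked_insert[OF linked_insert[OF linked_insert[OF linked_singleton[of x]]]],
        of x d x d' d e d' e'] e m m'
    by (simp add: insert_commute)
  moreover have "complete {x, d, e, d', e'}"
    using x m m' by (simp add: complete_def)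
  moreover have "E \<inter> {x, d, e, d', e'} \<times> {x, d, e, d', e'} =
       {(x, d), (d, x), (d, e), (e, d), (x, d'), (d', x), (d', e'), (e', d')}"
    using e m(2) m'(2) ne dd(1,2) irrefl by blast
  moreover have "distinct [x, d, e, d', e']" using x S m m' dd \<open>e \<noteq> e'\<close> by auto
  ultimately show ?thesis using x S m m' by (intro that[of e e']) (simp add: armDD_def)
qed

end

section \<open>Copies given by lists: entry i is the image of pattern vertex i\<close>

lemma image_verts_list:
    "image_verts ((!) [x0, x1]) H1 = {x0, x1}"
    "image_verts ((!) [x0, x1, x2, x3]) H2 = {x0, x1, x2, x3}"
    "image_verts ((!) [x0, x1, x2, x3, x4, x5]) H3 = {x0, x1, x2, x3, x4, x5}"
    "image_verts ((!) [x0, x1, x2, x3, x4, x5, x6]) H4 = {x0, x1, x2, x3, x4, x5, x6}"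
    "image_verts ((!) [x0, x1, x2, x3, x4, x5, x6, x7]) H5 = {x0, x1, x2, x3, x4, x5, x6, x7}"
    "image_verts ((!) [x0, x1, x2, x3, x4, x5, x6, x7]) H6 = {x0, x1, x2, x3, x4, x5, x6, x7}"
    "image_verts ((!) [x0, x1, x2, x3, x4, x5, x6, x7, x8]) H7 = {x0, x1, x2, x3, x4, x5, x6, x7,
    x8}"
    "image_verts ((!) [x0, x1, x2]) F1 = {x0, x1, x2}"
    "image_verts ((!) [x0, x1, x2, x3]) F2 = {x0, x1, x2, x3}"
    "image_verts ((!) [x0, x1, x2, x3, x4]) F3 = {x0, x1, x2, x3, x4}"
    "image_verts ((!) [x0, x1, x2]) F4 = {x0, x1, x2}"
  by (simp_all add: image_explicit)

lemma image_arcs_list: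
    "image_arcs ((!) [x0, x1]) H1 = {(x0, x1), (x1, x0)}"
    "image_arcs ((!) [x0, x1, x2, x3]) H2 = {(x0, x1), (x1, x0), (x1, x2), (x2, x1), (x2, x3), (x3,
    x2)}"
    "image_arcs ((!) [x0, x1, x2, x3, x4, x5]) H3 = {(x0, x1), (x1, x0), (x0, x2), (x2, x0), (x0,
    x3), (x3, x0), (x1, x4), (x4, x1), (x1, x5), (x5, x1)}"
    "image_arcs ((!) [x0, x1, x2, x3, x4, x5, x6]) H4 = {(x0, x1), (x1, x0), (x0, x2), (x2, x0),
    (x0, x3), (x3, x0), (x1, x4), (x4, x1), (x1, x5), (x5, x1), (x5, x6), (x6, x5)}"
    "image_arcs ((!) [x0, x1, x2, x3, x4, x5, x6, x7]) H5 = {(x0, x1), (x1, x0), (x0, x2), (x2, x0),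
    (x0, x3), (x3, x0), (x3, x4), (x4, x3), (x1, x5), (x5, x1), (x1, x6), (x6, x1), (x6, x7), (x7, x6)}"
    "image_arcs ((!) [x0, x1, x2, x3, x4, x5, x6, x7]) H6 = {(x0, x1), (x1, x0), (x0, x2), (x2, x0),
    (x0, x3), (x3, x0), (x1, x4), (x4, x1), (x4, x5), (x5, x4), (x1, x6), (x6, x1), (x6, x7), (x7, x6)}"
    "image_arcs ((!) [x0, x1, x2, x3, x4, x5, x6, x7, x8]) H7 = {(x0, x1), (x1, x0), (x0, x2), (x2,
    x0), (x0, x3), (x3, x0), (x3, x4), (x4, x3), (x1, x5), (x5, x1), (x5, x6), (x6, x5), (x1, x7), (x7,
    x1), (x7, x8), (x8, x7)}"
    "image_arcs ((!) [x0, x1, x2]) F1 = {(x0, x1), (x1, x0), (x1, x2), (x2, x1)}"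
    "image_arcs ((!) [x0, x1, x2, x3]) F2 = {(x0, x1), (x1, x0), (x1, x2), (x2, x1), (x2, x3), (x3,
    x2)}"
    "image_arcs ((!) [x0, x1, x2, x3, x4]) F3 = {(x0, x1), (x1, x0), (x1, x2), (x2, x1), (x2, x3),
    (x3, x2), (x3, x4), (x4, x3)}"
    "image_arcs ((!) [x0, x1, x2]) F4 = {(x0, x1), (x1, x0), (x1, x2), (x2, x1)}"
  by (simp_all add: image_explicit)

lemma pverts_length:
  "pverts (fst H1) = {..<2}" "pverts (fst H2) = {..<4}" "pverts (fst H3) = {..<6}"
  "pverts (fst H4) = {..<7}" "pverts (fst H5) = {..<8}" "pverts (fst H6) = {..<8}"
  "pverts (fst H7) = {..<9}" "pverts (fst F1) = {..<3}" "pverts (fst F2) = {..<4}"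
  "pverts (fst F3) = {..<5}" "pverts (fst F4) = {..<3}"
  by (simp_all add: H1_def H2_def H3_def H4_def H5_def H6_def H7_def F1_def F2_def F3_def F4_def pattern_def)

lemma inj_on_nth_lessThan: "distinct xs \<Longrightarrow> length xs = n \<Longrightarrow> inj_on ((!) xs) {..<n}"
  by (auto simp: inj_on_def nth_eq_iff_index_eq)

lemma nth_image_lessThan: "(!) xs ` {..<length xs} = set xs"
  by (simp add: set_conv_nth image_def Bex_def lessThan_def) metis

lemma pattern_statuses:
  "snd H1 = (!) [StD, StD]" "snd H2 = (!) [StA, StB, StB, StA]"
  "snd H3 = (!) [StC, StC, StA, StA, StA, StA]"
  "snd H4 = (!) [StC, StC, StA, StA, StA, StD, StD]"
  "snd H5 = (!) [StC, StC, StA, StD, StD, StA, StD, StD]"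
  "snd H6 = (!) [StC, StC, StA, StA, StD, StD, StD, StD]"
  "snd H7 = (!) [StC, StC, StA, StD, StD, StD, StD, StD, StD]"
  "snd F1 = (!) [StA, StC, StA]" "snd F2 = (!) [StA, StC, StD, StD]"
  "snd F3 = (!) [StD, StD, StC, StD, StD]" "snd F4 = (!) [StC, StD, StD]"
  by (simp_all add: patterns_explicit)

lemmas list_copy = image_verts_list image_arcs_list pverts_length pattern_statuses

section \<open>The operations as extensions of a built set\<close>

context structured_tree
begin

text \<open>\<open>P\<close> holds the new vertices and \<open>insert u P\<close> the whole copy.
  The copy regards \<open>u\<close> as a vertex of status A, hence the updated statuses in
  \<open>ss\<close>.\<close>

lemma built_identify:
  assumes X: "built X" and u: "u \<in> X" and w: "w \<notin> X" "w \<in> P" "u \<notin> P" "(u, w) \<in> E"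
    and P: "linked P" "P \<subseteq> V" "complete (X \<union> P)"
    and L: "S u = StA \<and> L \<in> {H2, H3, H4, H5, H6, H7} \<or> S u = StD \<and> L \<in> {H3, H4, H6}"
    and xs: "distinct xs" "pverts (fst L) = {..<length xs}" "image_verts ((!) xs) L = insert u P"
      "image_arcs ((!) xs) L = E \<inter> P \<times> P \<union> {(u, w), (w, u)}"
    and ss: "snd L = (!) (map (S(u := StA)) xs)"
  shows "built (X \<union> P)"
proof -
  let ?\<phi> = "(!) xs"
  have \<phi>: "inj_on ?\<phi> (pverts (fst L))" "image_verts ?\<phi> L = insert u P"
      "image_arcs ?\<phi> L = E \<inter> P \<times> P \<union> {(u, w), (w, u)}"
    using xs by (simp_all add: inj_on_nth_lessThan)
  have xsP: "set xs = insert u P"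
    using xs(3) unfolding image_verts_def xs(2) by (simp add: nth_image_lessThan)
  then obtain v where v: "v < length xs" "xs ! v = u" by (metis in_set_conv_nth insertI1)
  have S\<phi>: "S (xs ! y) = snd L y" if "y < length xs" "y \<noteq> v" for y
    using that v xs(1) ss by (auto simp: nth_eq_iff_index_eq)
  have vA: "snd L v = StA" using v ss by simp
  have lX: "linked X" using X by (simp add: built_def)
  note sep = separation[OF lX P(1) u w(2,4,3,1)]
  have "identify (S u) L (\<lparr>pverts = X, parcs = E \<inter> X \<times> X\<rparr>, S)
      (\<lparr>pverts = X \<union> P, parcs = E \<inter> (X \<union> P) \<times> (X \<union> P)\<rparr>, S)"
    unfolding identify_iff
  proof (intro exI conjI)
    show "?\<phi> ` pverts (fst L) \<inter> pverts \<lparr>pverts = X, parcs = E \<inter> X \<times> X\<rparr> = {u}"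
      using \<phi>(2) sep(1) u by (auto simp: image_verts_def)
  qed (use \<phi> v vA S\<phi> sep u xs(2) in auto)
  then have "(\<lparr>pverts = X \<union> P, parcs = E \<inter> (X \<union> P) \<times> (X \<union> P)\<rparr>, S) \<in> tree_family"
    using L X tree_family.O3 tree_family.O4 unfolding built_def by metis
  moreover have "linked (X \<union> P)" using linked_join[OF lX P(1) u w(2,4)] .
  ultimately show ?thesis using X P u by (auto simp: built_def)
qed

lemma built_attach:
  assumes X: "built X" and u: "u \<in> X" and w: "w \<notin> X" "w \<in> P" "u \<notin> P" "(u, w) \<in> E"
    and P: "linked P" "P \<subseteq> V" "complete (X \<union> P)"
    and L: "S u = StC \<and> L \<in> {F1, F2, F3} \<or> S u = StD \<and> L = F4"
    and xs: "distinct xs" "pverts (fst L) = {..<length xs}" "image_verts ((!) xs) L = P"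
      "image_arcs ((!) xs) L = E \<inter> P \<times> P"
    and ss: "snd L = (!) (map S xs)" and wC: "S w = StC"
  shows "built (X \<union> P)"
proof -
  let ?\<phi> = "(!) xs"
  have \<phi>: "inj_on ?\<phi> (pverts (fst L))" "image_verts ?\<phi> L = P" "image_arcs ?\<phi> L = E \<inter> P \<times> P"
    using xs by (simp_all add: inj_on_nth_lessThan)
  have "set xs = P"
    using xs(3) unfolding image_verts_def xs(2) by (simp add: nth_image_lessThan)
  then obtain x where x: "x < length xs" "xs ! x = w" using w(2) by (metis in_set_conv_nth)
  have S\<phi>: "S (xs ! y) = snd L y" if "y < length xs" for y
    using that ss by simp
  have xC: "snd L x = StC" using x ss wC by simp
  have lX: "linked X" using X by (simp add: built_def)
  note sep = separation[OF lX P(1) u w(2,4,3,1)]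
  have "attach_edge (S u) L (\<lparr>pverts = X, parcs = E \<inter> X \<times> X\<rparr>, S)
      (\<lparr>pverts = X \<union> P, parcs = E \<inter> (X \<union> P) \<times> (X \<union> P)\<rparr>, S)"
    unfolding attach_edge_iff
  proof (intro exI conjI)
    show "?\<phi> ` pverts (fst L) \<inter> pverts \<lparr>pverts = X, parcs = E \<inter> X \<times> X\<rparr> = {}"
      using \<phi>(2) sep(1) by (auto simp: image_verts_def)
  qed (use \<phi> x xC S\<phi> sep u xs(2) in auto)
  then have "(\<lparr>pverts = X \<union> P, parcs = E \<inter> (X \<union> P) \<times> (X \<union> P)\<rparr>, S) \<in> tree_family"
    using L X tree_family.O1 tree_family.O2 unfolding built_def by metis
  moreover have "linked (X \<union> P)" using linked_join[OF lX P(1) u w(2,4)] .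
  ultimately show ?thesis using X P u by (auto simp: built_def)
qed

lemma built_base:
  assumes X: "X \<subseteq> V" "X \<noteq> {}" "linked X" "complete X" and L: "L \<in> {H1, H2, H3, H4, H5}"
    and xs: "distinct xs" "pverts (fst L) = {..<length xs}" "image_verts ((!) xs) L = X"
      "image_arcs ((!) xs) L = E \<inter> X \<times> X"
    and ss: "snd L = (!) (map S xs)"
  shows "built X"
proof -
  let ?\<phi> = "(!) xs"
  have \<phi>: "inj_on ?\<phi> (pverts (fst L))" "image_verts ?\<phi> L = X" "image_arcs ?\<phi> L = E \<inter> X \<times> X"
    using xs by (simp_all add: inj_on_nth_lessThan)
  have S\<phi>: "S (xs ! y) = snd L y" if "y < length xs" for y
    using that ss by simp
  have "graph_image ?\<phi> (fst L) = \<lparr>pverts = X, parcs = E \<inter> X \<times> X\<rparr>"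
    using \<phi> by (simp add: graph_image_def image_verts_def image_arcs_def)
  then have "is_copy L (\<lparr>pverts = X, parcs = E \<inter> X \<times> X\<rparr>, S)"
    using \<phi>(1) S\<phi> xs(2) unfolding is_copy_def by (auto split: prod.splits)
  then show ?thesis using X L tree_family.base unfolding built_def by blast
qed

lemma arms_cases:
  assumes x: "S x = StC"
  obtains a b where "armAA x a b" | a d e where "armAD x a d e" | d e d' e' where "armDD x d e d' e'"
proof -
  from StC_nbrs[OF x] obtain p q where pq: "p \<noteq> q" "companions x = {p, q}"
    "S p \<in> {StA, StD}" "S q \<in> {StA, StD}" using x by (auto simp: companions_simps)
  then consider "S p = StA" "S q = StA" | "S p = StA" "S q = StD" | "S q = StA" "S p = StD"
    | "S p = StD" "S q = StD" by auto
  then show ?thesis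
  proof cases
    case 1
    then show ?thesis using armAAI[OF x pq(2,1)] that by blast
  next
    case 2
    then show ?thesis using armADI[OF x pq(2)] that by metis
  next
    case 3
    have "companions x = {q, p}" using pq by auto
    then show ?thesis using armADI[OF x _ 3] that by metis
  next
    case 4
    then show ?thesis using armDDI[OF x pq(2,1)] that by metis
  qed
qed

lemma linked_V:
  assumes "linked Y" "y \<in> Y" "y \<in> V"
  shows "Y \<subseteq> V"
proof
  fix z assume "z \<in> Y"
  then have "(y, z) \<in> (E \<inter> Y \<times> Y)\<^sup>*" using assms by (simp add: linked_def)
  then show "z \<in> V" by induction (use assms sub in auto)
qed

lemma built_C:
  assumes X: "built X" and u: "u \<in> X" "S u = StC" and w: "w \<notin> X" "(u, w) \<in> E" "S w = StC"
  shows "\<exists>P. w \<in> P \<and> built (X \<union> P)"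
proof -
  have cX: "complete X" using X by (simp add: built_def)
  have uw: "u \<noteq> w" using u w by auto
  have wV: "w \<in> V" using w sub by auto
  note step = built_attach[OF X u(1) w(1) _ _ w(2)]
  from w(3) show ?thesis
  proof (cases rule: arms_cases)
    case (1 a b)
    let ?P = "{w, a, b}"
    from 1 have arm: "distinct [w, a, b]" "S a = StA" "S b = StA" "linked ?P" "complete ?P"
      "E \<inter> ?P \<times> ?P = {(w, a), (a, w), (w, b), (b, w)}" by (simp_all add: armAA_def)
    have "built (X \<union> ?P)"
    proof (rule step[where L = F1 and xs = "[a, w, b]"])
      show "complete (X \<union> ?P)" using complete_Un cX arm by blast
      show "image_arcs ((!) [a, w, b]) F1 = E \<inter> ?P \<times> ?P" unfolding list_copy arm by auto
      show "?P \<subseteq> V" using linked_V[OF arm(4) _ wV] by simp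
    qed (use arm(1-4) u(2) uw w(3) in \<open>auto simp: list_copy\<close>)
    then show ?thesis by blast
  next
    case (2 a d e)
    let ?P = "{w, a, d, e}"
    from 2 have arm: "distinct [w, a, d, e]" "S a = StA" "S d = StD" "S e = StD" "linked ?P" "complete ?P"
      "E \<inter> ?P \<times> ?P = {(w, a), (a, w), (w, d), (d, w), (d, e), (e, d)}" by (simp_all add: armAD_def)
    have "built (X \<union> ?P)"
    proof (rule step[where L = F2 and xs = "[a, w, d, e]"])
      show "complete (X \<union> ?P)" using complete_Un cX arm by blast
      show "image_arcs ((!) [a, w, d, e]) F2 = E \<inter> ?P \<times> ?P" unfolding list_copy arm by auto
      show "?P \<subseteq> V" using linked_V[OF arm(5) _ wV] by simp
    qed (use arm(1-5) u(2) uw w(3) in \<open>auto simp: list_copy\<close>)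
    then show ?thesis by blast
  next
    case (3 d e d' e')
    let ?P = "{w, d, e, d', e'}"
    from 3 have arm: "distinct [w, d, e, d', e']" "S d = StD" "S e = StD" "S d' = StD" "S e' = StD"
      "linked ?P" "complete ?P"
      "E \<inter> ?P \<times> ?P = {(w, d), (d, w), (d, e), (e, d), (w, d'), (d', w), (d', e'), (e', d')}"
      by (simp_all add: armDD_def)
    have "built (X \<union> ?P)"
    proof (rule step[where L = F3 and xs = "[e, d, w, d', e']"])
      show "complete (X \<union> ?P)" using complete_Un cX arm by blast
      show "image_arcs ((!) [e, d, w, d', e']) F3 = E \<inter> ?P \<times> ?P" unfolding list_copy arm by auto
      show "?P \<subseteq> V" using linked_V[OF arm(6) _ wV] by simp
    qed (use arm(1-6) u(2) uw w(3) in \<open>auto simp: list_copy\<close>)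
    then show ?thesis by blast
  qed
qed

text \<open>By completeness \<open>u\<close> and its mate, half of the arm at \<open>w\<close>, are
  already built. The other half together with \<open>w\<close> is a copy of \<open>F4\<close>;
  further neighbours of \<open>w\<close> are left to O1.\<close>

lemma built_DD:
  assumes X: "built X" and u: "u \<in> X" and w: "w \<notin> X" "(u, w) \<in> E" and arm: "armDD w u e d' e'"
  shows "\<exists>P. w \<in> P \<and> built (X \<union> P)"
proof -
  let ?P = "{w, d', e'}" and ?Y = "{w, u, e, d', e'}"
  from arm have a: "distinct [w, u, e, d', e']" "S w = StC" "S u = StD" "S e = StD" "S d' = StD" "S e' = StD"
    "complete ?Y" and EY: "E \<inter> ?Y \<times> ?Y = {(w, u), (u, w), (u, e), (e, u), (w, d'), (d', w), (d', e'), (e', d')}"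
    by (simp_all add: armDD_def)
  have arcs: "(w, d') \<in> E" "(d', e') \<in> E" "(u, e) \<in> E" using EY by blast+
  have "e \<in> companions u" using arcs a by (auto simp: companions_simps nbrs_iff)
  then have eX: "e \<in> X" using X u by (auto simp: built_def complete_def)
  have lP: "linked ?P"
    using linked_insert[OF linked_insert[OF linked_singleton[of w]], of w d' d' e'] arcs
    by (simp add: insert_commute)
  have EP: "E \<inter> ?P \<times> ?P = {(w, d'), (d', w), (d', e'), (e', d')}"
  proof -
    have "E \<inter> ?P \<times> ?P = (E \<inter> ?Y \<times> ?Y) \<inter> ?P \<times> ?P" by blast
    also have "\<dots> = {(w, d'), (d', w), (d', e'), (e', d')}" unfolding EY using a(1) by auto
    finally show ?thesis .
  qed
  have "built (X \<union> ?P)"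
  proof (rule built_attach[OF X u w(1) _ _ w(2), where L = F4 and xs = "[w, d', e']"])
    have "X \<union> ?P = X \<union> ?Y" using u eX by auto
    then show "complete (X \<union> ?P)" using complete_Un[OF _ a(7)] X by (simp add: built_def)
    show "image_arcs ((!) [w, d', e']) F4 = E \<inter> ?P \<times> ?P" unfolding list_copy EP by auto
    show "?P \<subseteq> V" using linked_V[OF lP, of w] w sub by auto
  qed (use a(1-6) lP in \<open>auto simp: list_copy\<close>)
  then show ?thesis by blast
qed

text \<open>The vertex \<open>u\<close> is one end of a path with statuses A, B, B, A, whose other
  three vertices are new.\<close>

lemma built_B:
  assumes X: "built X" and u: "u \<in> X" "S u = StA" and w: "w \<notin> X" "(u, w) \<in> E" "S w = StB"
  shows "\<exists>P. w \<in> P \<and> built (X \<union> P)"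
proof -
  have "u \<in> nbrs w" using w sym by (auto simp: nbrs_iff)
  with StB_nbrs[OF w(3)] u obtain b where b: "nbrs w = {b, u}" "S b = StB" by auto
  then have "w \<in> nbrs b" using nbrs_sym by blast
  with StB_nbrs[OF b(2)] w obtain a where a: "nbrs b = {w, a}" "S a = StA" by auto
  have arcs: "(w, b) \<in> E" "(b, w) \<in> E" "(b, a) \<in> E" "(a, b) \<in> E" "(w, u) \<in> E"
    using a b w sym by (auto simp: nbrs_def)
  have au: "a \<noteq> u" using no_triangle[of u w b] w(2) arcs by blast
  have wb: "w \<noteq> b" using arcs irrefl by auto
  have "a \<notin> nbrs w" using b a au by auto
  then have ne: "(w, a) \<notin> E" "(a, w) \<notin> E" using sym by (auto simp: nbrs_iff)
  let ?P = "{w, b, a}"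
  have lP: "linked ?P"
    using linked_insert[OF linked_insert[OF linked_singleton[of w]], of w b b a] arcs
    by (simp add: insert_commute)
  have EP: "E \<inter> ?P \<times> ?P = {(w, b), (b, w), (b, a), (a, b)}"
    using arcs ne irrefl by blast
  have d: "distinct [u, w, b, a]" using u w a b au wb by auto
  have "built (X \<union> ?P)"
  proof (rule built_identify[OF X u(1) w(1) _ _ w(2) lP, where L = H2 and xs = "[u, w, b, a]"])
    show "complete (X \<union> ?P)"
      using X u a b w by (auto simp: built_def complete_def companions_simps)
    show "image_arcs ((!) [u, w, b, a]) H2 = E \<inter> ?P \<times> ?P \<union> {(u, w), (w, u)}"
      unfolding list_copy EP by auto
    show "?P \<subseteq> V" using linked_V[OF lP, of w] w sub by auto
  qed (use u(2) w(3) a(2) b(2) d in \<open>auto simp: list_copy\<close>)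
  then show ?thesis by blast
qed

text \<open>\<open>Y1\<close> is the arm at \<open>w\<close> and reaches into the built set,
  \<open>R\<close> is its new part, and \<open>Y2\<close> is the arm at another vertex
  \<open>z\<close> of status C. With \<open>u\<close> and the edge from \<open>u\<close> to
  \<open>w\<close> added, \<open>R\<close> and \<open>Y2\<close> form the copy to be
  identified.\<close>

lemma two_arms:
  assumes X: "built X" and u: "u \<in> X" "u \<in> Y1" "u \<notin> R" and w: "w \<in> R"
    and Y1: "linked Y1" "complete Y1" "z \<notin> Y1" "Y1 \<subseteq> X \<union> R"
    and R: "linked R" "R \<subseteq> Y1" and z: "(w, z) \<in> E" and Y2: "linked Y2" "complete Y2" "z \<in> Y2" "w \<notin> Y2"
  shows "Y1 \<inter> Y2 = {}" "linked (R \<union> Y2)" "R \<union> Y2 \<subseteq> V" "w \<in> R \<union> Y2" "u \<notin> R \<union> Y2"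
    "complete (X \<union> (R \<union> Y2))"
    "E \<inter> (R \<union> Y2) \<times> (R \<union> Y2) = E \<inter> R \<times> R \<union> E \<inter> Y2 \<times> Y2 \<union> {(w, z), (z, w)}"
proof -
  have w1: "w \<in> Y1" using w R by auto
  show disj: "Y1 \<inter> Y2 = {}" using separation(1)[OF Y1(1) Y2(1) w1 Y2(3) z Y2(4) Y1(3)] .
  show l: "linked (R \<union> Y2)" using linked_join[OF R(1) Y2(1) w Y2(3) z] .
  show "R \<union> Y2 \<subseteq> V" using linked_V[OF l, of w] w z sub by auto
  show "w \<in> R \<union> Y2" using w by simp
  show "u \<notin> R \<union> Y2" using u disj by auto
  have "X \<union> (R \<union> Y2) = X \<union> Y1 \<union> Y2" using Y1(4) R(2) by auto
  then show "complete (X \<union> (R \<union> Y2))"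
    using complete_Un[OF complete_Un[OF _ Y1(2)] Y2(2)] X by (simp add: built_def)
  show "E \<inter> (R \<union> Y2) \<times> (R \<union> Y2) = E \<inter> R \<times> R \<union> E \<inter> Y2 \<times> Y2 \<union> {(w, z), (z, w)}"
    using separation(2)[OF R(1) Y2(1) w Y2(3) z Y2(4)] Y1(3) R(2) by blast
qed

text \<open>Treats \<open>u\<close> of status A and \<open>u\<close> of status D with its mate
  already built at once: in both cases the copy sees two leaves of status A at \<open>w\<close>.
  This is why O4 uses \<open>H3\<close>, \<open>H4\<close> and \<open>H6\<close>, the patterns that
  contain such an arm.\<close>

lemma built_rest_A:
  assumes X: "built X" and u: "u \<in> X" "u \<in> Y1" "u \<notin> {w, y}" "S u = StA \<or> S u = StD"
    and w: "w \<notin> X" "(u, w) \<in> E" "S w = StC" and y: "(w, y) \<in> E" "S y = StA"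
    and Y1: "linked Y1" "complete Y1" "z \<notin> Y1" "Y1 \<subseteq> X \<union> {w, y}" "{w, y} \<subseteq> Y1"
    and z: "(w, z) \<in> E" "S z = StC"
  shows "\<exists>P. w \<in> P \<and> built (X \<union> P)"
proof -
  let ?R = "{w, y}"
  have lR: "linked ?R" using linked_insert[OF linked_singleton[of w], of w y] y by (simp add: insert_commute)
  have ER: "E \<inter> ?R \<times> ?R = {(w, y), (y, w)}" using y sym irrefl by blast
  have wz: "w \<noteq> z" using z irrefl by auto
  have wR: "w \<in> ?R" by simp
  note arms = two_arms[OF X u(1-3) wR Y1(1-4) lR Y1(5) z(1)]
  from z(2) show ?thesis
  proof (cases rule: arms_cases)
    case (1 a b)
    let ?Y2 = "{z, a, b}"
    from 1 have arm: "distinct [z, a, b]" "S a = StA" "S b = StA" "linked ?Y2" "complete ?Y2"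
      and EY: "E \<inter> ?Y2 \<times> ?Y2 = {(z, a), (a, z), (z, b), (b, z)}" by (simp_all add: armAA_def)
    have "w \<notin> ?Y2" using wz w arm by auto
    note A = arms[OF arm(4,5) _ \<open>w \<notin> ?Y2\<close>]
    have d: "distinct [w, z, u, y, a, b]"
      using A(1)[OF insertI1] u(2,3) Y1(5) arm(1) y w by auto
    have "built (X \<union> (?R \<union> ?Y2))"
    proof (rule built_identify[OF X u(1) w(1) _ _ w(2), where L = H3 and xs = "[w, z, u, y, a, b]"])
      show "image_arcs ((!) [w, z, u, y, a, b]) H3 = E \<inter> (?R \<union> ?Y2) \<times> (?R \<union> ?Y2) \<union> {(u, w), (w, u)}"
        unfolding list_copy A(7)[OF insertI1] ER EY by (rule equalityI; simp)
      show "image_verts ((!) [w, z, u, y, a, b]) H3 = insert u (?R \<union> ?Y2)"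
        unfolding list_copy by (rule equalityI; simp)
      show "snd H3 = (!) (map (S(u := StA)) [w, z, u, y, a, b])"
        using d w(3) y(2) z(2) arm(2,3) by (auto simp: pattern_statuses)
    qed (use A(2-6)[OF insertI1] d u(4) in \<open>simp_all add: pverts_length\<close>)
    with A(4)[OF insertI1] show ?thesis by (intro exI[of _ "?R \<union> ?Y2"] conjI)
  next
    case (2 a d e)
    let ?Y2 = "{z, a, d, e}"
    from 2 have arm: "distinct [z, a, d, e]" "S a = StA" "S d = StD" "S e = StD" "linked ?Y2" "complete ?Y2"
      and EY: "E \<inter> ?Y2 \<times> ?Y2 = {(z, a), (a, z), (z, d), (d, z), (d, e), (e, d)}" by (simp_all add: armAD_def)
    have "w \<notin> ?Y2" using wz w arm by auto
    note A = arms[OF arm(5,6) _ this]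
    let ?xs = "[w, z, u, y, a, d, e]"
    have d: "distinct ?xs"
      using A(1)[OF insertI1] u(2,3) Y1(5) arm(1) y w by auto
    have "built (X \<union> (?R \<union> ?Y2))"
    proof (rule built_identify[OF X u(1) w(1) _ _ w(2), where L = H4 and xs = ?xs])
      show "image_arcs ((!) ?xs) H4 = E \<inter> (?R \<union> ?Y2) \<times> (?R \<union> ?Y2) \<union> {(u, w), (w, u)}"
        unfolding list_copy A(7)[OF insertI1] ER EY by (rule equalityI; simp)
      show "image_verts ((!) ?xs) H4 = insert u (?R \<union> ?Y2)"
        unfolding list_copy by (rule equalityI; simp)
      show "snd H4 = (!) (map (S(u := StA)) ?xs)"
        using d w(3) y(2) z(2) arm(2-4) by (auto simp: pattern_statuses)
    qed (use A(2-6)[OF insertI1] d u(4) in \<open>simp_all add: pverts_length\<close>)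
    with A(4)[OF insertI1] show ?thesis by (intro exI[of _ "?R \<union> ?Y2"] conjI)
  next
    case (3 d e d' e')
    let ?Y2 = "{z, d, e, d', e'}"
    from 3 have arm: "distinct [z, d, e, d', e']" "S d = StD" "S e = StD" "S d' = StD" "S e' = StD"
        "linked ?Y2" "complete ?Y2"
      and EY: "E \<inter> ?Y2 \<times> ?Y2 = {(z, d), (d, z), (d, e), (e, d), (z, d'), (d', z), (d', e'), (e', d')}"
      by (simp_all add: armDD_def)
    have "w \<notin> ?Y2" using wz w arm by auto
    note A = arms[OF arm(6,7) _ this]
    let ?xs = "[w, z, u, y, d, e, d', e']"
    have d: "distinct ?xs"
      using A(1)[OF insertI1] u(2,3) Y1(5) arm(1) y w by auto
    have "built (X \<union> (?R \<union> ?Y2))"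
    proof (rule built_identify[OF X u(1) w(1) _ _ w(2), where L = H6 and xs = ?xs])
      show "image_arcs ((!) ?xs) H6 = E \<inter> (?R \<union> ?Y2) \<times> (?R \<union> ?Y2) \<union> {(u, w), (w, u)}"
        unfolding list_copy A(7)[OF insertI1] ER EY by (rule equalityI; simp)
      show "image_verts ((!) ?xs) H6 = insert u (?R \<union> ?Y2)"
        unfolding list_copy by (rule equalityI; simp)
      show "snd H6 = (!) (map (S(u := StA)) ?xs)"
        using d w(3) y(2) z(2) arm(2-5) by (auto simp: pattern_statuses)
    qed (use A(2-6)[OF insertI1] d u(4) in \<open>simp_all add: pverts_length\<close>)
    with A(4)[OF insertI1] show ?thesis by (intro exI[of _ "?R \<union> ?Y2"] conjI)
  qed
qed

lemma built_rest_D: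
  assumes X: "built X" and u: "u \<in> X" "S u = StA" and w: "w \<notin> X" "(u, w) \<in> E" and Y1: "armAD w u y y'"
    and z: "(w, z) \<in> E" "S z = StC"
  shows "\<exists>P. w \<in> P \<and> built (X \<union> P)"
proof -
  let ?R = "{w, y, y'}" and ?Y1 = "{w, u, y, y'}"
  from Y1 have dY: "distinct [w, u, y, y']" and SY: "S w = StC" "S y = StD" "S y' = StD"
    and Y1': "linked ?Y1" "complete ?Y1"
    and EY1: "E \<inter> ?Y1 \<times> ?Y1 = {(w, u), (u, w), (w, y), (y, w), (y, y'), (y', y)}"
    by (simp_all add: armAD_def)
  have arcs: "(w, y) \<in> E" "(y, y') \<in> E" using EY1 by blast+
  have lR: "linked ?R"
    using linked_insert[OF linked_insert[OF linked_singleton[of w]], of w y y y'] arcs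
    by (simp add: insert_commute)
  have ER: "E \<inter> ?R \<times> ?R = {(w, y), (y, w), (y, y'), (y', y)}"
  proof -
    have "E \<inter> ?R \<times> ?R = (E \<inter> ?Y1 \<times> ?Y1) \<inter> ?R \<times> ?R" by blast
    also have "\<dots> = {(w, y), (y, w), (y, y'), (y', y)}" unfolding EY1 using dY by auto
    finally show ?thesis .
  qed
  have wz: "w \<noteq> z" using z irrefl by auto
  have zY: "z \<notin> ?Y1" using wz z(2) u(2) SY by auto
  have side: "u \<in> ?Y1" "u \<notin> ?R" "w \<in> ?R" "?Y1 \<subseteq> X \<union> ?R" "?R \<subseteq> ?Y1" using u dY by auto
  note arms = two_arms[OF X u(1) side(1-3) Y1' zY side(4) lR side(5) z(1)]
  from z(2) show ?thesis
  proof (cases rule: arms_cases)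
    case (1 a b)
    let ?Y2 = "{z, a, b}"
    from 1 have arm: "distinct [z, a, b]" "S a = StA" "S b = StA" "linked ?Y2" "complete ?Y2"
      and EY: "E \<inter> ?Y2 \<times> ?Y2 = {(z, a), (a, z), (z, b), (b, z)}" by (simp_all add: armAA_def)
    have "w \<notin> ?Y2" using wz SY arm by auto
    note A = arms[OF arm(4,5) _ this]
    \<comment> \<open>In \<open>H4\<close> the vertex 0 carries the two leaves of status A, so
      \<open>z\<close> precedes \<open>w\<close> here.\<close>
    let ?xs = "[z, w, a, b, u, y, y']"
    have d: "distinct ?xs" using A(1)[OF insertI1] dY arm(1) by auto
    have "built (X \<union> (?R \<union> ?Y2))"
    proof (rule built_identify[OF X u(1) w(1) _ _ w(2), where L = H4 and xs = ?xs])
      show "image_arcs ((!) ?xs) H4 = E \<inter> (?R \<union> ?Y2) \<times> (?R \<union> ?Y2) \<union> {(u, w), (w, u)}"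
        unfolding list_copy A(7)[OF insertI1] ER EY by (rule equalityI; simp)
      show "image_verts ((!) ?xs) H4 = insert u (?R \<union> ?Y2)"
        unfolding list_copy by (rule equalityI; simp)
      show "snd H4 = (!) (map (S(u := StA)) ?xs)"
        using d SY z(2) arm(2,3) by (auto simp: pattern_statuses)
    qed (use A(2-6)[OF insertI1] d u(2) in \<open>simp_all add: pverts_length\<close>)
    with A(4)[OF insertI1] show ?thesis by (intro exI[of _ "?R \<union> ?Y2"] conjI)
  next
    case (2 a d e)
    let ?Y2 = "{z, a, d, e}"
    from 2 have arm: "distinct [z, a, d, e]" "S a = StA" "S d = StD" "S e = StD" "linked ?Y2" "complete ?Y2"
      and EY: "E \<inter> ?Y2 \<times> ?Y2 = {(z, a), (a, z), (z, d), (d, z), (d, e), (e, d)}" by (simp_all add: armAD_def)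
    have "w \<notin> ?Y2" using wz SY arm by auto
    note A = arms[OF arm(5,6) _ this]
    let ?xs = "[w, z, u, y, y', a, d, e]"
    have d: "distinct ?xs" using A(1)[OF insertI1] dY arm(1) by auto
    have "built (X \<union> (?R \<union> ?Y2))"
    proof (rule built_identify[OF X u(1) w(1) _ _ w(2), where L = H5 and xs = ?xs])
      show "image_arcs ((!) ?xs) H5 = E \<inter> (?R \<union> ?Y2) \<times> (?R \<union> ?Y2) \<union> {(u, w), (w, u)}"
        unfolding list_copy A(7)[OF insertI1] ER EY by (rule equalityI; simp)
      show "image_verts ((!) ?xs) H5 = insert u (?R \<union> ?Y2)"
        unfolding list_copy by (rule equalityI; simp)
      show "snd H5 = (!) (map (S(u := StA)) ?xs)"
        using d SY z(2) arm(2-4) by (auto simp: pattern_statuses)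
    qed (use A(2-6)[OF insertI1] d u(2) in \<open>simp_all add: pverts_length\<close>)
    with A(4)[OF insertI1] show ?thesis by (intro exI[of _ "?R \<union> ?Y2"] conjI)
  next
    case (3 d e d' e')
    let ?Y2 = "{z, d, e, d', e'}"
    from 3 have arm: "distinct [z, d, e, d', e']" "S d = StD" "S e = StD" "S d' = StD" "S e' = StD"
        "linked ?Y2" "complete ?Y2"
      and EY: "E \<inter> ?Y2 \<times> ?Y2 = {(z, d), (d, z), (d, e), (e, d), (z, d'), (d', z), (d', e'), (e', d')}"
      by (simp_all add: armDD_def)
    have "w \<notin> ?Y2" using wz SY arm by auto
    note A = arms[OF arm(6,7) _ this]
    let ?xs = "[w, z, u, y, y', d, e, d', e']"
    have d: "distinct ?xs" using A(1)[OF insertI1] dY arm(1) by auto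
    have "built (X \<union> (?R \<union> ?Y2))"
    proof (rule built_identify[OF X u(1) w(1) _ _ w(2), where L = H7 and xs = ?xs])
      show "image_arcs ((!) ?xs) H7 = E \<inter> (?R \<union> ?Y2) \<times> (?R \<union> ?Y2) \<union> {(u, w), (w, u)}"
        unfolding list_copy A(7)[OF insertI1] ER EY by (rule equalityI; simp)
      show "image_verts ((!) ?xs) H7 = insert u (?R \<union> ?Y2)"
        unfolding list_copy by (rule equalityI; simp)
      show "snd H7 = (!) (map (S(u := StA)) ?xs)"
        using d SY z(2) arm(2-5) by (auto simp: pattern_statuses)
    qed (use A(2-6)[OF insertI1] d u(2) in \<open>simp_all add: pverts_length\<close>)
    with A(4)[OF insertI1] show ?thesis by (intro exI[of _ "?R \<union> ?Y2"] conjI)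
  qed
qed

lemma companions_StC:
  assumes "S w = StC" "u \<in> companions w"
  obtains y where "companions w = {u, y}" "u \<noteq> y" "S y \<in> {StA, StD}"
    "S u = StA \<or> S y = StA \<Longrightarrow> \<exists>z. (w, z) \<in> E \<and> S z = StC"
proof -
  from StC_nbrs[OF assms(1)] obtain p q where pq: "p \<noteq> q" "companions w = {p, q}" "S p \<in> {StA, StD}"
      "S q \<in> {StA, StD}" and z: "S p = StA \<or> S q = StA \<Longrightarrow> \<exists>z\<in>nbrs w. S z = StC"
    using assms(1) by (auto simp: companions_simps)
  have z': "S p = StA \<or> S q = StA \<Longrightarrow> \<exists>z. (w, z) \<in> E \<and> S z = StC"
    using z unfolding nbrs_iff Bex_def .
  from pq(2) consider "u = p" | "u = q" using assms(2) by auto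
  then show ?thesis
  proof cases
    case 1
    show ?thesis by (rule that[of q]) (use pq z' 1 in simp_all)
  next
    case 2
    show ?thesis by (rule that[of p]) (use pq z' 2 in \<open>simp_all add: insert_commute disj_commute\<close>)
  qed
qed

lemma built_step:
  assumes X: "built X" and "X \<noteq> V"
  shows "\<exists>X'. built X' \<and> X \<subset> X'"
proof -
  from X have XV: "X \<subseteq> V" "X \<noteq> {}" and cX: "complete X" by (auto simp: built_def)
  obtain x y where xy: "x \<in> X" "y \<in> V" "y \<notin> X" using XV \<open>X \<noteq> V\<close> by blast
  have "\<exists>u\<in>X. \<exists>w. w \<notin> X \<and> (u, w) \<in> E"
  proof (rule ccontr)
    assume no: "\<not> ?thesis"
    have "(x, y) \<in> E\<^sup>*" using conn xy XV by blast
    then have "y \<in> X" by induction (use no xy in auto)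
    with xy show False by simp
  qed
  then obtain u w where u: "u \<in> X" and w: "w \<notin> X" "(u, w) \<in> E" by blast
  have wu: "(w, u) \<in> E" using w sym by blast
  have nc: "w \<notin> companions u" using cX u w by (auto simp: complete_def)
  have comp: "u \<in> companions w" if "S w = StC" "S u \<noteq> StC"
    using that wu by (auto simp: companions_simps nbrs_iff)
  have "\<exists>P. w \<in> P \<and> built (X \<union> P)"
  proof (cases "S u")
    case StA
    then have "S w = StB \<or> S w = StC" using StA_nbrs[of u w] w by (auto simp: nbrs_iff)
    then show ?thesis
    proof
      assume "S w = StB"
      then show ?thesis using built_B[OF X u StA w] by simp
    next
      assume C: "S w = StC"
      obtain y where y: "companions w = {u, y}" "u \<noteq> y" "S y \<in> {StA, StD}"
        and "\<exists>z. (w, z) \<in> E \<and> S z = StC"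
        using companions_StC[OF C comp] C StA by (metis status.distinct(3))
      then obtain z where z: "(w, z) \<in> E" "S z = StC" by blast
      from y(3) consider "S y = StA" | "S y = StD" by auto
      then show ?thesis
      proof cases
        case 1
        have "armAA w u y" using armAAI[OF C y(1,2) StA 1] .
        then have a: "distinct [w, u, y]" "linked {w, u, y}" "complete {w, u, y}"
          by (simp_all add: armAA_def)
        have "w \<noteq> z" using z irrefl by auto
        then have "z \<notin> {w, u, y}" using z StA 1 by auto
        moreover have "(w, y) \<in> E" using y companions_arc[of y w] by auto
        ultimately show ?thesis
          using built_rest_A[OF X u, of "{w, u, y}" w y z] w C StA 1 a z u by auto
      next
        case 2
        obtain y' where "armAD w u y y'" using armADI[OF C y(1) StA 2] .
        then show ?thesis using built_rest_D[OF X u StA w] z by blast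
      qed
    qed
  next
    case StB
    then show ?thesis using nc w by (auto simp: companions_simps nbrs_iff)
  next
    case StC
    then have "S w = StC" using nc w by (auto simp: companions_simps nbrs_iff)
    then show ?thesis using built_C[OF X u StC w] by simp
  next
    case StD
    then have "S w \<noteq> StD" using nc w by (auto simp: companions_simps nbrs_iff)
    moreover have "w \<in> nbrs u" using w by (simp add: nbrs_iff)
    ultimately have C: "S w = StC" using StD_nbrs[OF StD] by metis
    have "u \<in> companions w" using comp C StD by simp
    then obtain y where y: "companions w = {u, y}" "u \<noteq> y" "S y \<in> {StA, StD}"
      and zz: "S u = StA \<or> S y = StA \<Longrightarrow> \<exists>z. (w, z) \<in> E \<and> S z = StC"
      using companions_StC[OF C] by metis
    from y(3) consider "S y = StA" | "S y = StD" by auto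
    then show ?thesis
    proof cases
      case 1
      then obtain z where z: "(w, z) \<in> E" "S z = StC" using zz by auto
      have "companions w = {y, u}" using y by auto
      then obtain e where "armAD w y u e" using armADI[OF C _ 1 StD] by blast
      then have a: "distinct [w, y, u, e]" "linked {w, y, u, e}" "complete {w, y, u, e}" "S e = StD"
        and E: "E \<inter> {w, y, u, e} \<times> {w, y, u, e} = {(w, y), (y, w), (w, u), (u, w), (u, e), (e, u)}"
        by (simp_all add: armAD_def)
      have "(u, e) \<in> E" "(w, y) \<in> E" using E by blast+
      then have "e \<in> companions u" using a(4) StD by (auto simp: companions_simps nbrs_iff)
      \<comment> \<open>The mate of \<open>u\<close> is its companion and already built, so the new
        part of this arm is just \<open>w\<close> and \<open>y\<close>.\<close>
      then have "e \<in> X" using cX u by (auto simp: complete_def)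
      have "w \<noteq> z" using z irrefl by auto
      then have zY: "z \<notin> {w, y, u, e}" using z StD 1 a(4) by auto
      show ?thesis
        by (rule built_rest_A[OF X u _ _ _ w C \<open>(w, y) \<in> E\<close> 1 a(2,3) zY _ _ z])
          (use a(1) StD u \<open>e \<in> X\<close> in auto)
    next
      case 2
      then obtain e e' where "armDD w u e y e'" using armDDI[OF C y(1,2) StD] by blast
      then show ?thesis using built_DD[OF X u w] by blast
    qed
  qed
  then obtain P where "w \<in> P" "built (X \<union> P)" by blast
  then show ?thesis using w by blast
qed

section \<open>A first built set, and exhaustion of the tree\<close>

lemma built_start:
  assumes "card V \<ge> 2"
  shows "\<exists>X. built X"
proof -
  consider v where "v \<in> V" "S v = StB" | v where "v \<in> V" "S v = StD"
    | v where "v \<in> V" "S v = StC" "\<forall>x\<in>V. S x \<noteq> StD" | "\<forall>v\<in>V. S v = StA"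
    by (metis status.exhaust)
  then show ?thesis
  proof cases
    case (1 w)
    from StB_nbrs[OF 1(2)] obtain b u where b: "nbrs w = {b, u}" "S b = StB" "S u = StA" by auto
    then have "w \<in> nbrs b" using nbrs_sym by blast
    with StB_nbrs[OF b(2)] 1 obtain a where a: "nbrs b = {w, a}" "S a = StA" by auto
    have arcs: "(w, b) \<in> E" "(b, w) \<in> E" "(b, a) \<in> E" "(a, b) \<in> E" "(w, u) \<in> E" "(u, w) \<in> E"
      using a b sym by (auto simp: nbrs_def)
    have au: "a \<noteq> u" using no_triangle[of u w b] arcs by blast
    have wb: "w \<noteq> b" using arcs irrefl by auto
    have "a \<notin> nbrs w" "u \<notin> nbrs b" using b a au 1 by auto
    then have ne: "(w, a) \<notin> E" "(a, w) \<notin> E" "(u, b) \<notin> E" "(b, u) \<notin> E" "(u, a) \<notin> E" "(a, u) \<notin> E"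
      using sym not_adjacent_A[of u a] a b by (auto simp: nbrs_iff)
    let ?X = "{u, w, b, a}"
    have l: "linked ?X"
      using linked_insert[OF linked_insert[OF linked_insert[OF linked_singleton[of u]]], of u w w b b a] arcs
      by (simp add: insert_commute)
    have EX: "E \<inter> ?X \<times> ?X = {(u, w), (w, u), (w, b), (b, w), (b, a), (a, b)}"
      using arcs ne irrefl by blast
    have "built ?X"
    proof (rule built_base[where L = H2 and xs = "[u, w, b, a]"])
      show "?X \<subseteq> V" using linked_V[OF l, of w] 1 by simp
      show "complete ?X" using a b 1 by (auto simp: complete_def companions_simps)
      show "image_arcs ((!) [u, w, b, a]) H2 = E \<inter> ?X \<times> ?X" unfolding list_copy EX ..
      show "distinct [u, w, b, a]" using a b 1 au wb by auto
    qed (use l a(2) b(2,3) 1(2) in \<open>simp_all add: list_copy\<close>)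
    then show ?thesis ..
  next
    case (2 d)
    obtain e where e: "S e = StD" "(d, e) \<in> E" "companions d = {e}" "companions e = {d}" "d \<noteq> e"
      using mate[OF 2(2)] .
    let ?X = "{d, e}"
    have l: "linked ?X" using linked_insert[OF linked_singleton[of d], of d e] e by (simp add: insert_commute)
    have EX: "E \<inter> ?X \<times> ?X = {(d, e), (e, d)}" using e(2) sym irrefl by blast
    have "built ?X"
    proof (rule built_base[where L = H1 and xs = "[d, e]"])
      show "?X \<subseteq> V" using linked_V[OF l, of d] 2 by simp
      show "complete ?X" using e by (simp add: complete_def)
      show "image_arcs ((!) [d, e]) H1 = E \<inter> ?X \<times> ?X" unfolding list_copy EX ..
    qed (use l e(1,5) 2 in \<open>simp_all add: list_copy\<close>)
    then show ?thesis ..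
  next
    case (3 w)
    \<comment> \<open>Without status D both companions of a vertex of status C have status A, and
      such a vertex has a neighbour of status C. Two adjacent arms then form a copy of
      \<open>H3\<close>.\<close>
    have AA: "\<exists>a b. armAA x a b" if "S x = StC" for x
      using that
    proof (cases rule: arms_cases)
      case (2 a d e)
      then have "(x, d) \<in> E" "S d = StD" unfolding armAD_def by blast+
      then show ?thesis using 3 sub by blast
    next
      case (3 d e d' e')
      then have "(x, d) \<in> E" "S d = StD" unfolding armDD_def by blast+
      then show ?thesis using \<open>\<forall>x\<in>V. S x \<noteq> StD\<close> sub by blast
    qed blast
    from AA[OF 3(2)] obtain a b where "armAA w a b" by blast
    then have 1: "distinct [w, a, b]" "S a = StA" "S b = StA" "linked {w, a, b}" "complete {w, a, b}"
      and E1: "E \<inter> {w, a, b} \<times> {w, a, b} = {(w, a), (a, w), (w, b), (b, w)}"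
      by (simp_all add: armAA_def)
    have "(w, a) \<in> E" using E1 by blast
    then have "a \<in> companions w" using 3 1(2) by (auto simp: companions_simps nbrs_iff)
    then obtain z where z: "(w, z) \<in> E" "S z = StC" using companions_StC[OF 3(2), of a] 1(2) by blast
    from AA[OF z(2)] obtain a' b' where "armAA z a' b'" by blast
    then have 2: "distinct [z, a', b']" "S a' = StA" "S b' = StA" "linked {z, a', b'}" "complete {z, a', b'}"
      and E2: "E \<inter> {z, a', b'} \<times> {z, a', b'} = {(z, a'), (a', z), (z, b'), (b', z)}"
      by (simp_all add: armAA_def)
    have wz: "w \<noteq> z" using z irrefl by auto
    let ?X = "{w, a, b} \<union> {z, a', b'}"
    have nin: "w \<notin> {z, a', b'}" "z \<notin> {w, a, b}" using wz 3 z 1 2 by auto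
    note sep = separation[OF 1(4) 2(4) insertI1 insertI1 z(1) nin]
    have l: "linked ?X" using linked_join[OF 1(4) 2(4) insertI1 insertI1 z(1)] .
    let ?xs = "[w, z, a, b, a', b']"
    have "built ?X"
    proof (rule built_base[where L = H3 and xs = ?xs])
      show "?X \<subseteq> V" using linked_V[OF l, of w] 3 by simp
      show "complete ?X" using complete_Un 1(5) 2(5) by blast
      show "image_arcs ((!) ?xs) H3 = E \<inter> ?X \<times> ?X"
        unfolding list_copy sep(2) E1 E2 by (rule equalityI; simp)
      show "image_verts ((!) ?xs) H3 = ?X" unfolding list_copy by (rule equalityI; simp)
      show "distinct ?xs" using sep(1) 1(1) 2(1) by auto
    qed (use l 3(2) z(2) 1(2,3) 2(2,3) in \<open>simp_all add: pverts_length pattern_statuses\<close>)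
    then show ?thesis ..
  next
    case 4
    \<comment> \<open>Impossible: with two vertices and connectedness there is an edge, but two
      vertices of status A are never adjacent.\<close>
    have "V \<noteq> {}" using assms by auto
    then obtain v where v: "v \<in> V" by blast
    have "V \<noteq> {v}" using assms by auto
    then obtain y where y: "y \<in> V" "y \<noteq> v" using v by blast
    from conn[OF v y(1)] y(2) obtain w where "(v, w) \<in> E" by (metis converse_rtranclE)
    moreover from this have "w \<in> V" using sub by auto
    ultimately show ?thesis using StA_nbrs[of v w] 4 v by (auto simp: nbrs_iff)
  qed
qed

lemma in_tree_family:
  assumes "card V \<ge> 2"
  shows "(\<lparr>pverts = V, parcs = E\<rparr>, S) \<in> tree_family"
proof -
  have "finite {X. built X}"
    using fin by (rule finite_subset[rotated, OF finite_Pow_iff[THEN iffD2]]) (auto simp: built_def)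
  moreover have "{X. built X} \<noteq> {}" using built_start[OF assms] by auto
  ultimately obtain X where X: "built X" "\<And>Y. built Y \<Longrightarrow> X \<subseteq> Y \<Longrightarrow> X = Y"
    using finite_has_maximal[of "{X. built X}"] by auto
  then have "X = V" using built_step[of X] by blast
  moreover have "E \<inter> V \<times> V = E" using sub by auto
  ultimately show ?thesis using X(1) by (simp add: built_def)
qed

end

sublocale excellent_tree \<subseteq> structured_tree V E lab
proof
  show "lab w \<in> {StB, StC}" if "lab v = StA" "w \<in> nbrs v" for v w
    using lab_StA that .
  show "\<exists>b a. nbrs v = {b, a} \<and> lab b = StB \<and> lab a = StA" if "lab v = StB" for v
    using lab_StB_pair[OF that] by metis
  show "\<exists>p q. p \<noteq> q \<and> {w \<in> nbrs v. lab w \<noteq> StC} = {p, q} \<and> lab p \<in> {StA, StD} \<and> lab q \<in> {StA, StD} \<and>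
      (lab p = StA \<or> lab q = StA \<longrightarrow> (\<exists>z\<in>nbrs v. lab z = StC))" if "lab v = StC" for v
  proof (rule lab_StC[OF that])
    fix p q assume "p \<noteq> q" "{w \<in> nbrs v. lab w \<noteq> StC} = {p, q}" "lab p \<in> {StA, StD}" "lab q \<in> {StA, StD}"
      "lab p = StA \<or> lab q = StA \<Longrightarrow> \<exists>z\<in>nbrs v. lab z = StC"
    then show ?thesis by (intro exI[of _ p] exI[of _ q] conjI impI)
  qed
  show "\<exists>d\<in>nbrs v. lab d = StD \<and> (\<forall>w\<in>nbrs v. w \<noteq> d \<longrightarrow> lab w = StC)" if "lab v = StD" for v
    using lab_StD[OF that] by metis
qed

text \<open>If the ends of an edge stay connected after its deletion, the edge closes a path to a
  cycle of length at least 3.\<close>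

lemma undirected_tree_utree:
  assumes T: "undirected_tree T"
  shows "utree (pverts T) (parcs T)"
proof -
  from T interpret pair_graph T by (simp add: undirected_tree_def)
  from T have con: "connected (with_proj T)" and acyc: "\<And>p. cycle p \<Longrightarrow> length p < 3"
    by (auto simp: undirected_tree_def not_le[symmetric])
  show ?thesis
  proof
    show "finite (pverts T)" by (rule pair_finite_verts)
    show "parcs T \<subseteq> pverts T \<times> pverts T" using in_arcsD1 in_arcsD2 by auto
    show "(v, u) \<in> parcs T" if "(u, v) \<in> parcs T" for u v using that by (rule arcs_symmetric)
    show "(u, v) \<in> (parcs T)\<^sup>*" if "u \<in> pverts T" "v \<in> pverts T" for u v
    proof -
      have "u \<rightarrow>\<^sup>*\<^bsub>mk_symmetric (with_proj T)\<^esub> v"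
        using con that by (auto simp: connected_def strongly_connected_def)
      then have "u \<rightarrow>\<^sup>*\<^bsub>with_proj T\<^esub> v"
        using reachable_mk_symmetric_eq sym_arcs by simp
      then show ?thesis by (simp add: reachable_conv)
    qed
    show "(u, w) \<notin> (parcs T - {(u, w), (w, u)})\<^sup>*" if uw: "(u, w) \<in> parcs T" for u w
    proof
      assume r: "(u, w) \<in> (parcs T - {(u, w), (w, u)})\<^sup>*"
      define H where "H = \<lparr>pverts = pverts T, parcs = parcs T - {(u, w), (w, u)}\<rparr>"
      interpret H: pair_wf_digraph H
        by unfold_locales (auto simp: H_def dest: in_arcsD1 in_arcsD2)
      have "u \<rightarrow>\<^sup>*\<^bsub>with_proj H\<^esub> w"
        using r in_arcsD1[OF uw] in_arcsD2[OF uw] by (simp add: H.reachable_conv) (simp add: H_def)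
      then obtain p where p: "H.apath u p w" using H.reachable_apath by blast
      then have walk: "pcas u p w" and pH: "set p \<subseteq> parcs H" and dis: "distinct (pawalk_verts u p)"
        by (auto simp: H.apath_def H.awalk_def)
      have neq: "u \<noteq> w" using no_loops'[OF uw] .
      have "cycle ((w, u) # p)"
        unfolding cycle_def
      proof (intro exI conjI)
        show "awalk w ((w, u) # p) w"
          using walk pH in_arcsD2[OF uw] arcs_symmetric[OF uw] by (auto simp: awalk_def H_def)
        show "distinct (tl (pawalk_verts w ((w, u) # p)))" using dis by simp
      qed simp
      \<comment> \<open>A path of a single arc would be the deleted arc itself; this rules out the
        back-and-forth walk, which is a cycle of length 2 for the digraph notion.\<close>
      moreover have "length p \<ge> 2"
      proof (cases p)
        case Nil
        then show ?thesis using walk neq by simp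
      next
        case (Cons e q)
        have "q \<noteq> []"
        proof
          assume "q = []"
          then have "e = (u, w)" using walk Cons by (cases e) simp
          then show False using pH Cons by (auto simp: H_def)
        qed
        then show ?thesis using Cons by (cases q) auto
      qed
      ultimately show False using acyc by fastforce
    qed
  qed
qed

section \<open>Value classes and the characterization of the statuses\<close>

lemma roman_dominating_rdf:
  assumes "parcs T \<subseteq> pverts T \<times> pverts T"
  shows "roman_dominating T f \<longleftrightarrow> rdf (parcs T) (pverts T) {} f"
proof -
  have "f v \<le> 2 \<longleftrightarrow> f v \<in> {0, 1, 2}" for v by auto
  moreover have "(\<exists>u\<in>neighborhood T v. f u = 2) \<longleftrightarrow> (\<exists>u\<in>pverts T. (v, u) \<in> parcs T \<and> f u = 2)" for v
    using assms by (auto simp: neighborhood_def)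
  ultimately show ?thesis
    unfolding roman_dominating_def rdf_def image_subset_iff by auto
qed

lemma roman_function_rdf:
  assumes "parcs T \<subseteq> pverts T \<times> pverts T"
  shows "roman_function T f \<longleftrightarrow>
    rdf (parcs T) (pverts T) {} f \<and> sum f (pverts T) = rdf_number (parcs T) (pverts T) {}"
  using roman_dominating_rdf[OF assms]
  by (simp add: roman_function_def weight_def roman_number_def rdf_number_def)

lemma good_values:
  assumes good: "good (parcs T) (pverts T) S g" and v: "v \<in> pverts T"
  shows "{f v |f. roman_function T f} = status_values (S v)"
proof -
  from good have sub: "parcs T \<subseteq> pverts T \<times> pverts T"
    and t: "tight (parcs T) (pverts T) S g" and a: "attains (parcs T) (pverts T) {} S g"
    by (auto simp: good_def)
  have low: "g \<le> sum f (pverts T)" "sum f (pverts T) = g \<Longrightarrow> f v \<in> status_values (S v)"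
    if "rdf (parcs T) (pverts T) {} f" for f
    using t rdf_mono[OF that, of "{v. S v = StC}"] v by (auto simp: tight_def)
  obtain i where "i \<in> status_values (S v)" by (cases "S v") auto
  then obtain f where f: "rdf (parcs T) (pverts T) {} f" "sum f (pverts T) = g"
    using a v by (auto simp: attains_def)
  obtain f' where f': "rdf (parcs T) (pverts T) {} f'" "sum f' (pverts T) = rdf_number (parcs T) (pverts T) {}"
    using rdf_number_attained by metis
  have num: "rdf_number (parcs T) (pverts T) {} = g"
    using rdf_number_le[OF f(1)] f(2) low(1)[OF f'(1)] f'(2) by simp
  show ?thesis
  proof (intro equalityI subsetI)
    fix i assume "i \<in> {f v |f. roman_function T f}"
    then show "i \<in> status_values (S v)"
      using low(2) by (auto simp: roman_function_rdf[OF sub] num)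
  next
    fix i assume "i \<in> status_values (S v)"
    then show "i \<in> {f v |f. roman_function T f}"
      using a v by (fastforce simp: attains_def roman_function_rdf[OF sub] num)
  qed
qed

lemma certified_value_class:
  assumes "certified (T, S)"
  shows "value_class {0, 1} T = {v \<in> pverts T. S v = StA}"
    "value_class {0, 2} T = {v \<in> pverts T. S v = StB \<or> S v = StC}"
    "value_class {0, 1, 2} T = {v \<in> pverts T. S v = StD}"
proof -
  from assms obtain g where "good (parcs T) (pverts T) S g" by (auto simp: certified_def)
  note vals = good_values[OF this]
  have *: "value_class X T = {v \<in> pverts T. status_values (S v) = X}" for X
    unfolding value_class_def by (intro Collect_cong conj_cong refl) (simp only: vals)
  have 1: "1 \<in> status_values s \<longleftrightarrow> s = StA \<or> s = StD" and 2: "2 \<in> status_values s \<longleftrightarrow> s \<noteq> StA" for s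
    by (cases s; simp)+
  have sv: "status_values s = {0, 1} \<longleftrightarrow> s = StA" "status_values s = {0, 2} \<longleftrightarrow> s = StB \<or> s = StC"
    "status_values s = {0, 1, 2} \<longleftrightarrow> s = StD" for s
  proof -
    show "status_values s = {0, 1} \<longleftrightarrow> s = StA"
    proof
      assume "status_values s = {0, 1}"
      then have "2 \<notin> status_values s" by simp
      then show "s = StA" using 2 by blast
    qed simp
    show "status_values s = {0, 2} \<longleftrightarrow> s = StB \<or> s = StC"
    proof
      assume "status_values s = {0, 2}"
      then have "1 \<notin> status_values s" by simp
      then have "s \<noteq> StA" "s \<noteq> StD" using 1 by blast+
      then show "s = StB \<or> s = StC" by (cases s) simp_all
    qed auto
    show "status_values s = {0, 1, 2} \<longleftrightarrow> s = StD"
    proof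
      assume "status_values s = {0, 1, 2}"
      then have "1 \<in> status_values s" "2 \<in> status_values s" by simp_all
      then show "s = StD" using 1 2 by blast
    qed simp
  qed
  show "value_class {0, 1} T = {v \<in> pverts T. S v = StA}"
    "value_class {0, 2} T = {v \<in> pverts T. S v = StB \<or> S v = StC}"
    "value_class {0, 1, 2} T = {v \<in> pverts T. S v = StD}"
    unfolding * sv by simp_all
qed

lemma certified_excellent:
  assumes "certified (T, S)"
  shows "roman_excellent T"
  unfolding roman_excellent_def
proof
  fix v assume v: "v \<in> pverts T"
  from assms obtain g where "good (parcs T) (pverts T) S g" by (auto simp: certified_def)
  note vals = good_values[OF this v]
  obtain i where "i \<in> status_values (S v)" "i \<noteq> 0" by (cases "S v") auto
  then show "\<exists>f. roman_function T f \<and> f v \<noteq> 0" unfolding vals[symmetric] by auto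
qed

lemma degree_eq: "degree T v = card (neighborhood T v)"
proof -
  have "out_arcs (with_proj T) v = Pair v ` neighborhood T v"
    by (auto simp: out_arcs_def neighborhood_def)
  then show ?thesis
    by (simp add: degree_def out_degree_def card_image inj_on_def)
qed

text \<open>A vertex of status C has two neighbours of status A or D; with degree 2 these are all,
  and none of them lies in the class of values 0 and 2. For status B exactly the partner
  does.\<close>

lemma certified_StB:
  assumes cert: "certified (T, S)" and v: "v \<in> pverts T"
  shows "S v = StB \<longleftrightarrow> (S v = StB \<or> S v = StC) \<and> degree T v = 2 \<and>
    card (neighborhood T v \<inter> {w \<in> pverts T. S w = StB \<or> S w = StC}) = 1"
proof -
  from cert obtain g where "good (parcs T) (pverts T) S g" and sh: "local_shape (parcs T) (pverts T) S"
    by (auto simp: certified_def)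
  then have fin: "finite (pverts T)" and sub: "parcs T \<subseteq> pverts T \<times> pverts T" by (auto simp: good_def)
  have nb: "neighborhood T v \<subseteq> pverts T" using sub by (auto simp: neighborhood_def)
  show ?thesis
  proof
    assume B: "S v = StB"
    with sh v obtain b a where ba: "neighborhood T v = {b, a}" "S b = StB" "S a = StA"
      unfolding local_shape_def neighborhood_def by metis
    have "neighborhood T v \<inter> {w \<in> pverts T. S w = StB \<or> S w = StC} = {b}" using ba nb by auto
    moreover have "degree T v = 2" unfolding degree_eq ba(1) using ba(2,3) by (cases "a = b") auto
    ultimately show "(S v = StB \<or> S v = StC) \<and> degree T v = 2 \<and>
      card (neighborhood T v \<inter> {w \<in> pverts T. S w = StB \<or> S w = StC}) = 1" using B by simp
  next
    assume R: "(S v = StB \<or> S v = StC) \<and> degree T v = 2 \<and>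
      card (neighborhood T v \<inter> {w \<in> pverts T. S w = StB \<or> S w = StC}) = 1"
    show "S v = StB"
    proof (rule ccontr)
      assume "S v \<noteq> StB"
      with R have "S v = StC" by simp
      from local_shape_StC[OF sh v this] obtain p q where pq: "p \<noteq> q" "p \<in> neighborhood T v"
          "q \<in> neighborhood T v" "S p \<in> {StA, StD}" "S q \<in> {StA, StD}"
        by (metis mem_Collect_eq neighborhood_def)
      have finN: "finite (neighborhood T v)" using nb fin finite_subset by blast
      have "neighborhood T v = {p, q}"
        by (rule card_subset_eq[symmetric]) (use finN pq R in \<open>auto simp: degree_eq\<close>)
      then have "neighborhood T v \<inter> {w \<in> pverts T. S w = StB \<or> S w = StC} = {}" using pq by auto
      with R show False by simp
    qed
  qed
qed

theorem theorem2p1: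
  fixes T :: "'a pair_pre_digraph"
  assumes "undirected_tree T" and "card (pverts T) \<ge> 2"
  shows "(roman_excellent T \<longleftrightarrow> (\<exists>S. (T, S) \<in> tree_family)) \<and>
    (\<forall>S. (T, S) \<in> tree_family \<longrightarrow>
      status_set StB (T, S) =
        {x \<in> value_class {0, 2} T. degree T x = 2 \<and>
          card (neighborhood T x \<inter> value_class {0, 2} T) = 1} \<and>
      status_set StA (T, S) = value_class {0, 1} T \<and>
      status_set StD (T, S) = value_class {0, 1, 2} T \<and>
      status_set StC (T, S) = value_class {0, 2} T - status_set StB (T, S))"
proof (intro conjI allI impI)
  interpret utree "pverts T" "parcs T" using undirected_tree_utree assms(1) .
  show "roman_excellent T \<longleftrightarrow> (\<exists>S. (T, S) \<in> tree_family)"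
  proof
    assume "roman_excellent T"
    then have excellent
      unfolding excellent_def roman_excellent_def roman_function_rdf[OF sub] by blast
    then interpret excellent_tree "pverts T" "parcs T" by unfold_locales
    have "\<lparr>pverts = pverts T, parcs = parcs T\<rparr> = T" by (cases T) simp
    with in_tree_family[OF assms(2)] show "\<exists>S. (T, S) \<in> tree_family" by auto
  next
    assume "\<exists>S. (T, S) \<in> tree_family"
    then show "roman_excellent T" using tree_family_certified certified_excellent by blast
  qed
  fix S assume "(T, S) \<in> tree_family"
  then have cert: "certified (T, S)" by (rule tree_family_certified)
  note vc = certified_value_class[OF cert]
  show "status_set StB (T, S) = {x \<in> value_class {0, 2} T. degree T x = 2 \<and>
          card (neighborhood T x \<inter> value_class {0, 2} T) = 1}"
    unfolding vc status_set_def using certified_StB[OF cert] by auto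
  show "status_set StA (T, S) = value_class {0, 1} T" "status_set StD (T, S) = value_class {0, 1, 2} T"
    "status_set StC (T, S) = value_class {0, 2} T - status_set StB (T, S)"
    unfolding vc status_set_def by auto
qed

end
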